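(* Let $a,b,c,d,e,f$ be nonzero complex numbers and $s=\dfrac{a^3q^3}{bcdef}$. With $W_1,W_{1+},S_1,T_1,W_2',W_{2+}',S_2',T_2',L_2'$ as in the context, $$L_2'(1-q)\bigl[(S_1-S_2')W_1W_2'-T_1W_{1+}W_2'+T_2'W_1W_{2+}'\bigr]$$ $$=-q\Bigl(1-\frac ab\Bigr)\Bigl(1-\frac ac\Bigr)\Bigl(1-\frac ad\Bigr)\Bigl(1-\frac ae\Bigr)\Bigl(1-\frac af\Bigr)\frac{(aq)_\infty}{(\frac aq)_\infty}$$ $$\times\left[1+\frac{(\frac aq,\frac{q^2}{a},b,\frac qb,c,\frac qc,d,\frac qd,e,\frac qe,f,\frac qf,\frac{s}{q^2},\frac{q^3}{s})_\infty}{(a,\frac qa,\frac ab,\frac{bq}{a},\frac ac,\frac{cq}{a},\frac ad,\frac{dq}{a},\frac ae,\frac{eq}{a},\frac af,\frac{fq}{a},\frac{s}{aq},\frac{aq^2}{s})_\infty}\right].$$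
   Context: Throughout $q\in\mathbb C$, $0<|q|<1$; $(x)_0=1$, $(x)_k=\prod_{j=0}^{k-1}(1-xq^j)$, $(x)_\infty=\prod_{j\ge 0}(1-xq^j)$, $(x_1,\dots,x_r)_k=\prod_i (x_i)_k$. The very-well-poised series is $${}_8W_7(a;p_1,\dots,p_5;z)=\sum_{k=0}^\infty \frac{1-aq^{2k}}{1-a}\,\frac{(a,p_1,\dots,p_5)_k}{(q,aq/p_1,\dots,aq/p_5)_k}\,z^k,\qquad z=\frac{a^2q^2}{p_1\cdots p_5},$$ for $|z|<1$, and its analytic continuation in the parameters otherwise. Put $$W_1={}_8W_7\bigl(a;b,c,d,e,f;\tfrac{s}{aq}\bigr),\qquad W_{1+}={}_8W_7\bigl(aq^2;bq,cq,dq,eq,fq;\tfrac{s}{aq^2}\bigr),$$ $$S_1=\frac1{1-q}\Bigl(\frac sq+\frac{s}{aq}+\frac{aq}{b}+\frac{aq}{c}+\frac{aq}{d}+\frac{aq}{e}+\frac{aq}{f}-aq\Bigr),$$ $$T_1=\frac{\frac{s}{aq}(1-\frac{s}{aq^2})(1-aq)(1-aq^2)(1-b)(1-c)(1-d)(1-e)(1-f)}{(1-q)(1-\frac{aq}{b})(1-\frac{aq}{c})(1-\frac{aq}{d})(1-\frac{aq}{e})(1-\frac{aq}{f})},$$ $$W_2'={}_8W_7\bigl(\tfrac{cde}{a^2};\tfrac{ce}{a},\tfrac{cd}{a},\tfrac{de}{a},\tfrac qf,\tfrac qb;\tfrac{bf}{a}\bigr),\qquad W_{2+}'={}_8W_7\bigl(\tfrac{cdeq^2}{a^2};\tfrac{ceq}{a},\tfrac{cdq}{a},\tfrac{deq}{a},\tfrac{q^2}{f},\tfrac{q^2}{b};\tfrac{bf}{aq}\bigr),$$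 $$S_2'=\frac1{1-q}\Bigl(q+\frac{cs}{aq}+\frac{ds}{aq}+\frac{es}{aq}+\frac{a^2q}{cde}+\frac{aq}{f}+\frac{aq}{b}-\frac{aq^2}{bf}\Bigr),$$ $$T_2'=\frac{\frac{bfs}{aq^2}(1-\frac{bf}{aq})(1-\frac{cdeq}{a^2})(1-\frac{cdeq^2}{a^2})(1-\frac{cd}{a})(1-\frac{ce}{a})(1-\frac{de}{a})(1-\frac qf)(1-\frac qb)}{(1-q)(1-\frac{cq}{a})(1-\frac{dq}{a})(1-\frac{eq}{a})(1-\frac{cdef}{a^2})(1-\frac{bcde}{a^2})},$$ $$L_2'=\frac{(\frac{q^2}{a},\frac{cdef}{a^2},\frac{bcde}{a^2},\frac{bf}{a})_\infty}{(\frac{cdeq}{a^2},\frac{fq}{a},\frac{bq}{a},\frac{aq^2}{s})_\infty}.$$ Standing assumption: parameters are such that no zero denominators (singularities) occur. *)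

theory Defs
  imports "HOL-Analysis.Analysis"
begin

definition qpoch :: "complex \<Rightarrow> complex \<Rightarrow> nat \<Rightarrow> complex" where
  "qpoch q x k = (\<Prod>j<k. 1 - x * q ^ j)"

definition qpoch_inf :: "complex \<Rightarrow> complex \<Rightarrow> complex" where
  "qpoch_inf q x = prodinf (\<lambda>j. 1 - x * q ^ j)"

definition qpochs_inf :: "complex \<Rightarrow> complex list \<Rightarrow> complex" where
  "qpochs_inf q xs = (\<Prod>x\<leftarrow>xs. qpoch_inf q x)"

text \<open>The very-well-poised series 8W7(a; p1, ..., p5; z). The list ps holds the five
  parameters p1, ..., p5. The argument z is always a^2 q^2 / (p1 ... p5), so it is a function
  of the parameters and not a variable of its own.\<close>

definition W87_arg :: "complex \<Rightarrow> complex \<Rightarrow> complex list \<Rightarrow> complex" where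
  "W87_arg q a ps = a ^ 2 * q ^ 2 / prod_list ps"

definition W87_term :: "complex \<Rightarrow> complex \<Rightarrow> complex list \<Rightarrow> nat \<Rightarrow> complex" where
  "W87_term q a ps k =
     (1 - a * q ^ (2 * k)) / (1 - a)
     * (qpoch q a k * (\<Prod>p\<leftarrow>ps. qpoch q p k))
     / (qpoch q q k * (\<Prod>p\<leftarrow>ps. qpoch q (a * q / p) k))
     * W87_arg q a ps ^ k"

text \<open>The parameters at which neither the terms of the series nor its analytic continuation
  has a singularity. The last condition only matters for |z| \<ge> 1: besides the zeros
  of the denominators of the terms, the continued function has poles exactly along the
  hypersurfaces z = q^(-k), k = 0, 1, 2, ...\<close>

definition W87_regular :: "complex \<Rightarrow> complex \<Rightarrow> complex list \<Rightarrow> bool" where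
  "W87_regular q a ps \<longleftrightarrow>
     length ps = 5 \<and> a \<noteq> 0 \<and> a \<noteq> 1 \<and>
     (\<forall>p\<in>set ps. p \<noteq> 0 \<and> (\<forall>k::nat. 1 - (a * q / p) * q ^ k \<noteq> 0)) \<and>
     (\<forall>k::nat. 1 - W87_arg q a ps * q ^ k \<noteq> 0)"

text \<open>F is analytic as a function of the six parameters (analytic in each of them, which by
  Hartogs' theorem is joint analyticity) on the regular set, and is given by the series where
  |z| < 1. The regular set is (C - {0})^6 without a locally finite union of complex
  hypersurfaces, hence connected, so F is determined on it by these conditions.\<close>

definition is_W87_continuation ::
  "complex \<Rightarrow> (complex \<Rightarrow> complex list \<Rightarrow> complex) \<Rightarrow> bool" where
  "is_W87_continuation q F \<longleftrightarrow>
     (\<forall>a ps. W87_regular q a ps \<longrightarrow>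
        (\<lambda>t. F t ps) analytic_on {a} \<and>
        (\<forall>i<5. (\<lambda>t. F a (ps[i := t])) analytic_on {ps ! i}) \<and>
        (norm (W87_arg q a ps) < 1 \<longrightarrow> F a ps = (\<Sum>k. W87_term q a ps k)))"

definition W87 :: "complex \<Rightarrow> complex \<Rightarrow> complex list \<Rightarrow> complex" where
  "W87 q = (SOME F. is_W87_continuation q F)"

end

theory Submission
  imports Defs "HOL-Complex_Analysis.Complex_Analysis"
begin

text \<open>
  Multiplied by its possible denominators, the series $_8W_7(a;b,c,d,e,f)$ becomes a function
  $\Phi$ that is holomorphic on $(\mathbb C^*)^6$, and the theorem becomes an identity
  between a bilinear form $B$ in $\Phi,\Phi_+$ (for $W_1$ and for $W_2'$) and a difference
  of two theta products. A contiguous relation expresses $\Phi_+$ by $\Phi$ and its shift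
  $(b,f)\to(bq,f/q)$. Hence $B$ is a Casoratian, both with respect to this shift and to its
  inverse, so it is quasi-periodic with multiplier $f/(bq)$; the same holds for $(c,d)$.
  Therefore, for fixed $bf$, the difference of the two sides is as a function of $b$ a theta
  function of degree 2, and it is zero if it has three zeros modulo $q^{\mathbb Z}$.
  The difference vanishes at $b=1$ and $f=1$, where $W_1=1$ and the contiguous series
  telescope. If $cd=aq$, it also vanishes at $be=aq$, where $\Phi=\Phi_+=0$, so it is zero for
  $cd=aq$. If $b=a$, it vanishes as a function of $c$, with $cd$ fixed, at $c=1$, $d=1$ and
  $ce=aq$, hence identically; and $b=a$ is the third zero that is needed in general.\<close>

section \<open>$q$-shifted factorials and theta functions\<close>

text \<open>Series can be compared termwise only where their arguments are small, and the arguments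
  s/(aq) and bf/a of the two series need not be small together. Each relation is therefore proved
  where one parameter is so large that the series converge, and carried to all nonzero parameters by
  the identity theorem. This is why \<open>Phi\<close> must be free of poles. Poles in the argument
  z can only lie at z = q^(-m): the coefficients are h(q^k) with h(x) = sum_m h_m x^m near 0, so
  formally sum_k h(q^k) z^k = sum_m h_m / (1 - z q^m), and (z)_inf removes them all.

  The solutions of phi(bq) = kappa b^(-2) phi(b) form a space of dimension two, so three zeros
  suffice for every kappa, provided that they are distinct modulo powers of q. As they collide for
  special parameters, an auxiliary variable t moves them apart, and t = 1 is recovered by
  continuity.

  Quasi-periodicity costs no further series identity: the Casoratians for a shift and for its
  inverse contain the same two products of series, with proportional coefficients.\<close>

locale nome =
  fixes q :: complex
  assumes q_nonzero [simp]: "q \<noteq> 0" and norm_q_less_1: "norm q < 1"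
begin

lemma q_power_tendsto_0: "(\<lambda>k. q ^ k) \<longlonglongrightarrow> 0"
  using norm_q_less_1 by (rule LIMSEQ_power_zero)

lemma summable_norm_q_power: "summable (\<lambda>j. norm (q ^ j))"
  using norm_q_less_1 by (simp add: norm_power summable_geometric)

lemma convergent_prod_qpoch: "convergent_prod (\<lambda>j. 1 - x * q ^ j)"
proof (rule abs_convergent_prod_imp_convergent_prod, rule summable_imp_abs_convergent_prod)
  show "summable (\<lambda>j. norm (1 - x * q ^ j - 1))"
    using summable_mult[OF summable_norm_q_power, of "norm x"] by (simp add: norm_mult)
qed

lemma qpoch_inf_split: "qpoch_inf q x = qpoch q x k * qpoch_inf q (x * q ^ k)"
proof (induction k)
  case 0
  show ?case by (simp add: qpoch_def)
next
  case (Suc k)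
  let ?y = "x * q ^ k"
  \<comment> \<open>If no factor vanishes, the first one is split off the convergent product;
    otherwise both sides are 0.\<close>
  have "qpoch_inf q ?y = (1 - ?y) * qpoch_inf q (?y * q)"
  proof (cases "\<exists>j. 1 - ?y * q ^ j = 0")
    case False
    then have "prodinf (\<lambda>j. 1 - ?y * q ^ j) =
        prodinf (\<lambda>j. 1 - ?y * q ^ (j + 1)) * (\<Prod>j<1. 1 - ?y * q ^ j)"
      by (intro prodinf_split_initial_segment convergent_prod_qpoch) blast
    then show ?thesis by (simp add: qpoch_inf_def mult_ac)
  next
    case True
    have zero: "qpoch_inf q w = 0" if "1 - w * q ^ j = 0" for w j
      using convergent_prod_has_prod[OF convergent_prod_qpoch, of w] that
      by (auto simp: qpoch_inf_def has_prod_eq_0_iff)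
    obtain j where j: "1 - ?y * q ^ j = 0"
      using True by blast
    show ?thesis
    proof (cases j)
      case 0
      then show ?thesis using j zero[of ?y 0] by simp
    next
      case (Suc i)
      then have "1 - ?y * q * q ^ i = 0" using j by (simp add: mult_ac)
      then show ?thesis using zero[OF j] zero[of "?y * q" i] by simp
    qed
  qed
  then have "qpoch_inf q x = qpoch q x k * ((1 - ?y) * qpoch_inf q (?y * q))"
    using Suc.IH by metis
  then show ?case by (simp add: qpoch_def mult_ac)
qed

lemma qpoch_inf_rec: "qpoch_inf q x = (1 - x) * qpoch_inf q (x * q)"
  using qpoch_inf_split[of x 1] by (simp add: qpoch_def)

lemma qpoch_inf_eq_0_iff: "qpoch_inf q x = 0 \<longleftrightarrow> (\<exists>j. x * q ^ j = 1)"
proof -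
  have "qpoch_inf q x = 0 \<longleftrightarrow> (\<exists>j. 1 - x * q ^ j = 0)"
    using has_prod_eq_0_iff[OF convergent_prod_has_prod[OF convergent_prod_qpoch, of x]]
    by (auto simp: qpoch_inf_def)
  then show ?thesis by (simp add: eq_commute[of 1])
qed

lemma qpoch_inf_1 [simp]: "qpoch_inf q 1 = 0"
  by (auto simp: qpoch_inf_eq_0_iff intro!: exI[of _ 0])

lemma qpoch_inf_0 [simp]: "qpoch_inf q 0 = 1"
  by (simp add: qpoch_inf_def)

lemma qpoch_inf_nonzero: "norm x < 1 \<Longrightarrow> qpoch_inf q x \<noteq> 0"
proof
  assume "norm x < 1" "qpoch_inf q x = 0"
  then obtain j where "x * q ^ j = 1" by (auto simp: qpoch_inf_eq_0_iff)
  then have "norm x * norm q ^ j = 1" by (metis norm_mult norm_one norm_power)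
  moreover have "norm x * norm q ^ j \<le> norm x * 1"
    using norm_q_less_1 by (intro mult_left_mono power_le_one) auto
  ultimately show False using \<open>norm x < 1\<close> by simp
qed

lemma qpoch_tendsto: "(\<lambda>k. qpoch q x k) \<longlonglongrightarrow> qpoch_inf q x"
proof -
  have "(\<lambda>k. \<Prod>j\<le>k. 1 - x * q ^ j) \<longlonglongrightarrow> prodinf (\<lambda>j. 1 - x * q ^ j)"
    by (rule convergent_prod_LIMSEQ[OF convergent_prod_qpoch])
  then show ?thesis
    by (subst filterlim_sequentially_Suc[symmetric])
      (simp add: qpoch_inf_def qpoch_def lessThan_Suc_atMost)
qed

text \<open>Locally uniform limit of the partial products: on a disc the deviations |y q^j| of the
  factors from 1 are dominated by a geometric series.\<close>

lemma holomorphic_qpoch_inf: "qpoch_inf q holomorphic_on UNIV"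
proof (rule holomorphic_uniform_sequence)
  show "open (UNIV :: complex set)" by simp
  show "(\<lambda>x. qpoch q x n) holomorphic_on UNIV" for n
    unfolding qpoch_def by (intro holomorphic_intros)
  fix x :: complex
  have "uniformly_convergent_on (cball x 1) (\<lambda>n y. \<Prod>j<n. 1 - y * q ^ j)"
  proof (rule uniformly_convergent_on_prod')
    show "uniformly_convergent_on (cball x 1) (\<lambda>n y. \<Sum>j<n. norm (1 - y * q ^ j - 1))"
    proof (rule Weierstrass_m_test'_ev)
      show "\<forall>\<^sub>F j in sequentially. \<forall>y\<in>cball x 1.
          norm (norm (1 - y * q ^ j - 1)) \<le> (norm x + 1) * norm (q ^ j)"
      proof (intro always_eventually allI ballI)
        fix j y assume "y \<in> cball x 1"
        then have "norm y \<le> norm x + 1"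
          using norm_triangle_sub[of y x] by (simp add: dist_norm norm_minus_commute)
        then show "norm (norm (1 - y * q ^ j - 1)) \<le> (norm x + 1) * norm (q ^ j)"
          by (simp add: norm_mult mult_right_mono)
      qed
      show "summable (\<lambda>j. (norm x + 1) * norm (q ^ j))"
        by (intro summable_mult summable_norm_q_power)
    qed
  qed (auto intro!: continuous_intros)
  then have "uniform_limit (cball x 1) (\<lambda>n y. \<Prod>j<n. 1 - y * q ^ j)
      (\<lambda>y. lim (\<lambda>n. \<Prod>j<n. 1 - y * q ^ j)) sequentially"
    by (simp add: uniformly_convergent_uniform_limit_iff)
  moreover have "lim (\<lambda>n. \<Prod>j<n. 1 - y * q ^ j) = qpoch_inf q y" for y
    using limI[OF qpoch_tendsto[of y]] by (simp add: qpoch_def)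
  ultimately have "uniform_limit (cball x 1) (\<lambda>n y. qpoch q y n) (qpoch_inf q) sequentially"
    by (simp add: qpoch_def)
  then show "\<exists>d>0. cball x d \<subseteq> UNIV \<and>
      uniform_limit (cball x d) (\<lambda>n y. qpoch q y n) (qpoch_inf q) sequentially"
    by (intro exI[of _ 1]) auto
qed

lemma holomorphic_qpoch_inf' [holomorphic_intros]:
  "f holomorphic_on A \<Longrightarrow> (\<lambda>t. qpoch_inf q (f t)) holomorphic_on A"
  using holomorphic_on_compose_gen[OF _ holomorphic_qpoch_inf, of f A] by (simp add: o_def)

lemma continuous_qpoch_inf [continuous_intros]:
  "continuous_on A f \<Longrightarrow> continuous_on A (\<lambda>t. qpoch_inf q (f t))"
  by (rule continuous_on_compose2[OF holomorphic_on_imp_continuous_on[OF holomorphic_qpoch_inf]])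
    auto

lemma qpoch_inf_q_power_tendsto: "(\<lambda>k. qpoch_inf q (x * q ^ k)) \<longlonglongrightarrow> 1"
proof -
  have "isCont (qpoch_inf q) 0"
    using holomorphic_on_imp_continuous_on[OF holomorphic_qpoch_inf]
    by (simp add: continuous_on_eq_continuous_at)
  moreover have "(\<lambda>k. x * q ^ k) \<longlonglongrightarrow> 0"
    using tendsto_mult_right_zero[OF q_power_tendsto_0] by simp
  ultimately show ?thesis
    using isCont_tendsto_compose[of 0 "qpoch_inf q" "\<lambda>k. x * q ^ k"] by simp
qed

lemma qpoch_Suc: "qpoch q x (Suc k) = qpoch q x k * (1 - x * q ^ k)"
  by (simp add: qpoch_def)

lemma qpoch_Suc': "qpoch q x (Suc k) = (1 - x) * qpoch q (x * q) k"
  by (simp add: qpoch_def prod.lessThan_Suc_shift mult_ac del: prod.lessThan_Suc)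

lemma qpoch_0 [simp]: "qpoch q x 0 = 1"
  by (simp add: qpoch_def)

lemma holomorphic_qpoch [holomorphic_intros]:
  "f holomorphic_on A \<Longrightarrow> (\<lambda>t. qpoch q (f t) k) holomorphic_on A"
  unfolding qpoch_def by (intro holomorphic_intros)

text \<open>The modified Jacobi theta function of nome q, with simple zeros exactly at the integer
  powers of q. Division by zero makes its value at 0 equal to 1.\<close>

definition theta :: "complex \<Rightarrow> complex" where
  "theta x = qpoch_inf q x * qpoch_inf q (q / x)"

lemma theta_inversion: "theta (q / x) = theta x"
  by (cases "x = 0") (simp_all add: theta_def)

lemma theta_shift:
  assumes "x \<noteq> 0"
  shows "theta (x * q) = - theta x / x"
proof -
  have "qpoch_inf q (1 / x) = (1 - 1 / x) * qpoch_inf q (q / x)"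
    using qpoch_inf_rec[of "1 / x"] by simp
  moreover have "q / (x * q) = 1 / x" by simp
  ultimately have "theta (x * q) = qpoch_inf q (x * q) * ((1 - 1 / x) * qpoch_inf q (q / x))"
    by (simp only: theta_def)
  also have "\<dots> = - ((1 - x) * qpoch_inf q (x * q)) * qpoch_inf q (q / x) / x"
    using assms by (simp add: field_simps)
  finally show ?thesis
    by (simp add: theta_def qpoch_inf_rec[of x])
qed

lemma theta_shift_down:
  assumes "x \<noteq> 0"
  shows "theta (x / q) = - (x / q) * theta x"
proof -
  have "theta x = - theta (x / q) / (x / q)"
    using theta_shift[of "x / q"] assms by simp
  then show ?thesis using assms by (simp only:) (simp add: divide_simps)
qed

lemma theta_1 [simp]: "theta 1 = 0" "theta q = 0"
  by (simp_all add: theta_def)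

lemma holomorphic_theta [holomorphic_intros]:
  "f holomorphic_on A \<Longrightarrow> (\<And>t. t \<in> A \<Longrightarrow> f t \<noteq> 0) \<Longrightarrow> (\<lambda>t. theta (f t)) holomorphic_on A"
  unfolding theta_def by (intro holomorphic_intros) auto

section \<open>Continuation of power series with geometrically convergent coefficients\<close>


text \<open>The coefficients of the power series of c multiplied by (1 - z)(1 - zq)...(1 - z
  q^(N-1)), the polynomial that cancels its first N poles.\<close>

primrec qdiff :: "nat \<Rightarrow> (nat \<Rightarrow> complex) \<Rightarrow> nat \<Rightarrow> complex" where
  "qdiff 0 c = c"
| "qdiff (Suc N) c = (\<lambda>k. qdiff N c k - q ^ N * (if k = 0 then 0 else qdiff N c (k - 1)))"

text \<open>The coefficients are values at q^k of a function holomorphic near 0, with radius and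
  bound uniform in t. Only large k matter, since finitely many coefficients change the series by a
  polynomial.\<close>

definition qtail_on :: "'t set \<Rightarrow> ('t \<Rightarrow> nat \<Rightarrow> complex) \<Rightarrow> bool" where
  "qtail_on U c \<longleftrightarrow> (\<exists>r>0. \<exists>M. \<forall>t\<in>U. \<exists>h. h holomorphic_on ball 0 r \<and>
     (\<forall>x\<in>ball 0 r. norm (h x) \<le> M) \<and> (\<forall>k. norm (q ^ k) < r \<longrightarrow> c t k = h (q ^ k)))"

section \<open>Coefficient sequences of the form h(q^k)\<close>

lemma qtail_onI:
  assumes "r > 0" "\<And>t. t \<in> U \<Longrightarrow> h t holomorphic_on ball 0 r"
    "\<And>t x. t \<in> U \<Longrightarrow> norm x < r \<Longrightarrow> norm (h t x) \<le> M"
    "\<And>t k. t \<in> U \<Longrightarrow> norm (q ^ k) < r \<Longrightarrow> c t k = h t (q ^ k)"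
  shows "qtail_on U c"
  unfolding qtail_on_def
proof (rule exI[of _ r], rule conjI[OF assms(1)], rule exI[of _ M], rule ballI)
  fix t assume "t \<in> U"
  then show "\<exists>h. h holomorphic_on ball 0 r \<and> (\<forall>x\<in>ball 0 r. norm (h x) \<le> M) \<and>
      (\<forall>k. norm (q ^ k) < r \<longrightarrow> c t k = h (q ^ k))"
    using assms by (intro exI[of _ "h t"]) auto
qed

lemma qtail_on_subset: "qtail_on U c \<Longrightarrow> V \<subseteq> U \<Longrightarrow> qtail_on V c"
  unfolding qtail_on_def by blast

lemma qtail_on_mult:
  assumes "qtail_on U c" "qtail_on U c'"
  shows "qtail_on U (\<lambda>t k. c t k * c' t k)"
proof -
  obtain r M where r: "r > 0" "\<forall>t\<in>U. \<exists>h. h holomorphic_on ball 0 r \<and>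
     (\<forall>x\<in>ball 0 r. norm (h x) \<le> M) \<and> (\<forall>k. norm (q ^ k) < r \<longrightarrow> c t k = h (q ^ k))"
    using assms(1) unfolding qtail_on_def by blast
  obtain r' M' where r': "r' > 0" "\<forall>t\<in>U. \<exists>h. h holomorphic_on ball 0 r' \<and>
     (\<forall>x\<in>ball 0 r'. norm (h x) \<le> M') \<and> (\<forall>k. norm (q ^ k) < r' \<longrightarrow> c' t k = h (q ^ k))"
    using assms(2) unfolding qtail_on_def by blast
  show ?thesis
    unfolding qtail_on_def
  proof (rule exI[of _ "min r r'"], rule conjI, use r r' in simp, rule exI[of _ "M * M'"], rule ballI)
    fix t assume "t \<in> U"
    obtain h where h: "h holomorphic_on ball 0 r" "\<forall>x\<in>ball 0 r. norm (h x) \<le> M"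
      "\<forall>k. norm (q ^ k) < r \<longrightarrow> c t k = h (q ^ k)" using r \<open>t \<in> U\<close> by blast
    obtain h' where h': "h' holomorphic_on ball 0 r'" "\<forall>x\<in>ball 0 r'. norm (h' x) \<le> M'"
      "\<forall>k. norm (q ^ k) < r' \<longrightarrow> c' t k = h' (q ^ k)" using r' \<open>t \<in> U\<close> by blast
    have "(\<lambda>x. h x * h' x) holomorphic_on ball 0 (min r r')"
      by (intro holomorphic_intros holomorphic_on_subset[OF h(1)] holomorphic_on_subset[OF h'(1)]) auto
    moreover have "norm (h x * h' x) \<le> M * M'" if "x \<in> ball 0 (min r r')" for x
    proof -
      have "norm (h x) \<le> M" "norm (h' x) \<le> M'" using h(2) h'(2) that by auto
      moreover from this have "0 \<le> M" by (meson norm_ge_zero order_trans)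
      ultimately show ?thesis by (simp add: norm_mult mult_mono)
    qed
    ultimately show "\<exists>h. h holomorphic_on ball 0 (min r r') \<and>
      (\<forall>x\<in>ball 0 (min r r'). norm (h x) \<le> M * M') \<and>
      (\<forall>k. norm (q ^ k) < min r r' \<longrightarrow> c t k * c' t k = h (q ^ k))"
      using h(3) h'(3) by (intro exI[of _ "\<lambda>x. h x * h' x"]) auto
  qed
qed

lemma continuous_bounded_on_cball:
  fixes f :: "complex \<Rightarrow> complex"
  assumes "continuous_on (cball 0 L) f"
  obtains M where "\<And>x. x \<in> cball 0 L \<Longrightarrow> norm (f x) \<le> M"
proof -
  have "bounded (f ` cball 0 L)"
    by (intro compact_imp_bounded compact_continuous_image assms compact_cball)
  then show ?thesis using that unfolding bounded_iff by blast
qed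

lemma continuous_on_qpoch_inf: "continuous_on A (qpoch_inf q)"
  by (intro holomorphic_on_imp_continuous_on holomorphic_on_subset[OF holomorphic_qpoch_inf]) simp

lemma qtail_on_qpoch_inf:
  assumes "\<And>t. t \<in> U \<Longrightarrow> norm (\<beta> t) \<le> L"
  shows "qtail_on U (\<lambda>t k. qpoch_inf q (\<beta> t * q ^ k))"
proof -
  obtain M where M: "\<And>x. x \<in> cball 0 (max L 0) \<Longrightarrow> norm (qpoch_inf q x) \<le> M"
    using continuous_bounded_on_cball[OF continuous_on_qpoch_inf] by blast
  show ?thesis
  proof (rule qtail_onI[where r = 1 and M = M and h = "\<lambda>t x. qpoch_inf q (\<beta> t * x)"])
    fix t x assume tx: "t \<in> U" "norm (x :: complex) < 1"
    then have "norm (\<beta> t * x) \<le> max L 0 * 1"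
      unfolding norm_mult using assms[OF tx(1)] by (intro mult_mono) auto
    then show "norm (qpoch_inf q (\<beta> t * x)) \<le> M" by (intro M) simp
  next
    show "(\<lambda>x. qpoch_inf q (\<beta> t * x)) holomorphic_on ball 0 1" for t
      by (intro holomorphic_intros)
  qed simp_all
qed

text \<open>Since (x)_k = (x)_inf / (x q^k)_inf, the function is h(y) = (x)_inf / (x y)_inf with x =
  \<beta> t. The radius 1/(2L') keeps |x y| at most 1/2, away from the zeros of the
  denominator.\<close>

lemma qtail_on_qpoch:
  assumes "\<And>t. t \<in> U \<Longrightarrow> norm (\<beta> t) \<le> L"
  shows "qtail_on U (\<lambda>t k. qpoch q (\<beta> t) k)"
proof -
  define L' where "L' = max L 1"
  have L': "L' > 0" by (simp add: L'_def)
  obtain M where M: "\<And>x. x \<in> cball 0 L' \<Longrightarrow> norm (qpoch_inf q x) \<le> M"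
    using continuous_bounded_on_cball[OF continuous_on_qpoch_inf] by blast
  have "continuous_on (cball 0 (1 / 2)) (\<lambda>x. 1 / qpoch_inf q x)"
    by (intro continuous_on_divide continuous_on_const continuous_on_qpoch_inf ballI
        qpoch_inf_nonzero) simp
  then obtain M' where M': "\<And>x. x \<in> cball 0 (1 / 2) \<Longrightarrow> norm (1 / qpoch_inf q x) \<le> M'"
    using continuous_bounded_on_cball by blast
  have small: "norm (\<beta> t * x) \<le> 1 / 2" if "t \<in> U" "norm x < 1 / (2 * L')" for t and x :: complex
  proof -
    have "norm (\<beta> t) * norm x \<le> L' * (1 / (2 * L'))"
      using that assms[of t] L' by (intro mult_mono) (auto simp: L'_def)
    also have "\<dots> = 1 / 2" using L' by simp
    finally show ?thesis by (simp add: norm_mult)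
  qed
  show ?thesis
  proof (rule qtail_onI[where r = "1 / (2 * L')" and M = "M * M'"
        and h = "\<lambda>t x. qpoch_inf q (\<beta> t) * (1 / qpoch_inf q (\<beta> t * x))"])
    show "1 / (2 * L') > 0" using L' by simp
  next
    fix t assume t: "t \<in> U"
    show "(\<lambda>x. qpoch_inf q (\<beta> t) * (1 / qpoch_inf q (\<beta> t * x))) holomorphic_on ball 0 (1 / (2 * L'))"
    proof (intro holomorphic_intros qpoch_inf_nonzero)
      fix x :: complex assume "x \<in> ball 0 (1 / (2 * L'))"
      then show "norm (\<beta> t * x) < 1" using small[OF t, of x] by simp
    qed
    fix k assume "norm (q ^ k) < 1 / (2 * L')"
    then have "qpoch_inf q (\<beta> t * q ^ k) \<noteq> 0"
      using small[OF t, of "q ^ k"] by (intro qpoch_inf_nonzero) simp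
    then show "qpoch q (\<beta> t) k = qpoch_inf q (\<beta> t) * (1 / qpoch_inf q (\<beta> t * q ^ k))"
      using qpoch_inf_split[of "\<beta> t" k] by simp
  next
    fix t and x :: complex assume tx: "t \<in> U" "norm x < 1 / (2 * L')"
    have a: "norm (qpoch_inf q (\<beta> t)) \<le> M"
      using assms[OF tx(1)] by (intro M) (auto simp: L'_def)
    have b: "norm (1 / qpoch_inf q (\<beta> t * x)) \<le> M'"
      using small[OF tx] by (intro M') auto
    have "0 \<le> M" using a by (meson norm_ge_zero order_trans)
    then show "norm (qpoch_inf q (\<beta> t) * (1 / qpoch_inf q (\<beta> t * x))) \<le> M * M'"
      unfolding norm_mult by (intro mult_mono a b norm_ge_zero)
  qed
qed

lemma holomorphic_divide_vanishing:
  assumes hol: "g holomorphic_on ball 0 r" and r: "r > 0" and g0: "g 0 = 0"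
    and bound: "\<And>x. norm x < r \<Longrightarrow> norm (g x) \<le> M"
  obtains h where "h holomorphic_on ball 0 r" "\<And>x. norm x < r \<Longrightarrow> g x = x * h x"
    "\<And>x. norm x < r \<Longrightarrow> x \<noteq> 0 \<Longrightarrow> norm (h x) \<le> (M + 1) / r"
proof -
  obtain h where h: "h holomorphic_on ball 0 r" "\<And>x. norm x < r \<Longrightarrow> g x = x * h x"
    and "deriv g 0 = h 0"
    by (rule Schwarz3[OF hol g0]) (rule that)
  have M0: "M \<ge> 0" using bound[of 0] r g0 by simp
  have "norm (h x) \<le> (M + 1) / r" if x: "norm x < r" "x \<noteq> 0" for x
  proof -
    \<comment> \<open>Rescaling to the unit disc for the Schwarz lemma. Dividing by M + 1 instead of
      M gives the strict bound |f| < 1 and is harmless for M = 0.\<close>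
    define f where "f w = g (of_real r * w) / of_real (M + 1)" for w
    have lt: "norm (of_real r * w) < r" if "norm w < 1" for w :: complex
      using that r by (simp add: norm_mult)
    have 1: "f holomorphic_on ball 0 1"
      unfolding f_def using M0 lt
      by (intro holomorphic_intros holomorphic_on_compose_gen[OF _ hol, unfolded o_def])
        (auto simp: complex_eq_iff)
    have 2: "norm (f w) < 1" if "norm w < 1" for w
    proof -
      have "norm (g (of_real r * w)) < M + 1"
        using bound[OF lt[OF that]] by simp
      then show ?thesis using M0 by (simp add: f_def norm_divide del: of_real_add)
    qed
    have "f 0 = 0" by (simp add: f_def g0)
    then have "norm (f (x / of_real r)) \<le> norm (x / of_real r)"
      using Schwarz_Lemma(1)[OF 1 _ 2, of "x / of_real r"] x r by (simp add: norm_divide)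
    then have "norm (g x) / (M + 1) \<le> norm x / r"
      using r M0 by (simp add: f_def norm_divide del: of_real_add)
    then have "norm x * norm (h x) \<le> norm x * ((M + 1) / r)"
      using h(2)[OF x(1)] r M0 by (simp add: norm_mult divide_simps mult_ac split: if_splits)
    then show ?thesis using x by (subst (asm) mult_le_cancel_left_pos) auto
  qed
  with h(1,2) show ?thesis by (rule that)
qed

text \<open>Each difference step gains a factor q^k: it replaces h(x) by h(x) - h(x/q), which
  vanishes at 0 and so is divisible by x. The radius shrinks by |q| because x/q has to stay in the
  disc.\<close>

lemma qdiff_representation:
  assumes "qtail_on U c"
  shows "\<exists>r M. 0 < r \<and> r \<le> 1 \<and> 0 \<le> M \<and> (\<forall>t\<in>U. \<exists>h. h holomorphic_on ball 0 r \<and>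
    (\<forall>x\<in>ball 0 r. x \<noteq> 0 \<longrightarrow> norm (h x) \<le> M) \<and>
    (\<forall>k. norm (q ^ k) < r \<longrightarrow> qdiff N (c t) k = q ^ (N * k) * h (q ^ k)))"
proof (induction N)
  case 0
  obtain r M where r: "r > 0" "\<forall>t\<in>U. \<exists>h. h holomorphic_on ball 0 r \<and>
     (\<forall>x\<in>ball 0 r. norm (h x) \<le> M) \<and> (\<forall>k. norm (q ^ k) < r \<longrightarrow> c t k = h (q ^ k))"
    using assms unfolding qtail_on_def by blast
  show ?case
  proof (rule exI[of _ "min r 1"], rule exI[of _ "max M 0"], intro conjI ballI)
    fix t assume "t \<in> U"
    then obtain h where h: "h holomorphic_on ball 0 r" "\<forall>x\<in>ball 0 r. norm (h x) \<le> M"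
      "\<forall>k. norm (q ^ k) < r \<longrightarrow> c t k = h (q ^ k)" using r by blast
    show "\<exists>h. h holomorphic_on ball 0 (min r 1) \<and>
      (\<forall>x\<in>ball 0 (min r 1). x \<noteq> 0 \<longrightarrow> norm (h x) \<le> max M 0) \<and>
      (\<forall>k. norm (q ^ k) < min r 1 \<longrightarrow> qdiff 0 (c t) k = q ^ (0 * k) * h (q ^ k))"
      using h by (intro exI[of _ h] conjI holomorphic_on_subset[OF h(1)])
        (auto simp: le_max_iff_disj)
  qed (use r in auto)
next
  case (Suc N)
  then obtain r M where r: "0 < r" "r \<le> 1" "0 \<le> M" and
    rep: "\<forall>t\<in>U. \<exists>h. h holomorphic_on ball 0 r \<and>
      (\<forall>x\<in>ball 0 r. x \<noteq> 0 \<longrightarrow> norm (h x) \<le> M) \<and>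
      (\<forall>k. norm (q ^ k) < r \<longrightarrow> qdiff N (c t) k = q ^ (N * k) * h (q ^ k))"
    by blast
  define r' where "r' = r * norm q"
  have r': "0 < r'" "r' < r" "r' < 1"
  proof -
    show "0 < r'" using r by (simp add: r'_def)
    show "r' < r" using r norm_q_less_1 by (simp add: r'_def)
    then show "r' < 1" using r by linarith
  qed
  have scale: "norm (x / q) < r" if "norm x < r'" for x
    using that by (simp add: r'_def norm_divide divide_simps)
  show ?case
  proof (rule exI[of _ r'], rule exI[of _ "(2 * M + 1) / r'"], intro conjI ballI)
    fix t assume "t \<in> U"
    then obtain h where h: "h holomorphic_on ball 0 r"
      and h2': "\<forall>x\<in>ball 0 r. x \<noteq> 0 \<longrightarrow> norm (h x) \<le> M"
      and h3': "\<forall>k. norm (q ^ k) < r \<longrightarrow> qdiff N (c t) k = q ^ (N * k) * h (q ^ k)"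
      using rep by blast
    have h2: "norm (h x) \<le> M" if "norm x < r" "x \<noteq> 0" for x using h2' that by simp
    have h3: "qdiff N (c t) k = q ^ (N * k) * h (q ^ k)" if "norm (q ^ k) < r" for k
      using h3' that by blast
    define g where "g x = h x - h (x / q)" for x
    have "g holomorphic_on ball 0 r'"
      unfolding g_def using r' scale
      by (intro holomorphic_intros holomorphic_on_subset[OF h]
          holomorphic_on_compose_gen[OF _ h, unfolded o_def]) auto
    moreover have "norm (g x) \<le> 2 * M" if "norm x < r'" for x
    proof (cases "x = 0")
      case False
      have "norm (g x) \<le> norm (h x) + norm (h (x / q))"
        unfolding g_def by (rule norm_triangle_ineq4)
      then show ?thesis
        using h2[of x] h2[OF scale[OF that]] that r' False q_nonzero by simp
    qed (use r in \<open>auto simp: g_def\<close>)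
    ultimately obtain h' where h': "h' holomorphic_on ball 0 r'"
      "\<And>x. norm x < r' \<Longrightarrow> g x = x * h' x"
      "\<And>x. norm x < r' \<Longrightarrow> x \<noteq> 0 \<Longrightarrow> norm (h' x) \<le> (2 * M + 1) / r'"
      using holomorphic_divide_vanishing[of g r' "2 * M"] r' by (auto simp: g_def)
    have "qdiff (Suc N) (c t) k = q ^ (Suc N * k) * h' (q ^ k)" if k: "norm (q ^ k) < r'" for k
    proof -
      \<comment> \<open>The index 0 is excluded because |q^0| = 1 exceeds r'.\<close>
      obtain j where j: "k = Suc j" using k r' by (cases k) auto
      have qk: "q ^ k / q = q ^ j" by (simp add: j)
      have "qdiff (Suc N) (c t) k = q ^ (N * k) * h (q ^ k) - q ^ N * (q ^ (N * j) * h (q ^ j))"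
        using h3[of k] h3[of j] scale[OF k] k r' unfolding qk by (simp add: j)
      also have "\<dots> = q ^ (N * k) * g (q ^ k)"
        by (simp add: g_def qk j algebra_simps power_add)
      also have "\<dots> = q ^ (Suc N * k) * h' (q ^ k)"
        using h'(2)[OF k] by (simp add: power_add mult_ac)
      finally show ?thesis .
    qed
    with h' show "\<exists>h. h holomorphic_on ball 0 r' \<and>
      (\<forall>x\<in>ball 0 r'. x \<noteq> 0 \<longrightarrow> norm (h x) \<le> (2 * M + 1) / r') \<and>
      (\<forall>k. norm (q ^ k) < r' \<longrightarrow> qdiff (Suc N) (c t) k = q ^ (Suc N * k) * h (q ^ k))"
      by (intro exI[of _ h']) auto
  qed (use r r' in auto)
qed

lemma qdiff_bound:
  assumes "qtail_on U c"
  shows "\<exists>C K. \<forall>t\<in>U. \<forall>k\<ge>K. norm (qdiff N (c t) k) \<le> C * norm (q ^ N) ^ k"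
proof -
  obtain r M where r: "0 < r" "0 \<le> M" and
    rep: "\<forall>t\<in>U. \<exists>h. h holomorphic_on ball 0 r \<and>
      (\<forall>x\<in>ball 0 r. x \<noteq> 0 \<longrightarrow> norm (h x) \<le> M) \<and>
      (\<forall>k. norm (q ^ k) < r \<longrightarrow> qdiff N (c t) k = q ^ (N * k) * h (q ^ k))"
    using qdiff_representation[OF assms, of N] by blast
  have "eventually (\<lambda>k. norm (q ^ k) < r) sequentially"
    using tendstoD[OF q_power_tendsto_0 r(1)] by simp
  then obtain K where K: "\<And>k. k \<ge> K \<Longrightarrow> norm (q ^ k) < r"
    by (auto simp: eventually_sequentially)
  show ?thesis
  proof (intro exI[of _ K] exI[of _ M] ballI allI impI)
    fix t k assume t: "t \<in> U" and k: "k \<ge> K"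
    obtain h where "\<forall>x\<in>ball 0 r. x \<noteq> 0 \<longrightarrow> norm (h x) \<le> M"
      "\<forall>k. norm (q ^ k) < r \<longrightarrow> qdiff N (c t) k = q ^ (N * k) * h (q ^ k)"
      using rep t by blast
    then have "norm (h (q ^ k)) \<le> M" "qdiff N (c t) k = q ^ (N * k) * h (q ^ k)"
      using K[OF k] by auto
    then show "norm (qdiff N (c t) k) \<le> M * norm (q ^ N) ^ k"
      by (simp add: norm_mult norm_power power_mult mult.commute mult_right_mono)
  qed
qed

text \<open>The continuation of (z)_inf times the sum of c_k z^k. The first N factors of (z)_inf are
  absorbed into the coefficients, after which the series converges for |z q^N| < 1. The least such N
  only serves to fix a value: \<open>qext_eq\<close> shows that every admissible N gives the same
  one.\<close>

definition qext :: "(nat \<Rightarrow> complex) \<Rightarrow> complex \<Rightarrow> complex" where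
  "qext c z = (let N = LEAST N. norm (z * q ^ N) < 1
     in qpoch_inf q (z * q ^ N) * (\<Sum>k. qdiff N c k * z ^ k))"

lemma qdiff_summable:
  assumes "qtail_on {t} (\<lambda>_. c)" "norm (z * q ^ N) < 1"
  shows "summable (\<lambda>k. norm (qdiff N c k * z ^ k))"
proof -
  obtain C K where CK: "\<forall>t'\<in>{t}. \<forall>k\<ge>K. norm (qdiff N c k) \<le> C * norm (q ^ N) ^ k"
    using qdiff_bound[OF assms(1), of N] by (elim exE)
  show ?thesis
  proof (rule summable_comparison_test_ev)
    show "\<forall>\<^sub>F k in sequentially. norm (norm (qdiff N c k * z ^ k)) \<le> C * norm (z * q ^ N) ^ k"
      unfolding eventually_sequentially
    proof (intro exI[of _ K] allI impI)
      fix k assume "k \<ge> K"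
      then have "norm (qdiff N c k) * norm z ^ k \<le> C * norm (q ^ N) ^ k * norm z ^ k"
        using CK by (intro mult_right_mono) auto
      then show "norm (norm (qdiff N c k * z ^ k)) \<le> C * norm (z * q ^ N) ^ k"
        by (simp add: norm_mult norm_power power_mult_distrib mult_ac)
    qed
    show "summable (\<lambda>k. C * norm (z * q ^ N) ^ k)"
      using assms(2) by (intro summable_mult summable_geometric) auto
  qed
qed

lemma suminf_qdiff_Suc:
  assumes "summable (\<lambda>k. norm (qdiff N c k * z ^ k))"
  shows "(\<Sum>k. qdiff (Suc N) c k * z ^ k) = (1 - z * q ^ N) * (\<Sum>k. qdiff N c k * z ^ k)"
proof -
  let ?a = "\<lambda>k. qdiff N c k * z ^ k"
  let ?b = "\<lambda>k. q ^ N * (if k = 0 then 0 else qdiff N c (k - 1)) * z ^ k"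
  have a: "?a sums (\<Sum>k. ?a k)"
    by (rule summable_sums[OF summable_norm_cancel[OF assms]])
  then have "(\<lambda>k. z * q ^ N * ?a k) sums (z * q ^ N * (\<Sum>k. ?a k))"
    by (rule sums_mult)
  moreover have "(\<lambda>k. z * q ^ N * ?a k) = (\<lambda>k. ?b (Suc k))"
    by (simp add: fun_eq_iff mult_ac)
  ultimately have "(\<lambda>k. ?b (Suc k)) sums (z * q ^ N * (\<Sum>k. ?a k))" by metis
  then have "?b sums (z * q ^ N * (\<Sum>k. ?a k) + ?b 0)"
    by (rule sums_Suc)
  then have "?b sums (z * q ^ N * (\<Sum>k. ?a k))" by simp
  from sums_diff[OF a this] show ?thesis
    by (simp add: sums_iff algebra_simps)
qed

text \<open>Passing from M to M + 1 moves the factor 1 - z q^M from the infinite product into the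
  series.\<close>

lemma qext_eq:
  assumes c: "qtail_on {t} (\<lambda>_. c)" and z: "norm (z * q ^ N) < 1"
  shows "qext c z = qpoch_inf q (z * q ^ N) * (\<Sum>k. qdiff N c k * z ^ k)"
proof -
  define G where "G N = qpoch_inf q (z * q ^ N) * (\<Sum>k. qdiff N c k * z ^ k)" for N
  define N0 where "N0 = (LEAST N. norm (z * q ^ N) < 1)"
  have N0: "norm (z * q ^ N0) < 1" "N0 \<le> N"
    unfolding N0_def using z by (auto intro: LeastI Least_le)
  have less: "norm (z * q ^ M) < 1" if "N0 \<le> M" for M
  proof -
    have "norm (z * q ^ M) = norm (z * q ^ N0) * norm q ^ (M - N0)"
      using that by (simp add: norm_mult norm_power mult.assoc flip: power_add)
    also have "\<dots> \<le> norm (z * q ^ N0) * 1"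
      using norm_q_less_1 by (intro mult_left_mono power_le_one) auto
    finally show ?thesis using N0 by simp
  qed
  have "G (Suc M) = G M" if "N0 \<le> M" for M
    unfolding G_def suminf_qdiff_Suc[OF qdiff_summable[OF c less[OF that]]]
    using qpoch_inf_rec[of "z * q ^ M"] by (simp add: mult_ac)
  from N0(2) this have "G N = G N0"
    by (induction rule: dec_induct) auto
  then show ?thesis by (simp add: G_def N0_def qext_def Let_def)
qed

lemma qext_series:
  assumes "norm z < 1"
  shows "qext c z = qpoch_inf q z * (\<Sum>k. c k * z ^ k)"
proof -
  have "(LEAST N. norm (z * q ^ N) < 1) = 0"
    using assms by (intro Least_equality) auto
  then show ?thesis by (simp add: qext_def)
qed

lemma holomorphic_qdiff:
  assumes "\<And>k. (\<lambda>t. c t k) holomorphic_on U"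
  shows "(\<lambda>t. qdiff N (c t) k) holomorphic_on U"
proof (induction N arbitrary: k)
  case (Suc N)
  show ?case
    by (cases k) (auto intro!: holomorphic_intros Suc)
qed (simp add: assms)

text \<open>The least N in \<open>qext\<close> may jump with t. Near a given point a single N is
  admissible throughout, and \<open>qdiff_bound\<close> then gives uniform convergence of the series
  with a geometric majorant.\<close>

lemma holomorphic_qext:
  assumes U: "open U" and z: "z holomorphic_on U"
    and c: "\<And>k. (\<lambda>t. c t k) holomorphic_on U"
    and tail: "\<And>t. t \<in> U \<Longrightarrow> \<exists>d>0. qtail_on (ball t d) c"
  shows "(\<lambda>t. qext (c t) (z t)) holomorphic_on U"
proof -
  have "(\<lambda>t. qext (c t) (z t)) field_differentiable at t0" if t0: "t0 \<in> U" for t0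
  proof -
    obtain d where d: "d > 0" "qtail_on (ball t0 d) c" using tail[OF t0] by blast
    have "(\<lambda>N. z t0 * q ^ N) \<longlonglongrightarrow> 0"
      using tendsto_mult_right_zero[OF q_power_tendsto_0] by simp
    from tendstoD[OF this, of 1]
    have "eventually (\<lambda>N. norm (z t0 * q ^ N) < 1) sequentially"
      by simp
    then obtain N where N: "norm (z t0 * q ^ N) < 1"
      unfolding eventually_sequentially by blast
    obtain \<rho> where \<rho>: "norm (z t0 * q ^ N) < \<rho>" "\<rho> < 1"
      using dense[OF N] by blast
    have "continuous_on U (\<lambda>t. norm (z t * q ^ N))"
      by (intro continuous_intros holomorphic_on_imp_continuous_on z)
    then have "open (U \<inter> (\<lambda>t. norm (z t * q ^ N)) -` {..<\<rho>})"
      using U open_lessThan by (rule continuous_open_preimage)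
    then have "open (ball t0 d \<inter> (U \<inter> (\<lambda>t. norm (z t * q ^ N)) -` {..<\<rho>}))"
      by (rule open_Int[OF open_ball])
    moreover have "t0 \<in> ball t0 d \<inter> (U \<inter> (\<lambda>t. norm (z t * q ^ N)) -` {..<\<rho>})"
      using d t0 \<rho> by auto
    ultimately obtain \<delta> where \<delta>: "\<delta> > 0"
      "ball t0 \<delta> \<subseteq> ball t0 d \<inter> (U \<inter> (\<lambda>t. norm (z t * q ^ N)) -` {..<\<rho>})"
      by (meson openE)
    define V where "V = ball t0 \<delta>"
    have V: "open V" "V \<subseteq> U" "t0 \<in> V" "\<And>t. t \<in> V \<Longrightarrow> norm (z t * q ^ N) < \<rho>"
      using \<delta> by (auto simp: V_def)
    have tailV: "qtail_on V c" using qtail_on_subset[OF d(2)] \<delta> by (auto simp: V_def)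
    obtain C K where CK: "\<forall>t\<in>V. \<forall>k\<ge>K. norm (qdiff N (c t) k) \<le> C * norm (q ^ N) ^ k"
      using qdiff_bound[OF tailV, of N] by (elim exE)
    define S where "S t = (\<Sum>k. qdiff N (c t) k * z t ^ k)" for t
    have "S holomorphic_on V"
    proof (rule holomorphic_uniform_sequence[OF V(1)])
      show "(\<lambda>t. \<Sum>k<n. qdiff N (c t) k * z t ^ k) holomorphic_on V" for n
        by (intro holomorphic_intros holomorphic_on_subset[OF z V(2)]
            holomorphic_on_subset[OF holomorphic_qdiff[OF c] V(2)])
      fix x assume "x \<in> V"
      then obtain e where e: "e > 0" "cball x e \<subseteq> V" using V(1) by (meson open_contains_cball)
      have "uniform_limit V (\<lambda>n t. \<Sum>k<n. qdiff N (c t) k * z t ^ k)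
          (\<lambda>t. suminf (\<lambda>k. qdiff N (c t) k * z t ^ k)) sequentially"
      proof (rule Weierstrass_m_test_ev)
        show "\<forall>\<^sub>F k in sequentially. \<forall>t\<in>V. norm (qdiff N (c t) k * z t ^ k) \<le> \<bar>C\<bar> * \<rho> ^ k"
          unfolding eventually_sequentially
        proof (intro exI[of _ K] allI impI ballI)
          fix k t assume kt: "k \<ge> K" "t \<in> V"
          have "norm (qdiff N (c t) k) * norm (z t) ^ k \<le> C * norm (q ^ N) ^ k * norm (z t) ^ k"
            using CK kt by (intro mult_right_mono) auto
          also have "\<dots> = C * norm (z t * q ^ N) ^ k"
            by (simp add: norm_mult norm_power power_mult_distrib mult_ac)
          also have "\<dots> \<le> \<bar>C\<bar> * norm (z t * q ^ N) ^ k"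
            by (intro mult_right_mono) auto
          also have "\<dots> \<le> \<bar>C\<bar> * \<rho> ^ k"
            using V(4)[OF kt(2)] by (intro mult_left_mono power_mono) auto
          finally show "norm (qdiff N (c t) k * z t ^ k) \<le> \<bar>C\<bar> * \<rho> ^ k"
            by (simp add: norm_mult norm_power)
        qed
        have "0 \<le> \<rho>" using \<rho>(1) by (meson norm_ge_zero order_trans less_imp_le)
        then show "summable (\<lambda>k. \<bar>C\<bar> * \<rho> ^ k)"
          using \<rho>(2) by (intro summable_mult summable_geometric) auto
      qed
      then have "uniform_limit (cball x e) (\<lambda>n t. \<Sum>k<n. qdiff N (c t) k * z t ^ k) S sequentially"
        unfolding S_def using e(2) by (rule uniform_limit_on_subset)
      then show "\<exists>d>0. cball x d \<subseteq> V \<and>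
          uniform_limit (cball x d) (\<lambda>n t. \<Sum>k<n. qdiff N (c t) k * z t ^ k) S sequentially"
        using e by blast
    qed
    then have "(\<lambda>t. qpoch_inf q (z t * q ^ N) * S t) holomorphic_on V"
      by (intro holomorphic_intros holomorphic_on_subset[OF z V(2)])
    moreover have "qext (c t) (z t) = qpoch_inf q (z t * q ^ N) * S t" if "t \<in> V" for t
    proof -
      have "qtail_on {t} (\<lambda>_. c t)"
        using tailV that unfolding qtail_on_def by blast
      then show ?thesis
        unfolding S_def using qext_eq[of t "c t" "z t" N] V(4)[OF that] \<rho>(2) by simp
    qed
    ultimately have "(\<lambda>t. qext (c t) (z t)) holomorphic_on V"
      by (simp cong: holomorphic_cong)
    then show ?thesis using V by (simp add: holomorphic_on_imp_differentiable_at)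
  qed
  then show ?thesis
    using field_differentiable_at_within unfolding holomorphic_on_def by blast
qed

end

section \<open>Theta functions of degree 2\<close>

text \<open>A ball is uncountable, so the exceptional set contains none. This is how parameters are
  recovered at which a factor to be cancelled is 0 or at which zeros collide.\<close>

lemma continuous_zero_off_countable:
  fixes f :: "complex \<Rightarrow> complex"
  assumes "continuous_on S f" "open S" "countable N"
    and "\<And>x. x \<in> S \<Longrightarrow> x \<notin> N \<Longrightarrow> f x = 0" and "x \<in> S"
  shows "f x = 0"
proof (rule ccontr)
  assume "f x \<noteq> 0"
  have "open (S \<inter> f -` (- {0}))"
    by (rule continuous_open_preimage[OF assms(1,2)]) (rule open_Compl, rule closed_singleton)
  moreover have "x \<in> S \<inter> f -` (- {0})" using \<open>f x \<noteq> 0\<close> \<open>x \<in> S\<close> by blast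
  ultimately obtain e where e: "e > 0" "ball x e \<subseteq> S \<inter> f -` (- {0})" by (rule openE)
  then have "ball x e \<subseteq> N" using assms(4) by blast
  then have "countable (ball x e)" using assms(3) by (rule countable_subset)
  with uncountable_ball[OF e(1), of x] show False by contradiction
qed

text \<open>At a zero x0 of g both functions are divided by x - x0; the difference quotients extend
  holomorphically, and that of g is nonzero at x0. The explicit value at the zeros of g is needed in
  \<open>degree_2_three_zeros\<close>, where the quotient is evaluated at a point that may be such a
  zero.\<close>

lemma holomorphic_quotient_simple_zeros:
  assumes f: "f holomorphic_on S" and g: "g holomorphic_on S" and S: "open S"
    and zero: "\<And>x. x \<in> S \<Longrightarrow> g x = 0 \<Longrightarrow> f x = 0"
    and simple: "\<And>x. x \<in> S \<Longrightarrow> g x = 0 \<Longrightarrow> deriv g x \<noteq> 0"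
  shows "(\<lambda>x. if g x = 0 then deriv f x / deriv g x else f x / g x) holomorphic_on S"
    (is "?h holomorphic_on S")
proof -
  have "?h field_differentiable at x0" if x0: "x0 \<in> S" for x0
  proof (cases "g x0 = 0")
    case False
    have "continuous_on S g" using g by (rule holomorphic_on_imp_continuous_on)
    then have V: "open (S \<inter> g -` (- {0}))"
      using S by (rule continuous_open_preimage) (rule open_Compl, rule closed_singleton)
    have "(\<lambda>x. f x / g x) holomorphic_on S \<inter> g -` (- {0})"
      by (intro holomorphic_on_divide holomorphic_on_subset[OF f] holomorphic_on_subset[OF g]) auto
    then have "?h holomorphic_on S \<inter> g -` (- {0})"
      by (rule holomorphic_transform) auto
    then show ?thesis
      using V by (rule holomorphic_on_imp_differentiable_at) (use x0 False in auto)
  next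
    case True
    define F where "F x = (if x = x0 then deriv f x0 else (f x - f x0) / (x - x0))" for x
    define G where "G x = (if x = x0 then deriv g x0 else (g x - g x0) / (x - x0))" for x
    have F: "F holomorphic_on S" and G: "G holomorphic_on S"
      unfolding F_def G_def by (rule pole_lemma_open[OF f S], rule pole_lemma_open[OF g S])
    have "continuous_on S G" using G by (rule holomorphic_on_imp_continuous_on)
    then have V: "open (S \<inter> G -` (- {0}))"
      using S by (rule continuous_open_preimage) (rule open_Compl, rule closed_singleton)
    have "G x0 \<noteq> 0" using simple[OF x0 True] by (simp add: G_def)
    have "(\<lambda>x. F x / G x) holomorphic_on S \<inter> G -` (- {0})"
      by (intro holomorphic_on_divide holomorphic_on_subset[OF F] holomorphic_on_subset[OF G]) auto
    then have "?h holomorphic_on S \<inter> G -` (- {0})"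
    proof (rule holomorphic_transform)
      fix x assume "x \<in> S \<inter> G -` (- {0})"
      moreover have "f x0 = 0" using zero[OF x0 True] .
      ultimately show "F x / G x = ?h x"
        using True by (cases "x = x0") (auto simp: F_def G_def)
    qed
    then show ?thesis
      using V by (rule holomorphic_on_imp_differentiable_at) (use x0 \<open>G x0 \<noteq> 0\<close> in auto)
  qed
  then show ?thesis
    using field_differentiable_at_within unfolding holomorphic_on_def by blast
qed

context nome
begin

text \<open>The multiplicative group generated by q; points are compared modulo this group.\<close>

definition q_spiral :: "complex set" where
  "q_spiral = range (\<lambda>k::int. q powi k)"

lemma theta_eq_0_iff:
  assumes "x \<noteq> 0"
  shows "theta x = 0 \<longleftrightarrow> x \<in> q_spiral"
proof
  assume "theta x = 0"
  then consider j where "x * q ^ j = 1" | j where "q / x * q ^ j = 1"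
    by (auto simp: theta_def qpoch_inf_eq_0_iff)
  then show "x \<in> q_spiral"
  proof cases
    case 1
    then have "x = q powi (- int j)" by (simp add: power_int_minus divide_simps)
    then show ?thesis by (auto simp: q_spiral_def)
  next
    case 2
    then have "x = q ^ Suc j" using assms by (simp add: divide_simps)
    also have "\<dots> = q powi (int (Suc j))" by (rule power_int_of_nat[symmetric])
    finally show ?thesis unfolding q_spiral_def by blast
  qed
next
  assume "x \<in> q_spiral"
  then obtain k :: int where k: "x = q powi k" by (auto simp: q_spiral_def)
  show "theta x = 0"
  proof (cases "k \<le> 0")
    case True
    then have "k = - int (nat (- k))" by simp
    then have "x = inverse (q ^ nat (- k))"
      unfolding k by (metis power_int_minus power_int_of_nat)
    then have "x * q ^ nat (- k) = 1" by simp
    then have "qpoch_inf q x = 0" unfolding qpoch_inf_eq_0_iff by (rule exI)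
    then show ?thesis by (simp add: theta_def)
  next
    case False
    define j where "j = nat (k - 1)"
    have "k = int (Suc j)" using False by (simp add: j_def)
    then have "x = q ^ Suc j" unfolding k by (simp only: power_int_of_nat)
    then have "q / x * q ^ j = 1" by simp
    then have "qpoch_inf q (q / x) = 0" unfolding qpoch_inf_eq_0_iff by (rule exI)
    then show ?thesis by (simp add: theta_def)
  qed
qed

lemma q_spiral_mult: "x \<in> q_spiral \<Longrightarrow> y \<in> q_spiral \<Longrightarrow> x * y \<in> q_spiral"
  unfolding q_spiral_def by (auto simp flip: power_int_add)

lemma q_spiral_inverse: "x \<in> q_spiral \<Longrightarrow> 1 / x \<in> q_spiral"
  unfolding q_spiral_def by (auto simp: divide_inverse power_int_minus[symmetric])

lemma q_spiral_divide: "x \<in> q_spiral \<Longrightarrow> y \<in> q_spiral \<Longrightarrow> x / y \<in> q_spiral"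
  using q_spiral_mult[OF _ q_spiral_inverse, of x y] by simp

lemma countable_q_spiral: "countable q_spiral"
  unfolding q_spiral_def by simp

lemma nonzero_q_spiral: "x \<in> q_spiral \<Longrightarrow> x \<noteq> 0"
  unfolding q_spiral_def by auto

lemma theta_differentiable: "x \<noteq> 0 \<Longrightarrow> theta field_differentiable at x"
  by (rule holomorphic_on_imp_differentiable_at[where s = "- {0}"])
    (use holomorphic_theta[of "\<lambda>x. x" "- {0}"] in auto)

text \<open>Derivative of the functional equation \<open>theta_shift\<close>; at a zero of theta the
  term containing theta x drops out.\<close>

lemma deriv_theta_shift:
  assumes "x \<noteq> 0" "theta x = 0"
  shows "deriv theta (x * q) * q = - deriv theta x / x"
proof -
  have d: "(theta has_field_derivative deriv theta y) (at y)" if "y \<noteq> 0" for y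
    using theta_differentiable[OF that] by (simp add: DERIV_deriv_iff_field_differentiable)
  have "((\<lambda>y. theta (y * q)) has_field_derivative deriv theta (x * q) * q) (at x)"
    by (rule DERIV_chain2[OF d]) (use assms in \<open>auto intro!: derivative_eq_intros\<close>)
  moreover have "((\<lambda>y. - theta y / y) has_field_derivative - deriv theta x / x) (at x)"
    using assms by (auto intro!: derivative_eq_intros d simp: field_simps)
  then have "((\<lambda>y. theta (y * q)) has_field_derivative - deriv theta x / x) (at x)"
    by (rule has_field_derivative_transform_within_open[where S = "- {0}"])
      (use assms theta_shift in auto)
  ultimately show ?thesis by (rule DERIV_unique)
qed

text \<open>At 1 the factor 1 - x splits off and the cofactor is (q)_inf^2, which is not 0. The
  relation \<open>deriv_theta_shift\<close> carries this along all powers of q.\<close>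

lemma deriv_theta_nonzero:
  assumes "x \<in> q_spiral"
  shows "deriv theta x \<noteq> 0"
proof -
  have at_1: "deriv theta 1 \<noteq> 0"
  proof -
    define g where "g x = qpoch_inf q (x * q) * qpoch_inf q (q / x)" for x
    have "g holomorphic_on - {0}" unfolding g_def by (intro holomorphic_intros) auto
    then have "g field_differentiable at 1"
      by (rule holomorphic_on_imp_differentiable_at) auto
    then have g: "(g has_field_derivative deriv g 1) (at 1)"
      by (simp add: DERIV_deriv_iff_field_differentiable)
    have "theta = (\<lambda>x. (1 - x) * g x)"
      unfolding theta_def g_def by (subst qpoch_inf_rec) (simp only: mult.assoc)
    moreover have "((\<lambda>x. (1 - x) * g x) has_field_derivative - g 1) (at 1)"
      by (auto intro!: derivative_eq_intros g)
    ultimately have "deriv theta 1 = - g 1" by (simp add: DERIV_imp_deriv)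
    moreover have "g 1 \<noteq> 0"
      using norm_q_less_1 by (simp add: g_def qpoch_inf_nonzero)
    ultimately show ?thesis by simp
  qed
  have step: "deriv theta (y * q) = 0 \<longleftrightarrow> deriv theta y = 0" if "y \<in> q_spiral" for y
  proof -
    have "y \<noteq> 0" "theta y = 0" using that nonzero_q_spiral theta_eq_0_iff by auto
    from deriv_theta_shift[OF this] \<open>y \<noteq> 0\<close> show ?thesis by auto
  qed
  obtain k :: int where k: "x = q powi k" using assms by (auto simp: q_spiral_def)
  have "deriv theta (q powi k) \<noteq> 0"
  proof (induction k rule: int_induct[where k = 0])
    case base
    show ?case using at_1 by simp
  next
    case (step1 i)
    then show ?case
      using step[of "q powi i"] by (auto simp: q_spiral_def power_int_add)
  next
    case (step2 i)
    have "q powi i = q powi (i - 1) * q" by (simp add: power_int_diff)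
    then show ?case
      using step[of "q powi (i - 1)"] step2 by (auto simp: q_spiral_def)
  qed
  with k show ?thesis by simp
qed

text \<open>The closed annulus between |q| and 1 meets every orbit of multiplication by q, so h is
  bounded. Composing with exp gives a bounded entire function, to which the theorem of Liouville
  applies.\<close>

lemma q_periodic_imp_constant:
  assumes hol: "h holomorphic_on - {0}" and per: "\<And>b. b \<noteq> 0 \<Longrightarrow> h (b * q) = h b"
    and "x \<noteq> 0" "y \<noteq> 0"
  shows "h x = h y"
proof -
  define K where "K = {b :: complex. norm q \<le> norm b \<and> norm b \<le> 1}"
  have perk: "h (b * q ^ k) = h b" if "b \<noteq> 0" for b k
  proof (induction k)
    case (Suc k)
    have "h (b * q ^ k * q) = h (b * q ^ k)" using per that by simp
    then show ?case using Suc by (simp add: mult_ac)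
  qed simp
  have reduce: "\<exists>w\<in>K. h b = h w" if b: "b \<noteq> 0" for b
  proof (cases "norm b \<le> 1")
    case True
    have "\<exists>n. norm q ^ n < norm b"
      using b norm_q_less_1 by (intro real_arch_pow_inv) auto
    then have ex: "\<exists>n. norm q ^ Suc n \<le> norm b"
    proof (elim exE)
      fix n assume "norm q ^ n < norm b"
      moreover have "norm q ^ Suc n \<le> norm q ^ n"
        using norm_q_less_1 by (intro power_decreasing) auto
      ultimately have "norm q ^ Suc n \<le> norm b" by linarith
      then show ?thesis by blast
    qed
    define n where "n = (LEAST n. norm q ^ Suc n \<le> norm b)"
    have n: "norm q ^ Suc n \<le> norm b" unfolding n_def using ex by (rule LeastI_ex)
    have up: "norm b \<le> norm q ^ n"
    proof (cases n)
      case (Suc m)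
      then have "\<not> norm q ^ Suc m \<le> norm b"
        using not_less_Least[of m "\<lambda>n. norm q ^ Suc n \<le> norm b"] by (simp add: n_def)
      then show ?thesis using Suc by simp
    qed (use True in simp)
    have "b / q ^ n \<in> K"
      using n up by (simp add: K_def norm_divide norm_power divide_simps mult_ac)
    moreover have "h b = h (b / q ^ n)"
      using perk[of "b / q ^ n" n] b by simp
    ultimately show ?thesis by blast
  next
    case False
    have "\<exists>n. norm q ^ n < 1 / norm b"
      using b norm_q_less_1 by (intro real_arch_pow_inv) auto
    then have ex: "\<exists>n. norm (b * q ^ n) \<le> 1"
      using b by (auto simp: norm_mult norm_power divide_simps mult_ac intro: less_imp_le)
    define n where "n = (LEAST n. norm (b * q ^ n) \<le> 1)"
    have n: "norm (b * q ^ n) \<le> 1" unfolding n_def using ex by (rule LeastI_ex)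
    obtain m where m: "n = Suc m" using n False by (cases n) auto
    have "\<not> norm (b * q ^ m) \<le> 1"
      using not_less_Least[of m "\<lambda>n. norm (b * q ^ n) \<le> 1"] m by (simp add: n_def)
    then have "norm q * 1 \<le> norm q * norm (b * q ^ m)"
      by (intro mult_left_mono) auto
    then have "b * q ^ n \<in> K"
      using n by (simp add: K_def m norm_mult norm_power mult_ac)
    moreover have "h b = h (b * q ^ n)" using perk[OF b] by simp
    ultimately show ?thesis by blast
  qed
  have "compact K"
  proof -
    have "K = cball 0 1 - ball 0 (norm q)" by (auto simp: K_def)
    then show ?thesis by (simp add: compact_diff)
  qed
  moreover have "continuous_on K h"
    by (rule continuous_on_subset[OF holomorphic_on_imp_continuous_on[OF hol]])
      (auto simp: K_def)
  ultimately have "bounded (h ` K)"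
    by (intro compact_imp_bounded compact_continuous_image)
  moreover have "h (exp w) \<in> h ` K" for w
    using reduce[OF exp_not_eq_zero[of w]] by auto
  then have "range (\<lambda>w. h (exp w)) \<subseteq> h ` K" by blast
  ultimately have "bounded (range (\<lambda>w. h (exp w)))" by (rule bounded_subset)
  moreover have "(\<lambda>w. h (exp w)) holomorphic_on UNIV"
    by (rule holomorphic_on_compose_gen[OF _ hol, unfolded o_def]) (auto intro: holomorphic_intros)
  ultimately have "(\<lambda>w. h (exp w)) constant_on UNIV" by (intro Liouville_theorem)
  then obtain c where "\<And>w. h (exp w) = c" by (auto simp: constant_on_def)
  from this[of "Ln x"] this[of "Ln y"] assms show ?thesis by simp
qed

text \<open>A further theta factor raises phi to degree 3 with the same multiplier as the theta
  product with zeros x, y, w. The quotient of the two is holomorphic and invariant under b -> bq,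
  hence constant, and it vanishes at the zero of the added factor.\<close>

lemma degree_2_three_zeros:
  assumes hol: "\<phi> holomorphic_on - {0}"
    and quasi: "\<And>b. b \<noteq> 0 \<Longrightarrow> \<phi> (b * q) = \<kappa> / b ^ 2 * \<phi> b"
    and nz: "\<kappa> \<noteq> 0" "x \<noteq> 0" "y \<noteq> 0" "w \<noteq> 0"
    and zeros: "\<phi> x = 0" "\<phi> y = 0" "\<phi> w = 0"
    and distinct: "x / y \<notin> q_spiral" "x / w \<notin> q_spiral" "y / w \<notin> q_spiral"
    and b: "b \<noteq> 0"
  shows "\<phi> b = 0"
proof -
  \<comment> \<open>This value makes the multipliers -\<kappa>/(u b^3) of f and -xyw/b^3 of g
    equal.\<close>
  define u where "u = \<kappa> / (x * y * w)"
  have u: "u \<noteq> 0" using nz by (simp add: u_def)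
  define f where "f b = \<phi> b * theta (b * u)" for b
  define g where "g b = theta (b / x) * (theta (b / y) * theta (b / w))" for b
  have f_hol: "f holomorphic_on - {0}" and g_hol: "g holomorphic_on - {0}"
    unfolding f_def g_def using u nz by (auto intro!: holomorphic_intros hol)
  have f_shift: "f (b * q) = - (\<kappa> / (u * b ^ 3)) * f b" if "b \<noteq> 0" for b
    using quasi[OF that] theta_shift[of "b * u"] that u
    by (simp add: f_def mult_ac power2_eq_square power3_eq_cube)
  have g_shift: "g (b * q) = - (x * y * w / b ^ 3) * g b" if "b \<noteq> 0" for b
    using theta_shift[of "b / x"] theta_shift[of "b / y"] theta_shift[of "b / w"] that nz
    by (simp add: g_def mult_ac power3_eq_cube)
  have coeff: "\<kappa> / u = x * y * w" using nz by (simp add: u_def)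
  have f_shift': "f (b * q) = - (x * y * w / b ^ 3) * f b" if "b \<noteq> 0" for b
    using f_shift[OF that] by (simp flip: coeff)
  have phi_zero: "\<phi> (v * s) = 0" if "\<phi> v = 0" "v \<noteq> 0" "s \<in> q_spiral" for v s
  proof -
    obtain k :: int where k: "s = q powi k" using \<open>s \<in> q_spiral\<close> by (auto simp: q_spiral_def)
    have step: "\<phi> (b * q) = 0 \<longleftrightarrow> \<phi> b = 0" if "b \<noteq> 0" for b
      using quasi[OF that] nz that by simp
    have "\<phi> (v * q powi k) = 0"
    proof (induction k rule: int_induct[where k = 0])
      case base
      show ?case using that by simp
    next
      case (step1 i)
      then show ?case using step[of "v * q powi i"] that by (simp add: power_int_add mult_ac)
    next
      case (step2 i)
      have eq: "v * q powi i = v * q powi (i - 1) * q" by (simp add: power_int_diff)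
      have "\<phi> (v * q powi (i - 1) * q) = 0" using step2.IH unfolding eq .
      moreover have "v * q powi (i - 1) \<noteq> 0" using that by simp
      ultimately show ?case using step by blast
    qed
    with k show ?thesis by simp
  qed
  have g_zero: "b / x \<in> q_spiral \<or> b / y \<in> q_spiral \<or> b / w \<in> q_spiral"
    if "b \<noteq> 0" "g b = 0" for b
    using that nz by (auto simp: g_def theta_eq_0_iff)
  have zero: "\<phi> b = 0" if "b \<noteq> 0" "g b = 0" for b
    using g_zero[OF that] phi_zero[of x "b / x"] phi_zero[of y "b / y"] phi_zero[of w "b / w"]
      zeros nz by auto
  have d: "((\<lambda>b. theta (b / v)) has_field_derivative deriv theta (b / v) / v) (at b)"
    if "b \<noteq> 0" "v \<noteq> 0" for b v
  proof -
    have "(theta has_field_derivative deriv theta (b / v)) (at (b / v))"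
      using theta_differentiable[of "b / v"] that
      by (simp add: DERIV_deriv_iff_field_differentiable)
    then have "((\<lambda>b. theta (b / v)) has_field_derivative deriv theta (b / v) * (1 / v)) (at b)"
      by (rule DERIV_chain2) (use that in \<open>auto intro!: derivative_eq_intros\<close>)
    then show ?thesis by simp
  qed
  have deriv_g: "deriv g b = deriv theta (b / x) / x * (theta (b / y) * theta (b / w)) +
      (deriv theta (b / y) / y * theta (b / w) + deriv theta (b / w) / w * theta (b / y))
        * theta (b / x)" if "b \<noteq> 0" for b
    unfolding g_def
    by (rule DERIV_imp_deriv) (intro DERIV_mult d that nz)
  have ratio: "x / y \<in> q_spiral" if "b / x \<in> q_spiral" "b / y \<in> q_spiral" "b \<noteq> 0" for b x y
    using q_spiral_divide[OF that(2,1)] that nonzero_q_spiral by (auto simp: divide_simps)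
  have sym: "v / v' \<in> q_spiral \<longleftrightarrow> v' / v \<in> q_spiral" for v v'
    using q_spiral_inverse[of "v / v'"] q_spiral_inverse[of "v' / v"] by auto
  have th0: "theta (b / v) = 0 \<longleftrightarrow> b / v \<in> q_spiral" if "b \<noteq> 0" "v \<noteq> 0" for b v
    using theta_eq_0_iff[of "b / v"] that by simp
  have simple: "deriv g b \<noteq> 0" if "b \<noteq> 0" "g b = 0" for b
    using g_zero[OF that]
  proof (elim disjE)
    assume bx: "b / x \<in> q_spiral"
    then have t1: "theta (b / x) = 0" using th0 that nz by simp
    moreover have "b / y \<notin> q_spiral" "b / w \<notin> q_spiral"
      using ratio[of b x y] ratio[of b x w] distinct that bx by auto
    ultimately have "theta (b / y) \<noteq> 0" "theta (b / w) \<noteq> 0" using th0 that nz by simp_all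
    with t1 show ?thesis using that nz deriv_theta_nonzero[OF bx]
      by (simp add: deriv_g)
  next
    assume bx: "b / y \<in> q_spiral"
    then have t1: "theta (b / y) = 0" using th0 that nz by simp
    moreover have "b / x \<notin> q_spiral" "b / w \<notin> q_spiral"
      using ratio[of b x y] ratio[of b y w] distinct that bx by auto
    ultimately have "theta (b / x) \<noteq> 0" "theta (b / w) \<noteq> 0" using th0 that nz by simp_all
    with t1 show ?thesis using that nz deriv_theta_nonzero[OF bx]
      by (simp add: deriv_g)
  next
    assume bx: "b / w \<in> q_spiral"
    then have t1: "theta (b / w) = 0" using th0 that nz by simp
    moreover have "b / x \<notin> q_spiral" "b / y \<notin> q_spiral"
      using ratio[of b x w] ratio[of b y w] distinct that bx by auto
    ultimately have "theta (b / x) \<noteq> 0" "theta (b / y) \<noteq> 0" using th0 that nz by simp_all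
    with t1 show ?thesis using that nz deriv_theta_nonzero[OF bx]
      by (simp add: deriv_g)
  qed
  define h where "h b = (if g b = 0 then deriv f b / deriv g b else f b / g b)" for b
  have h_hol: "h holomorphic_on - {0}"
    unfolding h_def
    by (rule holomorphic_quotient_simple_zeros[OF f_hol g_hol])
      (use zero simple in \<open>auto simp: f_def\<close>)
  have fgh: "f b = g b * h b" if "b \<noteq> 0" for b
    using zero[OF that] by (auto simp: h_def f_def)
  \<comment> \<open>The zeros of g. Invariance of h follows by cancelling g off this countable set,
    and everywhere by continuity.\<close>
  define N where "N = (\<lambda>s. x * s) ` q_spiral \<union> (\<lambda>s. y * s) ` q_spiral \<union> (\<lambda>s. w * s) ` q_spiral"
  have "countable N" unfolding N_def by (intro countable_Un countable_image countable_q_spiral)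
  have off_N: "g b \<noteq> 0" if "b \<noteq> 0" "b \<notin> N" for b
  proof
    assume "g b = 0"
    from g_zero[OF that(1) this] that(2) nz show False
      unfolding N_def by (auto simp: image_iff)
  qed
  have periodic: "h (b * q) = h b" if "b \<noteq> 0" for b
  proof -
    have "h (b * q) - h b = 0"
    proof (rule continuous_zero_off_countable[of "- {0}" "\<lambda>b. h (b * q) - h b" N b])
      show "continuous_on (- {0}) (\<lambda>b. h (b * q) - h b)"
        by (intro continuous_intros holomorphic_on_imp_continuous_on h_hol
            holomorphic_on_compose_gen[OF _ h_hol, unfolded o_def] holomorphic_intros) auto
      fix b assume b: "b \<in> - {0}" "b \<notin> N"
      then have "b \<noteq> 0" "g b \<noteq> 0" using off_N by auto
      moreover have "g (b * q) * h (b * q) = - (x * y * w / b ^ 3) * (g b * h b)"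
        using fgh[of b] fgh[of "b * q"] f_shift'[of b] b by simp
      ultimately show "h (b * q) - h b = 0" using g_shift[of b] nz by simp
    qed (use \<open>countable N\<close> that in auto)
    then show ?thesis by simp
  qed
  define v where "v = 1 / u"
  have v: "v \<noteq> 0" using u by (simp add: v_def)
  have "h v = 0"
  proof (cases "g v = 0")
    case False
    then show ?thesis using u by (simp add: h_def f_def v_def)
  next
    \<comment> \<open>Here phi v = 0 as well, so f has at least a double zero at v against a simple
      zero of g.\<close>
    case True
    have "(\<phi> has_field_derivative deriv \<phi> v) (at v)"
      using holomorphic_on_imp_differentiable_at[OF hol, of v] v
      by (simp add: DERIV_deriv_iff_field_differentiable open_Compl)
    moreover have "((\<lambda>b. theta (b / (1 / u))) has_field_derivative deriv theta (v / (1 / u)) / (1 / u)) (at v)"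
      by (rule d) (use u v in auto)
    ultimately have "(f has_field_derivative deriv \<phi> v * theta (v / (1 / u)) +
        deriv theta (v / (1 / u)) / (1 / u) * \<phi> v) (at v)"
      unfolding f_def using DERIV_mult by fastforce
    moreover have "\<phi> v = 0" using zero[OF v True] .
    ultimately have "deriv f v = 0"
      using u by (simp add: DERIV_imp_deriv v_def)
    then show ?thesis using True by (simp add: h_def)
  qed
  then have "h b = 0" if "b \<noteq> 0" for b
    using q_periodic_imp_constant[OF h_hol periodic that v] by simp
  then have f0: "f b = 0" if "b \<noteq> 0" for b
    using fgh[OF that] that by simp
  show ?thesis
  proof (rule continuous_zero_off_countable[of "- {0}" \<phi> "(\<lambda>s. s / u) ` q_spiral" b])
    show "continuous_on (- {0}) \<phi>" using hol by (rule holomorphic_on_imp_continuous_on)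
    fix b assume b: "b \<in> - {0}" "b \<notin> (\<lambda>s. s / u) ` q_spiral"
    then have "theta (b * u) \<noteq> 0" using u by (auto simp: theta_eq_0_iff image_iff)
    then show "\<phi> b = 0" using f0[of b] b by (simp add: f_def)
  qed (use b countable_q_spiral in auto)
qed

lemma countable_power_in_spiral:
  assumes "n > 0" "c \<noteq> 0"
  shows "countable {t. c * t ^ n \<in> q_spiral}"
proof -
  have "{t. c * t ^ n \<in> q_spiral} \<subseteq> (\<Union>s\<in>q_spiral. {t. t ^ n = s / c})"
    using assms by (auto simp: divide_simps mult_ac)
  moreover have "countable (\<Union>s\<in>q_spiral. {t. t ^ n = s / c})"
    using assms by (intro countable_UN countable_q_spiral countable_finite finite_nth_roots)
  ultimately show ?thesis by (rule countable_subset)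
qed

text \<open>The ratios of the zeros 1, y t^2 and w t are nonconstant monomials in t, so they avoid
  the powers of q for all but countably many t. Continuity in t then reaches t = 1.\<close>

lemma degree_2_vanishing:
  assumes hol: "\<And>t. t \<noteq> 0 \<Longrightarrow> \<psi> t holomorphic_on - {0}"
    and cont: "\<And>b. b \<noteq> 0 \<Longrightarrow> continuous_on (- {0}) (\<lambda>t. \<psi> t b)"
    and quasi: "\<And>t b. t \<noteq> 0 \<Longrightarrow> b \<noteq> 0 \<Longrightarrow> \<psi> t (b * q) = \<kappa> t / b ^ 2 * \<psi> t b"
    and nz: "\<And>t. t \<noteq> 0 \<Longrightarrow> \<kappa> t \<noteq> 0" "y \<noteq> 0" "w \<noteq> 0"
    and zeros: "\<And>t. t \<noteq> 0 \<Longrightarrow> \<psi> t 1 = 0" "\<And>t. t \<noteq> 0 \<Longrightarrow> \<psi> t (y * t ^ 2) = 0"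
      "\<And>t. t \<noteq> 0 \<Longrightarrow> \<psi> t (w * t) = 0"
    and b: "b \<noteq> 0"
  shows "\<psi> 1 b = 0"
proof (rule continuous_zero_off_countable[of "- {0}" "\<lambda>t. \<psi> t b"
      "{t. y * t ^ 2 \<in> q_spiral} \<union> {t. w * t ^ 1 \<in> q_spiral} \<union> {t. (y / w) * t ^ 1 \<in> q_spiral}"])
  fix t :: complex
  assume t: "t \<in> - {0}" "t \<notin> {t. y * t ^ 2 \<in> q_spiral} \<union> {t. w * t ^ 1 \<in> q_spiral} \<union>
    {t. (y / w) * t ^ 1 \<in> q_spiral}"
  then have [simp]: "t \<noteq> 0" by simp
  show "\<psi> t b = 0"
  proof (rule degree_2_three_zeros[of "\<psi> t" "\<kappa> t" 1 "y * t ^ 2" "w * t" b])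
    show "1 / (y * t ^ 2) \<notin> q_spiral" using t q_spiral_inverse[of "1 / (y * t ^ 2)"] by auto
    show "1 / (w * t) \<notin> q_spiral" using t q_spiral_inverse[of "1 / (w * t)"] by auto
    show "y * t ^ 2 / (w * t) \<notin> q_spiral" using t by (auto simp: power2_eq_square)
  qed (use hol quasi nz zeros b in auto)
next
  show "countable ({t. y * t ^ 2 \<in> q_spiral} \<union> {t. w * t ^ 1 \<in> q_spiral} \<union>
      {t. (y / w) * t ^ 1 \<in> q_spiral})"
    using nz by (intro countable_Un countable_power_in_spiral) auto
qed (use cont b in auto)

section \<open>The very-well-poised series\<close>


text \<open>Uniform bounds exist only where the parameters stay bounded, hence locally; this is the
  form that \<open>holomorphic_qext\<close> requires.\<close>

definition qtail_locally :: "complex set \<Rightarrow> (complex \<Rightarrow> nat \<Rightarrow> complex) \<Rightarrow> bool" where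
  "qtail_locally U c \<longleftrightarrow> (\<forall>t\<in>U. \<exists>d>0. qtail_on (ball t d) c)"

lemma qtail_locally_mult:
  assumes "qtail_locally U c" "qtail_locally U c'"
  shows "qtail_locally U (\<lambda>t k. c t k * c' t k)"
  unfolding qtail_locally_def
proof
  fix t assume "t \<in> U"
  then obtain d d' where d: "d > 0" "qtail_on (ball t d) c" "d' > 0" "qtail_on (ball t d') c'"
    using assms unfolding qtail_locally_def by blast
  have "qtail_on (ball t (min d d')) (\<lambda>t k. c t k * c' t k)"
    by (rule qtail_on_mult; rule qtail_on_subset, rule d) auto
  then show "\<exists>d>0. qtail_on (ball t d) (\<lambda>t k. c t k * c' t k)"
    using d by (intro exI[of _ "min d d'"]) auto
qed

lemma locally_bounded:
  fixes f :: "complex \<Rightarrow> complex"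
  assumes "continuous_on U f" "open U" "t \<in> U"
  obtains d L where "d > 0" "\<And>s. s \<in> ball t d \<Longrightarrow> norm (f s) \<le> L"
proof -
  have "open (U \<inter> f -` ball (f t) 1)"
    by (rule continuous_open_preimage[OF assms(1,2) open_ball])
  moreover have "t \<in> U \<inter> f -` ball (f t) 1" using assms by simp
  ultimately obtain d where d: "d > 0" "ball t d \<subseteq> U \<inter> f -` ball (f t) 1" by (rule openE)
  have "norm (f s) \<le> norm (f t) + 1" if "s \<in> ball t d" for s
  proof -
    have "f s \<in> ball (f t) 1" using d that by blast
    then have "norm (f s - f t) < 1" by (simp add: dist_norm norm_minus_commute)
    then show ?thesis using norm_triangle_sub[of "f s" "f t"] by simp
  qed
  with d(1) show ?thesis by (rule that)
qed

lemma qtail_locally_qpoch: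
  assumes "continuous_on U f" "open U"
  shows "qtail_locally U (\<lambda>t k. qpoch q (f t) k)"
    and "qtail_locally U (\<lambda>t k. qpoch_inf q (f t * q ^ k))"
    and "qtail_locally U (\<lambda>t k. 1 - f t * q ^ (2 * k))"
proof -
  have *: "\<exists>d>0. qtail_on (ball t d) (\<lambda>t k. qpoch q (f t) k) \<and>
      qtail_on (ball t d) (\<lambda>t k. qpoch_inf q (f t * q ^ k)) \<and>
      qtail_on (ball t d) (\<lambda>t k. 1 - f t * q ^ (2 * k))" if t: "t \<in> U" for t
  proof -
    obtain d L where d: "d > 0" "\<And>s. s \<in> ball t d \<Longrightarrow> norm (f s) \<le> L"
      by (rule locally_bounded[OF assms t]) (rule that)
    have "qtail_on (ball t d) (\<lambda>t k. 1 - f t * q ^ (2 * k))"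
    proof (rule qtail_onI[where r = 1 and h = "\<lambda>t x. 1 - f t * x ^ 2" and M = "1 + L"])
      fix s x assume sx: "s \<in> ball t d" "norm (x :: complex) < 1"
      have "norm (1 - f s * x ^ 2) \<le> norm (1 :: complex) + norm (f s * x ^ 2)"
        by (rule norm_triangle_ineq4)
      also have "norm (f s * x ^ 2) \<le> L * 1"
        unfolding norm_mult norm_power using d(2)[OF sx(1)] sx(2)
        by (intro mult_mono power_le_one) (auto intro: order_trans[OF norm_ge_zero])
      finally show "norm (1 - f s * x ^ 2) \<le> 1 + L" by simp
    next
      show "(\<lambda>x. 1 - f s * x ^ 2) holomorphic_on ball 0 1" for s
        by (intro holomorphic_intros)
    qed (simp_all add: power_mult mult.commute flip: power_mult)
    with d qtail_on_qpoch[of "ball t d" f L] qtail_on_qpoch_inf[of "ball t d" f L]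
    show ?thesis by blast
  qed
  show "qtail_locally U (\<lambda>t k. qpoch q (f t) k)"
    "qtail_locally U (\<lambda>t k. qpoch_inf q (f t * q ^ k))"
    "qtail_locally U (\<lambda>t k. 1 - f t * q ^ (2 * k))"
    unfolding qtail_locally_def using * by blast+
qed

type_synonym fun6 =
  "complex \<Rightarrow> complex \<Rightarrow> complex \<Rightarrow> complex \<Rightarrow> complex \<Rightarrow> complex \<Rightarrow> complex"

text \<open>The factor $(p)_k / (aq/p)_k$, multiplied by $(aq/p)_\<infinity>$.\<close>

definition wp :: "complex \<Rightarrow> complex \<Rightarrow> nat \<Rightarrow> complex" where
  "wp a p k = qpoch q p k * qpoch_inf q (a * q / p * q ^ k)"

text \<open>The entry \<open>wp a a\<close> accounts for (a)_k/(q)_k, because aq/a = q.\<close>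

definition vwp_coeff ::
  "complex \<Rightarrow> complex \<Rightarrow> complex \<Rightarrow> complex \<Rightarrow> complex \<Rightarrow> complex \<Rightarrow> nat \<Rightarrow> complex" where
  "vwp_coeff a b c d e f k = (1 - a * q ^ (2 * k)) *
     (wp a a k * (wp a b k * (wp a c k * (wp a d k * (wp a e k * wp a f k)))))"

definition warg :: fun6 where
  "warg a b c d e f = a ^ 2 * q ^ 2 / (b * c * d * e * f)"

text \<open>$\Phi$ is the series $_8W_7$ times $(q)_\<infinity>(1-a)(z)_\<infinity>\prod_p(aq/p)_\<infinity>$, which
  cancels all its poles.\<close>

definition Phi :: fun6 where
  "Phi a b c d e f = qext (vwp_coeff a b c d e f) (warg a b c d e f)"

lemma holomorphic_wp:
  assumes "\<alpha> holomorphic_on U" "\<beta> holomorphic_on U" "\<And>t. t \<in> U \<Longrightarrow> \<beta> t \<noteq> 0"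
  shows "(\<lambda>t. wp (\<alpha> t) (\<beta> t) k) holomorphic_on U"
  unfolding wp_def using assms by (intro holomorphic_intros) blast+

lemma qtail_locally_wp:
  assumes "open U" "\<alpha> holomorphic_on U" "\<beta> holomorphic_on U" "\<And>t. t \<in> U \<Longrightarrow> \<beta> t \<noteq> 0"
  shows "qtail_locally U (\<lambda>t k. wp (\<alpha> t) (\<beta> t) k)"
  unfolding wp_def
  by (intro qtail_locally_mult qtail_locally_qpoch(1,2) continuous_intros
      holomorphic_on_imp_continuous_on ballI assms)

text \<open>All six parameters may depend on t, so that specialisations such as f = aq/e and the
  parameters of the second series are covered.\<close>

lemma holomorphic_Phi:
  assumes U: "open U" and hol: "\<alpha> holomorphic_on U" "\<beta> holomorphic_on U" "\<gamma> holomorphic_on U"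
      "\<delta> holomorphic_on U" "\<epsilon> holomorphic_on U" "\<zeta> holomorphic_on U"
    and nz: "\<And>t. t \<in> U \<Longrightarrow> \<alpha> t \<noteq> 0" "\<And>t. t \<in> U \<Longrightarrow> \<beta> t \<noteq> 0" "\<And>t. t \<in> U \<Longrightarrow> \<gamma> t \<noteq> 0"
      "\<And>t. t \<in> U \<Longrightarrow> \<delta> t \<noteq> 0" "\<And>t. t \<in> U \<Longrightarrow> \<epsilon> t \<noteq> 0" "\<And>t. t \<in> U \<Longrightarrow> \<zeta> t \<noteq> 0"
  shows "(\<lambda>t. Phi (\<alpha> t) (\<beta> t) (\<gamma> t) (\<delta> t) (\<epsilon> t) (\<zeta> t)) holomorphic_on U"
  unfolding Phi_def
proof (rule holomorphic_qext[OF U])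
  show "(\<lambda>t. warg (\<alpha> t) (\<beta> t) (\<gamma> t) (\<delta> t) (\<epsilon> t) (\<zeta> t)) holomorphic_on U"
    unfolding warg_def using nz by (intro holomorphic_intros hol) simp
  show "(\<lambda>t. vwp_coeff (\<alpha> t) (\<beta> t) (\<gamma> t) (\<delta> t) (\<epsilon> t) (\<zeta> t) k) holomorphic_on U" for k
    unfolding vwp_coeff_def by (intro holomorphic_intros holomorphic_wp hol nz)
  have "qtail_locally U (\<lambda>t. vwp_coeff (\<alpha> t) (\<beta> t) (\<gamma> t) (\<delta> t) (\<epsilon> t) (\<zeta> t))"
    unfolding vwp_coeff_def
    by (intro qtail_locally_mult qtail_locally_wp qtail_locally_qpoch(3)
        holomorphic_on_imp_continuous_on hol nz U)
  then show "\<exists>d>0. qtail_on (ball t d) (\<lambda>t. vwp_coeff (\<alpha> t) (\<beta> t) (\<gamma> t) (\<delta> t) (\<epsilon> t) (\<zeta> t))"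
    if "t \<in> U" for t
    using that unfolding qtail_locally_def by blast
qed

lemma Phi_series:
  "norm (warg a b c d e f) < 1 \<Longrightarrow> Phi a b c d e f =
    qpoch_inf q (warg a b c d e f) * (\<Sum>k. vwp_coeff a b c d e f k * warg a b c d e f ^ k)"
  unfolding Phi_def by (rule qext_series)

lemma wp_tendsto: "(\<lambda>k. wp a p k) \<longlonglongrightarrow> qpoch_inf q p"
  unfolding wp_def
  using tendsto_mult[OF qpoch_tendsto[of p] qpoch_inf_q_power_tendsto[of "a * q / p"]] by simp

lemma wp_convergent: "convergent (wp a p)"
  using wp_tendsto by (auto simp: convergent_def)

lemma summable_convergent_mult_power:
  fixes c :: "nat \<Rightarrow> complex"
  assumes "convergent c" "norm z < 1"
  shows "summable (\<lambda>k. c k * z ^ k)"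
proof -
  obtain K where K: "\<And>k. norm (c k) \<le> K"
    using convergent_imp_Bseq[OF assms(1)] unfolding Bseq_def by auto
  show ?thesis
  proof (rule summable_comparison_test')
    show "summable (\<lambda>k. K * norm z ^ k)"
      using assms(2) by (intro summable_mult summable_geometric) simp
    show "norm (c k * z ^ k) \<le> K * norm z ^ k" if "k \<ge> 0" for k
      using K by (simp add: norm_mult norm_power mult_right_mono)
  qed
qed

text \<open>The summand at k and at k + 1 of the telescope in \<open>wp_telescope\<close>, both
  expressed by the common factor \<open>wp a p k\<close>.\<close>

lemma wp_Suc:
  assumes "p \<noteq> 0"
  shows "qpoch q p k * qpoch_inf q (a / p * q ^ k) = (1 - a * q ^ k / p) * wp a p k"
    and "qpoch q p (Suc k) * qpoch_inf q (a / p * q ^ Suc k) = (1 - p * q ^ k) * wp a p k"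
proof -
  have "qpoch_inf q (a / p * q ^ k) = (1 - a * q ^ k / p) * qpoch_inf q (a * q / p * q ^ k)"
    using qpoch_inf_rec[of "a / p * q ^ k"] by (simp add: mult_ac)
  then show "qpoch q p k * qpoch_inf q (a / p * q ^ k) = (1 - a * q ^ k / p) * wp a p k"
    by (simp add: wp_def mult_ac)
  show "qpoch q p (Suc k) * qpoch_inf q (a / p * q ^ Suc k) = (1 - p * q ^ k) * wp a p k"
    by (simp add: wp_def qpoch_Suc mult_ac)
qed

lemma convergent_vwp_coeff: "convergent (vwp_coeff a b c d e f)"
proof -
  have "(\<lambda>k. 1 - a * (q ^ k * q ^ k)) \<longlonglongrightarrow> 1 - a * (0 * 0)"
    by (intro tendsto_intros q_power_tendsto_0)
  then have "convergent (\<lambda>k. 1 - a * q ^ (2 * k))"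
    by (auto simp: convergent_def mult_2 power_add)
  then show ?thesis
    unfolding vwp_coeff_def by (intro convergent_mult wp_convergent)
qed

text \<open>The summand is the difference of
  $\prod_p (p)_k (a q^k/p)_\<infinity> z^k$ at $k+1$ and $k$.\<close>

lemma wp_telescope:
  assumes "norm z < 1" "\<And>p. p \<in> set ps \<Longrightarrow> p \<noteq> 0"
  shows "(\<lambda>k. (\<Prod>p\<leftarrow>ps. wp a p k) * z ^ k *
      (z * (\<Prod>p\<leftarrow>ps. 1 - p * q ^ k) - (\<Prod>p\<leftarrow>ps. 1 - a * q ^ k / p)))
    sums (- (\<Prod>p\<leftarrow>ps. qpoch_inf q (a / p)))"
proof -
  define g where "g k = (\<Prod>p\<leftarrow>ps. qpoch q p k * qpoch_inf q (a / p * q ^ k))" for k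
  have "g \<longlonglongrightarrow> (\<Prod>p\<leftarrow>ps. qpoch_inf q p * 1)"
    unfolding g_def
  proof (induction ps)
    case (Cons p ps)
    then show ?case
      by (simp only: list.map prod_list.Cons)
        (intro tendsto_mult qpoch_tendsto qpoch_inf_q_power_tendsto)
  qed simp
  moreover have "(\<lambda>k. z ^ k) \<longlonglongrightarrow> 0" using assms(1) by (rule LIMSEQ_power_zero)
  ultimately have "(\<lambda>k. g k * z ^ k) \<longlonglongrightarrow> (\<Prod>p\<leftarrow>ps. qpoch_inf q p * 1) * 0"
    by (rule tendsto_mult)
  then have "(\<lambda>k. g (Suc k) * z ^ Suc k - g k * z ^ k) sums (0 - g 0 * z ^ 0)"
    by (intro telescope_sums) simp
  moreover have "g 0 = (\<Prod>p\<leftarrow>ps. qpoch_inf q (a / p))" by (simp add: g_def)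
  moreover have "g (Suc k) * z ^ Suc k - g k * z ^ k = (\<Prod>p\<leftarrow>ps. wp a p k) * z ^ k *
      (z * (\<Prod>p\<leftarrow>ps. 1 - p * q ^ k) - (\<Prod>p\<leftarrow>ps. 1 - a * q ^ k / p))" for k
  proof -
    have mult: "(\<Prod>p\<leftarrow>ps. u p * v p) = (\<Prod>p\<leftarrow>ps. u p) * (\<Prod>p\<leftarrow>ps. v p)"
      for u v :: "complex \<Rightarrow> complex"
      by (induction ps) (simp_all add: mult_ac)
    have "g (Suc k) = (\<Prod>p\<leftarrow>ps. (1 - p * q ^ k) * wp a p k)"
      unfolding g_def by (intro arg_cong[of _ _ prod_list] map_cong refl wp_Suc(2) assms(2))
    moreover have "g k = (\<Prod>p\<leftarrow>ps. (1 - a * q ^ k / p) * wp a p k)"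
      unfolding g_def by (intro arg_cong[of _ _ prod_list] map_cong refl wp_Suc(1) assms(2))
    moreover note mult[of "\<lambda>p. 1 - p * q ^ k" "\<lambda>p. wp a p k"]
      mult[of "\<lambda>p. 1 - a * q ^ k / p" "\<lambda>p. wp a p k"]
    ultimately show ?thesis by (simp add: algebra_simps)
  qed
  ultimately show ?thesis by simp
qed

text \<open>The identity theorem on the connected punctured plane. In the applications t is one of
  b, ..., f, and for large t the argument \<open>warg\<close> is small, so that identities between
  convergent series extend to all nonzero parameters.\<close>

lemma holomorphic_eq_on_nonzero:
  assumes f: "f holomorphic_on - {0}" and g: "g holomorphic_on - {0}"
    and far: "\<And>t. norm t > R \<Longrightarrow> f t = g t" and "t \<noteq> 0"
  shows "f t = g t"
proof (rule analytic_continuation_open[of "- cball 0 \<bar>R\<bar>" "- {0}" f g t])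
  show "- cball 0 \<bar>R\<bar> \<noteq> ({} :: complex set)"
  proof -
    have "of_real (\<bar>R\<bar> + 1) \<in> - cball (0 :: complex) \<bar>R\<bar>" by simp
    then show ?thesis by blast
  qed
  show "connected (- {0 :: complex})"
    by (rule connected_punctured_universe) simp
qed (use f g far \<open>t \<noteq> 0\<close> in auto)

section \<open>Existence and uniqueness of the analytic continuation\<close>

definition W87_norm :: "complex \<Rightarrow> complex list \<Rightarrow> complex" where
  "W87_norm a ps = qpoch_inf q q * (1 - a) * qpoch_inf q (W87_arg q a ps) *
     (\<Prod>p\<leftarrow>ps. qpoch_inf q (a * q / p))"

definition W87_cont :: "complex \<Rightarrow> complex list \<Rightarrow> complex" where
  "W87_cont a ps = Phi a (ps ! 0) (ps ! 1) (ps ! 2) (ps ! 3) (ps ! 4) / W87_norm a ps"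

lemma W87_regular_length5:
  assumes "W87_regular q a ps"
  obtains b c d e f where "ps = [b, c, d, e, f]"
  using assms unfolding W87_regular_def
  by (auto simp: length_Suc_conv numeral_eq_Suc)

text \<open>Each nonvanishing condition is that of one infinite product or of 1 - a; the remaining
  factor (q)_inf is never 0.\<close>

lemma W87_regular_iff:
  "W87_regular q a [b, c, d, e, f] \<longleftrightarrow> a \<noteq> 0 \<and> b \<noteq> 0 \<and> c \<noteq> 0 \<and> d \<noteq> 0 \<and> e \<noteq> 0 \<and> f \<noteq> 0 \<and>
     W87_norm a [b, c, d, e, f] \<noteq> 0"
proof -
  have "qpoch_inf q x \<noteq> 0 \<longleftrightarrow> (\<forall>k. 1 - x * q ^ k \<noteq> 0)" for x
    by (auto simp: qpoch_inf_eq_0_iff)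
  moreover have "qpoch_inf q q \<noteq> 0" using norm_q_less_1 by (rule qpoch_inf_nonzero)
  ultimately show ?thesis
    unfolding W87_regular_def W87_norm_def by (auto simp: qpoch_inf_eq_0_iff)
qed

lemma W87_arg_eq: "W87_arg q a [b, c, d, e, f] = warg a b c d e f"
  by (simp add: W87_arg_def warg_def mult_ac)

lemma W87_cont_series:
  assumes reg: "W87_regular q a [b, c, d, e, f]" and z: "norm (warg a b c d e f) < 1"
  shows "W87_cont a [b, c, d, e, f] = (\<Sum>k. W87_term q a [b, c, d, e, f] k)"
proof -
  have nz: "a \<noteq> 0" "W87_norm a [b, c, d, e, f] \<noteq> 0" using reg by (auto simp: W87_regular_iff)
  define D where "D = qpoch_inf q q * (1 - a) * (qpoch_inf q (a * q / b) * qpoch_inf q (a * q / c) *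
    qpoch_inf q (a * q / d) * qpoch_inf q (a * q / e) * qpoch_inf q (a * q / f))"
  have norm_eq: "W87_norm a [b, c, d, e, f] = qpoch_inf q (warg a b c d e f) * D"
    by (simp add: W87_norm_def D_def W87_arg_eq mult_ac)
  have D: "D \<noteq> 0" and z0: "qpoch_inf q (warg a b c d e f) \<noteq> 0" using nz norm_eq by auto
  have fac: "qpoch q p k / qpoch q (a * q / p) k = wp a p k / qpoch_inf q (a * q / p)"
    if "qpoch_inf q (a * q / p) \<noteq> 0" for p k
    using qpoch_inf_split[of "a * q / p" k] that by (simp add: wp_def divide_simps)
  have fac_a: "qpoch q a k / qpoch q q k = wp a a k / qpoch_inf q q" for k
    using fac[of a k] D nz by (simp add: D_def)
  have "W87_term q a [b, c, d, e, f] k = vwp_coeff a b c d e f k * warg a b c d e f ^ k / D" for k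
  proof -
    have "W87_term q a [b, c, d, e, f] k = (1 - a * q ^ (2 * k)) / (1 - a) * ((qpoch q a k / qpoch q q k) *
      (\<Prod>p\<leftarrow>[b, c, d, e, f]. qpoch q p k / qpoch q (a * q / p) k)) * warg a b c d e f ^ k"
      by (simp add: W87_term_def W87_arg_eq mult_ac)
    also have "\<dots> = (1 - a * q ^ (2 * k)) / (1 - a) * ((wp a a k / qpoch_inf q q) *
      (\<Prod>p\<leftarrow>[b, c, d, e, f]. wp a p k / qpoch_inf q (a * q / p))) * warg a b c d e f ^ k"
      using D by (simp add: fac fac_a D_def)
    finally show ?thesis by (simp add: vwp_coeff_def D_def mult_ac)
  qed
  moreover have "summable (\<lambda>k. vwp_coeff a b c d e f k * warg a b c d e f ^ k)"
    by (rule summable_convergent_mult_power[OF convergent_vwp_coeff z])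
  ultimately have "(\<Sum>k. W87_term q a [b, c, d, e, f] k) =
      (\<Sum>k. vwp_coeff a b c d e f k * warg a b c d e f ^ k) / D"
    by (simp add: suminf_divide)
  then show ?thesis
    using z0 by (simp add: W87_cont_def norm_eq Phi_series[OF z])
qed

lemma analytic_on_qpoch_inf: "f analytic_on A \<Longrightarrow> (\<lambda>t. qpoch_inf q (f t)) analytic_on A"
proof -
  assume "f analytic_on A"
  moreover have "qpoch_inf q analytic_on UNIV"
    using holomorphic_qpoch_inf by (simp add: analytic_on_open)
  ultimately show ?thesis using analytic_on_compose_gen[of f A "qpoch_inf q" UNIV] by (simp add: o_def)
qed

lemma analytic_on_Phi:
  assumes "\<And>x. x \<in> {\<alpha>, \<beta>, \<gamma>, \<delta>, \<epsilon>, \<zeta>} \<Longrightarrow> x holomorphic_on - {0} \<and> (\<forall>t. t \<noteq> 0 \<longrightarrow> x t \<noteq> 0)" "t0 \<noteq> 0"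
  shows "(\<lambda>t. Phi (\<alpha> t) (\<beta> t) (\<gamma> t) (\<delta> t) (\<epsilon> t) (\<zeta> t)) analytic_on {t0}"
proof -
  have "(\<lambda>t. Phi (\<alpha> t) (\<beta> t) (\<gamma> t) (\<delta> t) (\<epsilon> t) (\<zeta> t)) holomorphic_on - {0}"
    using assms(1) by (intro holomorphic_Phi) auto
  then have "(\<lambda>t. Phi (\<alpha> t) (\<beta> t) (\<gamma> t) (\<delta> t) (\<epsilon> t) (\<zeta> t)) analytic_on - {0}"
    by (simp add: analytic_on_open open_Compl)
  then show ?thesis by (rule analytic_on_subset) (use assms(2) in auto)
qed

text \<open>Existence, which gives content to the choice in the definition of \<open>W87\<close>.
  The numerator \<open>Phi\<close> has no singularities, so only zeros of \<open>W87_norm\<close>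
  could do harm, and regularity excludes them.\<close>

lemma is_W87_continuation_W87_cont: "is_W87_continuation q W87_cont"
  unfolding is_W87_continuation_def
proof (intro allI impI conjI)
  fix a ps assume reg: "W87_regular q a ps"
  then obtain b c d e f where ps: "ps = [b, c, d, e, f]" by (rule W87_regular_length5)
  note R = reg[unfolded ps W87_regular_iff]
  have norm_an: "(\<lambda>t. W87_norm (\<alpha> t) [\<beta> t, \<gamma> t, \<delta> t, \<epsilon> t, \<zeta> t]) analytic_on {t0}"
    if "\<alpha> analytic_on {t0}" "\<beta> analytic_on {t0}" "\<gamma> analytic_on {t0}" "\<delta> analytic_on {t0}"
      "\<epsilon> analytic_on {t0}" "\<zeta> analytic_on {t0}"
      "\<beta> t0 \<noteq> 0" "\<gamma> t0 \<noteq> 0" "\<delta> t0 \<noteq> 0" "\<epsilon> t0 \<noteq> 0" "\<zeta> t0 \<noteq> 0"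
    for \<alpha> \<beta> \<gamma> \<delta> \<epsilon> \<zeta> t0
    unfolding W87_norm_def W87_arg_def using that
    by (auto intro!: analytic_intros analytic_on_qpoch_inf)
  have quot: "(\<lambda>t. Phi (\<alpha> t) (\<beta> t) (\<gamma> t) (\<delta> t) (\<epsilon> t) (\<zeta> t) /
      W87_norm (\<alpha> t) [\<beta> t, \<gamma> t, \<delta> t, \<epsilon> t, \<zeta> t]) analytic_on {t0}"
    if H: "\<And>x. x \<in> {\<alpha>, \<beta>, \<gamma>, \<delta>, \<epsilon>, \<zeta>} \<Longrightarrow> x holomorphic_on - {0} \<and> (\<forall>t. t \<noteq> 0 \<longrightarrow> x t \<noteq> 0)"
      "t0 \<noteq> 0" "W87_norm (\<alpha> t0) [\<beta> t0, \<gamma> t0, \<delta> t0, \<epsilon> t0, \<zeta> t0] \<noteq> 0"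
    for \<alpha> \<beta> \<gamma> \<delta> \<epsilon> \<zeta> t0
  proof -
    have "x analytic_on {t0}" if x: "x \<in> {\<alpha>, \<beta>, \<gamma>, \<delta>, \<epsilon>, \<zeta>}" for x
    proof -
      have "x analytic_on - {0}" using H(1)[OF x] by (simp add: analytic_on_open open_Compl)
      then show ?thesis by (rule analytic_on_subset) (use H(2) in auto)
    qed
    then have "(\<lambda>t. W87_norm (\<alpha> t) [\<beta> t, \<gamma> t, \<delta> t, \<epsilon> t, \<zeta> t]) analytic_on {t0}"
      using H(1,2) by (intro norm_an) auto
    moreover have "(\<lambda>t. Phi (\<alpha> t) (\<beta> t) (\<gamma> t) (\<delta> t) (\<epsilon> t) (\<zeta> t)) analytic_on {t0}"
      by (rule analytic_on_Phi[OF H(1,2)])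
    ultimately show ?thesis using H(3) by (intro analytic_on_divide) auto
  qed
  show "(\<lambda>t. W87_cont t ps) analytic_on {a}"
    by (rule back_subst[of "\<lambda>F. F analytic_on _", OF quot[of "\<lambda>t. t" "\<lambda>_. b" "\<lambda>_. c" "\<lambda>_. d" "\<lambda>_. e" "\<lambda>_. f" a]])
      (use R in \<open>auto simp: W87_cont_def ps\<close>)
  show "(\<lambda>t. W87_cont a (ps[i := t])) analytic_on {ps ! i}" if i: "i < 5" for i
  proof -
    consider "i = 0" | "i = 1" | "i = 2" | "i = 3" | "i = 4" using i
      by (auto simp: less_Suc_eq numeral_eq_Suc)
    then show ?thesis
    proof cases
      case 1
      have "(\<lambda>t. Phi a t c d e f / W87_norm a [t, c, d, e, f]) analytic_on {b}"
        by (rule quot[of "\<lambda>_. a" "\<lambda>t. t" "\<lambda>_. c" "\<lambda>_. d" "\<lambda>_. e" "\<lambda>_. f" b])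
          (use R in auto)
      then show ?thesis by (simp add: W87_cont_def ps 1 numeral_eq_Suc)
    next
      case 2
      have "(\<lambda>t. Phi a b t d e f / W87_norm a [b, t, d, e, f]) analytic_on {c}"
        by (rule quot[of "\<lambda>_. a" "\<lambda>_. b" "\<lambda>t. t" "\<lambda>_. d" "\<lambda>_. e" "\<lambda>_. f" c])
          (use R in auto)
      then show ?thesis by (simp add: W87_cont_def ps 2 numeral_eq_Suc)
    next
      case 3
      have "(\<lambda>t. Phi a b c t e f / W87_norm a [b, c, t, e, f]) analytic_on {d}"
        by (rule quot[of "\<lambda>_. a" "\<lambda>_. b" "\<lambda>_. c" "\<lambda>t. t" "\<lambda>_. e" "\<lambda>_. f" d])
          (use R in auto)
      then show ?thesis by (simp add: W87_cont_def ps 3 numeral_eq_Suc)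
    next
      case 4
      have "(\<lambda>t. Phi a b c d t f / W87_norm a [b, c, d, t, f]) analytic_on {e}"
        by (rule quot[of "\<lambda>_. a" "\<lambda>_. b" "\<lambda>_. c" "\<lambda>_. d" "\<lambda>t. t" "\<lambda>_. f" e])
          (use R in auto)
      then show ?thesis by (simp add: W87_cont_def ps 4 numeral_eq_Suc)
    next
      case 5
      have "(\<lambda>t. Phi a b c d e t / W87_norm a [b, c, d, e, t]) analytic_on {f}"
        by (rule quot[of "\<lambda>_. a" "\<lambda>_. b" "\<lambda>_. c" "\<lambda>_. d" "\<lambda>_. e" "\<lambda>t. t" f])
          (use R in auto)
      then show ?thesis by (simp add: W87_cont_def ps 5 numeral_eq_Suc)
    qed
  qed
  show "W87_cont a ps = (\<Sum>k. W87_term q a ps k)" if "norm (W87_arg q a ps) < 1"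
    using W87_cont_series reg that by (simp add: ps W87_arg_eq)
qed

text \<open>It suffices to move the first parameter: the regular values t form the complement of a
  countable set, which is connected, and for large t both functions are given by the series.\<close>

lemma W87_continuation_unique:
  assumes F: "is_W87_continuation q F" and reg: "W87_regular q a [b, c, d, e, f]"
  shows "F a [b, c, d, e, f] = W87_cont a [b, c, d, e, f]"
proof -
  have R: "a \<noteq> 0" "b \<noteq> 0" "c \<noteq> 0" "d \<noteq> 0" "e \<noteq> 0" "f \<noteq> 0" "W87_norm a [b, c, d, e, f] \<noteq> 0"
    using reg by (auto simp: W87_regular_iff)
  define Z where "Z = a ^ 2 * q ^ 2 / (c * d * e * f)"
  have arg: "W87_arg q a [t, c, d, e, f] = Z / t" for t by (simp add: W87_arg_def Z_def mult_ac)
  \<comment> \<open>Besides 0, these are the zeros of (aq/t)_inf and of (Z/t)_inf, the only factors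
    of the normalisation that depend on t.\<close>
  define N where "N = insert 0 (range (\<lambda>k. a * q * q ^ k) \<union> range (\<lambda>k. Z * q ^ k))"
  define S where "S = {t. W87_regular q a [t, c, d, e, f]}"
  have S_iff: "t \<in> S \<longleftrightarrow> t \<noteq> 0 \<and> qpoch_inf q (a * q / t) \<noteq> 0 \<and> qpoch_inf q (Z / t) \<noteq> 0" for t
    using R by (auto simp: S_def W87_regular_iff W87_norm_def arg)
  have S_eq: "S = - N"
    unfolding set_eq_iff S_iff Compl_iff N_def
    by (auto simp: qpoch_inf_eq_0_iff divide_simps)
  have "open S"
  proof -
    have "continuous_on (- {0}) (\<lambda>t. qpoch_inf q (a * q / t) * qpoch_inf q (Z / t))"
      by (intro continuous_intros) auto
    then have "open (- {0} \<inter> (\<lambda>t. qpoch_inf q (a * q / t) * qpoch_inf q (Z / t)) -` (- {0}))"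
      by (rule continuous_open_preimage) (rule open_Compl, rule closed_singleton)+
    also have "- {0} \<inter> (\<lambda>t. qpoch_inf q (a * q / t) * qpoch_inf q (Z / t)) -` (- {0}) = S"
      by (auto simp: S_iff)
    finally show ?thesis .
  qed
  have "countable N" by (simp add: N_def)
  then have "connected S"
    unfolding S_eq
    using path_connected_complement_countable[of N] path_connected_imp_connected
    by auto
  have hol: "(\<lambda>t. G a [t, c, d, e, f]) holomorphic_on S" if G: "is_W87_continuation q G" for G
  proof -
    have "(\<lambda>t. G a [t, c, d, e, f]) analytic_on {t0}" if "t0 \<in> S" for t0
    proof -
      have "\<forall>i<5. (\<lambda>t. G a ([t0, c, d, e, f][i := t])) analytic_on {[t0, c, d, e, f] ! i}"
        using G that unfolding is_W87_continuation_def S_def by blast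
      from this[rule_format, of 0] show ?thesis by simp
    qed
    then have "(\<lambda>t. G a [t, c, d, e, f]) analytic_on S" using analytic_on_analytic_at by blast
    then show ?thesis by (rule analytic_imp_holomorphic)
  qed
  define S' where "S' = (- cball 0 (max (norm (a * q)) (norm Z)) :: complex set)"
  have S'S: "S' \<subseteq> S"
  proof
    fix t assume "t \<in> S'"
    then have t: "norm t > norm (a * q)" "norm t > norm Z" by (auto simp: S'_def)
    then have "norm t > 0" by (meson norm_ge_zero le_less_trans)
    then have "t \<noteq> 0" by simp
    moreover from this t have "norm (a * q / t) < 1" "norm (Z / t) < 1" by (auto simp: norm_divide)
    ultimately show "t \<in> S" by (simp add: S_iff qpoch_inf_nonzero)
  qed
  show ?thesis
  proof (rule analytic_continuation_open[of S' S "\<lambda>t. F a [t, c, d, e, f]"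
        "\<lambda>t. W87_cont a [t, c, d, e, f]" b])
    have "of_real (max (norm (a * q)) (norm Z) + 1) \<in> S'" 
      unfolding S'_def by (simp del: of_real_add)
    then show "S' \<noteq> {}" by blast
    fix t assume t: "t \<in> S'"
    have "t \<in> S" using t S'S by blast
    then have "t \<noteq> 0" by (simp add: S_iff)
    moreover have "norm Z < norm t" using t by (simp add: S'_def)
    ultimately have "norm (W87_arg q a [t, c, d, e, f]) < 1" by (simp add: arg norm_divide)
    moreover have "W87_regular q a [t, c, d, e, f]" using t S'S by (auto simp: S_def)
    ultimately show "F a [t, c, d, e, f] = W87_cont a [t, c, d, e, f]"
      using F is_W87_continuation_W87_cont unfolding is_W87_continuation_def by metis
  qed (use hol[OF F] hol[OF is_W87_continuation_W87_cont] \<open>open S\<close> \<open>connected S\<close> S'S reg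
      in \<open>auto simp: S_def S'_def open_Compl\<close>)
qed

lemma W87_eq_Phi:
  assumes "W87_regular q a [b, c, d, e, f]"
  shows "W87 q a [b, c, d, e, f] = Phi a b c d e f / W87_norm a [b, c, d, e, f]"
proof -
  have "is_W87_continuation q (W87 q)"
    unfolding W87_def by (rule someI[of _ W87_cont]) (rule is_W87_continuation_W87_cont)
  from W87_continuation_unique[OF this assms] show ?thesis
    by (simp add: W87_cont_def)
qed

end

section \<open>Telescoping identities\<close>

lemma vwp_polynomial_2:
  fixes a p x :: complex
  assumes "p \<noteq> 0" "a \<noteq> 0"
  shows "1 / p * ((1 - a * x) * (1 - p * x)) - (1 - a * x / a) * (1 - a * x / p)
    = (1 / p - 1) * (1 - a * x ^ 2)"
  using assms by (simp add: field_simps power2_eq_square)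

text \<open>If a x^2 = 1, then 1 - ax/p = -(1 - px)/(px), and with this \<zeta> the two products
  agree. Hence the very-well-poised factor 1 - a x^2 divides the difference.\<close>

lemma vwp_polynomial_4:
  fixes a p1 p2 p3 p4 x \<zeta> :: complex
  assumes nz: "p1 \<noteq> 0" "p2 \<noteq> 0" "p3 \<noteq> 0" "p4 \<noteq> 0"
    and \<zeta>: "\<zeta> = a ^ 2 / (p1 * p2 * p3 * p4)"
  shows "\<zeta> * ((1 - p1 * x) * (1 - p2 * x) * (1 - p3 * x) * (1 - p4 * x)) -
      (1 - a * x / p1) * (1 - a * x / p2) * (1 - a * x / p3) * (1 - a * x / p4)
    = (1 - a * x ^ 2) * ((\<zeta> - 1) * (1 + a * x ^ 2) +
        (a * (1 / p1 + 1 / p2 + 1 / p3 + 1 / p4) - \<zeta> * (p1 + p2 + p3 + p4)) * x)"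
  unfolding \<zeta> using nz by (simp add: divide_simps) algebra

text \<open>Elementary symmetric functions e1, ..., e5 in place of the five parameters keep the
  expansion small.\<close>

lemma vwp_polynomial_6_symmetric:
  fixes a g x e1 e2 e3 e4 e5 :: complex
  assumes "e5 \<noteq> 0" "g \<noteq> 0" and \<zeta>: "\<zeta> = a ^ 3 / (e5 * g)"
  shows "\<zeta> * ((1 - e1 * x + e2 * x ^ 2 - e3 * x ^ 3 + e4 * x ^ 4 - e5 * x ^ 5) * (1 - g * x)) -
      (1 - e4 / e5 * a * x + e3 / e5 * a ^ 2 * x ^ 2 - e2 / e5 * a ^ 3 * x ^ 3
        + e1 / e5 * a ^ 4 * x ^ 4 - a ^ 5 * x ^ 5 / e5) * (1 - a * x / g)
    = (1 - a * x ^ 2) * ((1 - g * x) * (1 - a * x / g) * ((\<zeta> - 1) * (1 + a * x ^ 2) +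
        ((\<zeta> - 1) * (g + a / g) + (a * e4 / e5 + a / g) - \<zeta> * (e1 + g)) * x)
      - g ^ 2 * (1 - e4 / e5 * (a / g) + e3 / e5 * (a / g) ^ 2 - e2 / e5 * (a / g) ^ 3
        + e1 / e5 * (a / g) ^ 4 - (a / g) ^ 5 / e5) * x ^ 2)"
  unfolding \<zeta> using assms(1,2) by (simp add: divide_simps) algebra

lemma prod_5_symmetric:
  fixes p1 p2 p3 p4 p5 x :: complex
  defines "e1 \<equiv> p1 + p2 + p3 + p4 + p5"
    and "e2 \<equiv> p1*p2 + p1*p3 + p1*p4 + p1*p5 + p2*p3 + p2*p4 + p2*p5 + p3*p4 + p3*p5 + p4*p5"
    and "e3 \<equiv> p1*p2*p3 + p1*p2*p4 + p1*p2*p5 + p1*p3*p4 + p1*p3*p5 + p1*p4*p5 + p2*p3*p4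
      + p2*p3*p5 + p2*p4*p5 + p3*p4*p5"
    and "e4 \<equiv> p1*p2*p3*p4 + p1*p2*p3*p5 + p1*p2*p4*p5 + p1*p3*p4*p5 + p2*p3*p4*p5"
    and "e5 \<equiv> p1*p2*p3*p4*p5"
  shows "(1 - p1*x) * (1 - p2*x) * (1 - p3*x) * (1 - p4*x) * (1 - p5*x) =
      1 - e1 * x + e2 * x ^ 2 - e3 * x ^ 3 + e4 * x ^ 4 - e5 * x ^ 5"
    and "p1 \<noteq> 0 \<Longrightarrow> p2 \<noteq> 0 \<Longrightarrow> p3 \<noteq> 0 \<Longrightarrow> p4 \<noteq> 0 \<Longrightarrow> p5 \<noteq> 0 \<Longrightarrow>
      (1 - y/p1) * (1 - y/p2) * (1 - y/p3) * (1 - y/p4) * (1 - y/p5) =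
      1 - e4 / e5 * y + e3 / e5 * y ^ 2 - e2 / e5 * y ^ 3 + e1 / e5 * y ^ 4 - y ^ 5 / e5"
    and "p1 \<noteq> 0 \<Longrightarrow> p2 \<noteq> 0 \<Longrightarrow> p3 \<noteq> 0 \<Longrightarrow> p4 \<noteq> 0 \<Longrightarrow> p5 \<noteq> 0 \<Longrightarrow>
      1/p1 + 1/p2 + 1/p3 + 1/p4 + 1/p5 = e4 / e5"
proof -
  show "(1 - p1*x) * (1 - p2*x) * (1 - p3*x) * (1 - p4*x) * (1 - p5*x) =
      1 - e1 * x + e2 * x ^ 2 - e3 * x ^ 3 + e4 * x ^ 4 - e5 * x ^ 5"
    unfolding assms by algebra
  assume nz: "p1 \<noteq> 0" "p2 \<noteq> 0" "p3 \<noteq> 0" "p4 \<noteq> 0" "p5 \<noteq> 0"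
  then have e5: "e5 \<noteq> 0" by (simp add: e5_def)
  have "e5 * ((1 - y/p1) * (1 - y/p2) * (1 - y/p3) * (1 - y/p4) * (1 - y/p5)) =
      (p1 * (1 - y/p1)) * (p2 * (1 - y/p2)) * (p3 * (1 - y/p3)) * (p4 * (1 - y/p4)) * (p5 * (1 - y/p5))"
    by (simp only: e5_def mult_ac)
  also have "\<dots> = (p1 - y) * (p2 - y) * (p3 - y) * (p4 - y) * (p5 - y)"
    using nz by (simp add: right_diff_distrib)
  also have "\<dots> = e5 - e4 * y + e3 * y ^ 2 - e2 * y ^ 3 + e1 * y ^ 4 - y ^ 5"
    unfolding assms by algebra
  finally have "(1 - y/p1) * (1 - y/p2) * (1 - y/p3) * (1 - y/p4) * (1 - y/p5) =
      (e5 - e4 * y + e3 * y ^ 2 - e2 * y ^ 3 + e1 * y ^ 4 - y ^ 5) / e5"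
    using e5 by (metis nonzero_mult_div_cancel_left)
  then show "(1 - y/p1) * (1 - y/p2) * (1 - y/p3) * (1 - y/p4) * (1 - y/p5) =
      1 - e4 / e5 * y + e3 / e5 * y ^ 2 - e2 / e5 * y ^ 3 + e1 / e5 * y ^ 4 - y ^ 5 / e5"
    using e5 by (simp only: diff_divide_distrib add_divide_distrib times_divide_eq_left divide_self_if if_False)
  show "1/p1 + 1/p2 + 1/p3 + 1/p4 + 1/p5 = e4 / e5"
    unfolding e4_def e5_def using nz by (simp add: field_simps)
qed

text \<open>Divisibility by 1 - a x^2 is as for four parameters. The quotient has degree 4 and is
  divided further by (1 - gx)(1 - ax/g); by the symmetry x -> 1/(ax) the remainder is a multiple of
  x^2, and x = 1/g determines its coefficient.\<close>

lemma vwp_polynomial_6: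
  fixes a p1 p2 p3 p4 p5 g x \<zeta> :: complex
  assumes nz: "p1 \<noteq> 0" "p2 \<noteq> 0" "p3 \<noteq> 0" "p4 \<noteq> 0" "p5 \<noteq> 0" "g \<noteq> 0"
    and \<zeta>: "\<zeta> = a ^ 3 / (p1 * p2 * p3 * p4 * p5 * g)"
  shows "\<zeta> * ((1 - p1*x) * (1 - p2*x) * (1 - p3*x) * (1 - p4*x) * (1 - p5*x) * (1 - g*x)) -
      (1 - a*x/p1) * (1 - a*x/p2) * (1 - a*x/p3) * (1 - a*x/p4) * (1 - a*x/p5) * (1 - a*x/g)
    = (1 - a * x ^ 2) * ((1 - g * x) * (1 - a * x / g) * ((\<zeta> - 1) * (1 + a * x ^ 2) +
        ((\<zeta> - 1) * (g + a / g) + a * (1/p1 + 1/p2 + 1/p3 + 1/p4 + 1/p5 + 1/g)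
          - \<zeta> * (p1 + p2 + p3 + p4 + p5 + g)) * x)
      - g ^ 2 * ((1 - a/g/p1) * (1 - a/g/p2) * (1 - a/g/p3) * (1 - a/g/p4) * (1 - a/g/p5)) * x ^ 2)"
proof -
  define e1 where "e1 = p1 + p2 + p3 + p4 + p5"
  define e2 where "e2 = p1*p2 + p1*p3 + p1*p4 + p1*p5 + p2*p3 + p2*p4 + p2*p5 + p3*p4 + p3*p5 + p4*p5"
  define e3 where "e3 = p1*p2*p3 + p1*p2*p4 + p1*p2*p5 + p1*p3*p4 + p1*p3*p5 + p1*p4*p5 + p2*p3*p4
      + p2*p3*p5 + p2*p4*p5 + p3*p4*p5"
  define e4 where "e4 = p1*p2*p3*p4 + p1*p2*p3*p5 + p1*p2*p4*p5 + p1*p3*p4*p5 + p2*p3*p4*p5"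
  define e5 where "e5 = p1*p2*p3*p4*p5"
  note S = prod_5_symmetric[where ?p1.0 = p1 and ?p2.0 = p2 and ?p3.0 = p3 and ?p4.0 = p4
      and ?p5.0 = p5, folded e1_def e2_def e3_def e4_def e5_def]
  have e5: "e5 \<noteq> 0" using nz by (simp add: e5_def)
  have \<zeta>': "\<zeta> = a ^ 3 / (e5 * g)" by (simp add: \<zeta> e5_def)
  have prods:
    "(1 - p1*x) * (1 - p2*x) * (1 - p3*x) * (1 - p4*x) * (1 - p5*x) * (1 - g*x) =
      (1 - e1 * x + e2 * x ^ 2 - e3 * x ^ 3 + e4 * x ^ 4 - e5 * x ^ 5) * (1 - g * x)"
    "(1 - a*x/p1) * (1 - a*x/p2) * (1 - a*x/p3) * (1 - a*x/p4) * (1 - a*x/p5) =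
      1 - e4 / e5 * a * x + e3 / e5 * a ^ 2 * x ^ 2 - e2 / e5 * a ^ 3 * x ^ 3
        + e1 / e5 * a ^ 4 * x ^ 4 - a ^ 5 * x ^ 5 / e5"
    using S(1)[of x] S(2)[OF nz(1-5), of "a * x"] by (simp_all only: power_mult_distrib mult.assoc)
  have sums: "a * (1/p1 + 1/p2 + 1/p3 + 1/p4 + 1/p5 + 1/g) = a * e4 / e5 + a / g"
    "p1 + p2 + p3 + p4 + p5 + g = e1 + g"
    using S(3)[OF nz(1-5)] by (simp_all add: distrib_left e1_def)
  show ?thesis
    unfolding prods sums S(2)[OF nz(1-5), of "a / g"]
    by (rule vwp_polynomial_6_symmetric[OF e5 nz(6) \<zeta>'])
qed

context nome
begin

definition Phi_plus :: fun6 where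
  "Phi_plus a b c d e f = Phi (a * q ^ 2) (b * q) (c * q) (d * q) (e * q) (f * q)"

text \<open>The coefficient T_1, up to the factors by which the normalisations of the series and of
  its shift differ; see \<open>T_W87_plus\<close>.\<close>

definition tau :: fun6 where
  "tau a b c d e f = warg a b c d e f * (1 - a) * (1 - a * q) *
     ((1 - b) * (1 - c) * (1 - d) * (1 - e) * (1 - f))"

text \<open>This is (1 - q) S_1, since s/(aq) is the argument of the series.\<close>

definition sigma :: fun6 where
  "sigma a b c d e f = warg a b c d e f * (1 + a) +
     a * q * (1 / b + 1 / c + 1 / d + 1 / e + 1 / f) - a * q"

text \<open>The coefficient of \<open>Phi\<close> in \<open>contiguous\<close>. It is symmetric in
  b, c, d, e only, since f is the parameter that is lowered.\<close>

definition lam :: fun6 where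
  "lam a b c d e f = warg a b c d e f * (1 + a * q / f - b - c - d - e) - f - a * q +
     a * q * (1 / b + 1 / c + 1 / d + 1 / e)"

section \<open>The summands under shifts of the parameters\<close>

lemma wp_scale:
  assumes "p \<noteq> 0"
  shows "(1 - p) * wp a (p * q) k = (1 - p * q ^ k) * (1 - a * q ^ k / p) * wp a p k"
    and "(1 - p) * wp (a * q ^ 2) (p * q) k = wp a p (Suc k)"
proof -
  have 1: "(1 - p) * qpoch q (p * q) k = qpoch q p k * (1 - p * q ^ k)"
    using qpoch_Suc'[of p k] qpoch_Suc[of p k] by simp
  have 2: "qpoch_inf q (a * q / (p * q) * q ^ k) =
      (1 - a * q ^ k / p) * qpoch_inf q (a * q / p * q ^ k)"
    using qpoch_inf_rec[of "a * q / (p * q) * q ^ k"] by (simp add: mult_ac)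
  have "(1 - p) * wp a (p * q) k =
      ((1 - p) * qpoch q (p * q) k) * qpoch_inf q (a * q / (p * q) * q ^ k)"
    by (simp only: wp_def mult_ac)
  also have "\<dots> = (1 - p * q ^ k) * (1 - a * q ^ k / p) * wp a p k"
    unfolding 1 2 by (simp only: wp_def mult_ac)
  finally show "(1 - p) * wp a (p * q) k = (1 - p * q ^ k) * (1 - a * q ^ k / p) * wp a p k" .
  have 3: "a * q ^ 2 * q / (p * q) * q ^ k = a * q / p * q ^ Suc k"
    by (simp add: power2_eq_square)
  have "(1 - p) * wp (a * q ^ 2) (p * q) k =
      ((1 - p) * qpoch q (p * q) k) * qpoch_inf q (a * q / p * q ^ Suc k)"
    unfolding wp_def 3 by (simp only: mult_ac)
  then show "(1 - p) * wp (a * q ^ 2) (p * q) k = wp a p (Suc k)"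
    unfolding 1 by (simp add: wp_def qpoch_Suc mult_ac)
qed

lemma wp_base_scale:
  assumes "a \<noteq> 0"
  shows "(1 - a) * (1 - a * q) * wp (a * q ^ 2) (a * q ^ 2) k =
    (1 - q ^ Suc k) * (1 - a * q ^ Suc k) * wp a a (Suc k)"
proof -
  have "(1 - a) * (1 - a * q) * qpoch q (a * q ^ 2) k = qpoch q a (Suc (Suc k))"
    by (simp add: qpoch_Suc'[of a] qpoch_Suc'[of "a * q"] power2_eq_square mult_ac)
  also have "\<dots> = qpoch q a (Suc k) * (1 - a * q ^ Suc k)"
    by (rule qpoch_Suc)
  finally have 1: "(1 - a) * (1 - a * q) * qpoch q (a * q ^ 2) k = qpoch q a (Suc k) * (1 - a * q ^ Suc k)" .
  have 2: "qpoch_inf q (q * q ^ k) = (1 - q ^ Suc k) * qpoch_inf q (q * q ^ Suc k)"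
    using qpoch_inf_rec[of "q * q ^ k"] by (simp add: mult_ac)
  have "a * q ^ 2 * q / (a * q ^ 2) = q" "a * q / a = q" using assms by simp_all
  then have "(1 - a) * (1 - a * q) * wp (a * q ^ 2) (a * q ^ 2) k =
      ((1 - a) * (1 - a * q) * qpoch q (a * q ^ 2) k) * qpoch_inf q (q * q ^ k)"
    "wp a a (Suc k) = qpoch q a (Suc k) * qpoch_inf q (q * q ^ Suc k)"
    by (simp_all only: wp_def mult_ac)
  then show ?thesis unfolding 1 2 by (simp only: mult_ac)
qed

lemma warg_plus:
  assumes "a \<noteq> 0" "b \<noteq> 0" "c \<noteq> 0" "d \<noteq> 0" "e \<noteq> 0" "f \<noteq> 0"
  shows "warg (a * q ^ 2) (b * q) (c * q) (d * q) (e * q) (f * q) = warg a b c d e f / q"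
  unfolding warg_def using assms by (simp add: divide_simps power2_eq_square)

lemma vwp_sums:
  assumes "norm (warg a b c d e f) < 1"
  shows "(\<lambda>k. qpoch_inf q (warg a b c d e f) * (vwp_coeff a b c d e f k * warg a b c d e f ^ k))
    sums Phi a b c d e f"
  unfolding Phi_series[OF assms]
  by (intro sums_mult summable_sums summable_convergent_mult_power convergent_vwp_coeff assms)

text \<open>The k-th term of the shifted series is the term k + 1 of the original one times an
  elementary factor, and this factor vanishes for index 0. Thus \<open>Phi\<close> and
  \<open>Phi_plus\<close> become sums over the same coefficients. The shifted argument is z/q,
  whence the bound |z| < |q|.\<close>

lemma tau_Phi_plus_sums:
  assumes nz: "a \<noteq> 0" "b \<noteq> 0" "c \<noteq> 0" "d \<noteq> 0" "e \<noteq> 0" "f \<noteq> 0"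
    and z: "norm (warg a b c d e f) < norm q"
  shows "(\<lambda>k. (q - warg a b c d e f) * (qpoch_inf q (warg a b c d e f) *
      (vwp_coeff a b c d e f k * warg a b c d e f ^ k)) * ((1 - q ^ k) * (1 - a * q ^ k) / q ^ k))
    sums (tau a b c d e f * Phi_plus a b c d e f)"
proof -
  define z where "z = warg a b c d e f"
  define V where "V k = (q - z) * (qpoch_inf q z * (vwp_coeff a b c d e f k * z ^ k)) *
    ((1 - q ^ k) * (1 - a * q ^ k) / q ^ k)" for k
  define V' where "V' = vwp_coeff (a * q ^ 2) (b * q) (c * q) (d * q) (e * q) (f * q)"
  have zq: "norm (z / q) < 1" using assms by (simp add: z_def norm_divide)
  have "(\<lambda>k. tau a b c d e f * (qpoch_inf q (z / q) * (V' k * (z / q) ^ k))) sums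
      (tau a b c d e f * Phi_plus a b c d e f)"
    unfolding Phi_plus_def V'_def
    using vwp_sums[of "a * q ^ 2" "b * q" "c * q" "d * q" "e * q" "f * q"] zq
    unfolding warg_plus[OF nz] z_def[symmetric] by (intro sums_mult) simp
  moreover have "tau a b c d e f * (qpoch_inf q (z / q) * (V' k * (z / q) ^ k)) = V (Suc k)" for k
  proof -
    have inf: "qpoch_inf q (z / q) = (1 - z / q) * qpoch_inf q z"
      using qpoch_inf_rec[of "z / q"] by simp
    have "tau a b c d e f * V' k = z * (1 - a * q ^ 2 * q ^ (2 * k)) *
      (((1 - a) * (1 - a * q) * wp (a * q ^ 2) (a * q ^ 2) k) *
       (((1 - b) * wp (a * q ^ 2) (b * q) k) * (((1 - c) * wp (a * q ^ 2) (c * q) k) *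
       (((1 - d) * wp (a * q ^ 2) (d * q) k) * (((1 - e) * wp (a * q ^ 2) (e * q) k) *
       ((1 - f) * wp (a * q ^ 2) (f * q) k))))))"
      unfolding tau_def V'_def vwp_coeff_def z_def[symmetric] by (simp only: mult_ac)
    also have "\<dots> = z * (1 - a * q ^ (2 * Suc k)) * ((1 - q ^ Suc k) * (1 - a * q ^ Suc k) *
      wp a a (Suc k) * (wp a b (Suc k) * (wp a c (Suc k) * (wp a d (Suc k) * (wp a e (Suc k) *
        wp a f (Suc k))))))"
      unfolding wp_base_scale[OF nz(1)] wp_scale(2)[OF nz(2)] wp_scale(2)[OF nz(3)]
        wp_scale(2)[OF nz(4)] wp_scale(2)[OF nz(5)] wp_scale(2)[OF nz(6)]
      by (simp add: power_add power2_eq_square mult_ac)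
    also have "\<dots> = z * ((1 - q ^ Suc k) * (1 - a * q ^ Suc k)) * vwp_coeff a b c d e f (Suc k)"
      unfolding vwp_coeff_def by (simp only: mult_ac)
    finally have "tau a b c d e f * V' k =
      z * ((1 - q ^ Suc k) * (1 - a * q ^ Suc k)) * vwp_coeff a b c d e f (Suc k)" .
    then have "tau a b c d e f * (qpoch_inf q (z / q) * (V' k * (z / q) ^ k)) =
      (z * ((1 - q ^ Suc k) * (1 - a * q ^ Suc k)) * vwp_coeff a b c d e f (Suc k)) *
        ((1 - z / q) * qpoch_inf q z * (z / q) ^ k)"
      unfolding inf by (metis mult.assoc mult.commute)
    also have "\<dots> = V (Suc k)"
      unfolding V_def by (simp add: divide_simps power_divide)
    finally show ?thesis .
  qed
  ultimately have "(\<lambda>k. V (Suc k)) sums (tau a b c d e f * Phi_plus a b c d e f)" by simp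
  then have "V sums (tau a b c d e f * Phi_plus a b c d e f + V 0)" by (rule sums_Suc)
  then have "V sums (tau a b c d e f * Phi_plus a b c d e f)" by (simp add: V_def)
  then show ?thesis unfolding V_def[abs_def] z_def .
qed

text \<open>The case in which two of the six factors of the summand combine to a constant.\<close>

lemma tau_Phi_plus_degenerate_aux:
  assumes nz: "a \<noteq> 0" "b \<noteq> 0" "c \<noteq> 0" "d \<noteq> 0" "e \<noteq> 0" "f \<noteq> 0"
    and p: "p1 \<noteq> 0" "p2 \<noteq> 0" "p3 \<noteq> 0" "p4 \<noteq> 0"
    and z: "norm (warg a b c d e f) < norm q"
    and prod: "warg a b c d e f = a ^ 2 * q / (p1 * p2 * p3 * p4)"
    and coeff: "\<And>k. vwp_coeff a b c d e f k =
      (1 - a * q ^ (2 * k)) * (K * (wp a p1 k * wp a p2 k * wp a p3 k * wp a p4 k))"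
  shows "tau a b c d e f * Phi_plus a b c d e f +
      ((q - warg a b c d e f) * (1 + a) + warg a b c d e f * (p1 + p2 + p3 + p4)
        - a * q * (1 / p1 + 1 / p2 + 1 / p3 + 1 / p4)) * Phi a b c d e f
    = q * K * qpoch_inf q (warg a b c d e f) *
      (qpoch_inf q (a / p1) * qpoch_inf q (a / p2) * qpoch_inf q (a / p3) * qpoch_inf q (a / p4))"
    (is "_ + ?X * _ = ?R")
proof -
  define z where "z = warg a b c d e f"
  define P where "P k = (1 - p1 * q ^ k) * (1 - p2 * q ^ k) * (1 - p3 * q ^ k) * (1 - p4 * q ^ k)" for k
  define P' where "P' k = (1 - a * q ^ k / p1) * (1 - a * q ^ k / p2) * (1 - a * q ^ k / p3) *
    (1 - a * q ^ k / p4)" for k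
  define U where "U k = wp a p1 k * wp a p2 k * wp a p3 k * wp a p4 k" for k
  have p_nz: "\<And>p. p = p1 \<or> p = p2 \<or> p = p3 \<or> p = p4 \<Longrightarrow> p \<noteq> 0" using p by auto
  have zq: "norm (z / q) < 1" using z by (simp add: z_def norm_divide)
  have "norm (warg a b c d e f) < 1" using z norm_q_less_1 by simp
  note A = sums_mult[OF vwp_sums[OF this], of ?X]
  note B = sums_add[OF tau_Phi_plus_sums[OF nz z] A]
  have "(\<lambda>k. U k * (z / q) ^ k * (z / q * P k - P' k)) sums
      (- (qpoch_inf q (a / p1) * qpoch_inf q (a / p2) * qpoch_inf q (a / p3) * qpoch_inf q (a / p4)))"
    using wp_telescope[OF zq, of "[p1, p2, p3, p4]" a] p_nz
    by (simp add: U_def P_def P'_def mult_ac)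
  then have "(\<lambda>k. - (q * K * qpoch_inf q z) * (U k * (z / q) ^ k * (z / q * P k - P' k))) sums
    (- (q * K * qpoch_inf q z) *
     (- (qpoch_inf q (a / p1) * qpoch_inf q (a / p2) * qpoch_inf q (a / p3) * qpoch_inf q (a / p4))))"
    by (rule sums_mult)
  moreover have "- (q * K * qpoch_inf q z) * (U k * (z / q) ^ k * (z / q * P k - P' k)) =
    (q - z) * (qpoch_inf q z * (vwp_coeff a b c d e f k * z ^ k)) *
      ((1 - q ^ k) * (1 - a * q ^ k) / q ^ k) +
    ?X * (qpoch_inf q z * (vwp_coeff a b c d e f k * z ^ k))" for k
  proof -
    define x where "x = q ^ k"
    have x: "x \<noteq> 0" by (simp add: x_def)
    have "z / q = a ^ 2 / (p1 * p2 * p3 * p4)" using prod by (simp add: z_def)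
    then have pol: "z / q * P k - P' k = (1 - a * x ^ 2) * ((z / q - 1) * (1 + a * x ^ 2) +
        (a * (1 / p1 + 1 / p2 + 1 / p3 + 1 / p4) - z / q * (p1 + p2 + p3 + p4)) * x)"
      unfolding P_def P'_def x_def[symmetric] by (rule vwp_polynomial_4[OF p])
    \<comment> \<open>As (1 - x)(1 - ax)/x = (1 + a x^2)/x - (1 + a), the summand of
      \<open>Phi_plus\<close> absorbs everything that depends on x; the constant left over is the
      coefficient of \<open>Phi\<close>.\<close>
    have X: "- q * ((z / q - 1) * (1 + a * x ^ 2) +
        (a * (1 / p1 + 1 / p2 + 1 / p3 + 1 / p4) - z / q * (p1 + p2 + p3 + p4)) * x) / x =
      (q - z) * ((1 - x) * (1 - a * x) / x) + ?X"
    proof -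
      define s where "s = 1 / p1 + 1 / p2 + 1 / p3 + 1 / p4"
      define t where "t = p1 + p2 + p3 + p4"
      show ?thesis
        unfolding s_def[symmetric] t_def[symmetric] z_def[symmetric] using x
        by (simp add: divide_simps) algebra
    qed
    have x2: "q ^ (2 * k) = x ^ 2" unfolding x_def power_mult[symmetric] by (simp only: mult.commute)
    have "- (q * K * qpoch_inf q z) * (U k * (z / q) ^ k * (z / q * P k - P' k)) =
      K * qpoch_inf q z * U k * (1 - a * x ^ 2) * z ^ k *
        (- q * ((z / q - 1) * (1 + a * x ^ 2) +
        (a * (1 / p1 + 1 / p2 + 1 / p3 + 1 / p4) - z / q * (p1 + p2 + p3 + p4)) * x) / x)"
      unfolding pol by (simp add: power_divide x_def)
    also have "\<dots> = K * qpoch_inf q z * U k * (1 - a * x ^ 2) * z ^ k *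
        ((q - z) * ((1 - x) * (1 - a * x) / x) + ?X)"
      by (simp only: X)
    also have "\<dots> = (q - z) * (qpoch_inf q z * (vwp_coeff a b c d e f k * z ^ k)) *
        ((1 - x) * (1 - a * x) / x) + ?X * (qpoch_inf q z * (vwp_coeff a b c d e f k * z ^ k))"
      unfolding coeff U_def[symmetric] x2 by (simp add: distrib_left distrib_right mult_ac)
    finally show ?thesis by (simp add: x_def)
  qed
  ultimately have "(\<lambda>k. (q - z) * (qpoch_inf q z * (vwp_coeff a b c d e f k * z ^ k)) *
      ((1 - q ^ k) * (1 - a * q ^ k) / q ^ k) +
    ?X * (qpoch_inf q z * (vwp_coeff a b c d e f k * z ^ k))) sums ?R"
    by (simp add: z_def mult_ac)
  from sums_unique2[OF B[folded z_def] this[unfolded z_def[symmetric]]]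
  show ?thesis by (simp add: z_def)
qed

section \<open>Contiguous relations\<close>


lemma open_nonzero: "open (- {0 :: complex})"
  by (rule open_Compl) (rule closed_singleton)

lemma holomorphic_vwp_on_nonzero:
  assumes hol: "\<alpha> holomorphic_on - {0}" "\<beta> holomorphic_on - {0}" "\<gamma> holomorphic_on - {0}"
      "\<delta> holomorphic_on - {0}" "\<epsilon> holomorphic_on - {0}" "\<zeta> holomorphic_on - {0}"
    and nz: "\<And>t. t \<noteq> 0 \<Longrightarrow>
      \<alpha> t \<noteq> 0 \<and> \<beta> t \<noteq> 0 \<and> \<gamma> t \<noteq> 0 \<and> \<delta> t \<noteq> 0 \<and> \<epsilon> t \<noteq> 0 \<and> \<zeta> t \<noteq> 0"
  shows "(\<lambda>t. Phi (\<alpha> t) (\<beta> t) (\<gamma> t) (\<delta> t) (\<epsilon> t) (\<zeta> t)) holomorphic_on - {0}" (is ?P)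
    and "(\<lambda>t. Phi_plus (\<alpha> t) (\<beta> t) (\<gamma> t) (\<delta> t) (\<epsilon> t) (\<zeta> t)) holomorphic_on - {0}" (is ?Pp)
    and "(\<lambda>t. warg (\<alpha> t) (\<beta> t) (\<gamma> t) (\<delta> t) (\<epsilon> t) (\<zeta> t)) holomorphic_on - {0}" (is ?W)
    and "(\<lambda>t. tau (\<alpha> t) (\<beta> t) (\<gamma> t) (\<delta> t) (\<epsilon> t) (\<zeta> t)) holomorphic_on - {0}" (is ?T)
    and "(\<lambda>t. sigma (\<alpha> t) (\<beta> t) (\<gamma> t) (\<delta> t) (\<epsilon> t) (\<zeta> t)) holomorphic_on - {0}" (is ?S)
    and "(\<lambda>t. lam (\<alpha> t) (\<beta> t) (\<gamma> t) (\<delta> t) (\<epsilon> t) (\<zeta> t)) holomorphic_on - {0}" (is ?L)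
proof -
  show ?P using nz by (intro holomorphic_Phi open_nonzero hol) auto
  show ?Pp unfolding Phi_plus_def
    using nz by (intro holomorphic_Phi open_nonzero holomorphic_intros hol) auto
  show W: ?W unfolding warg_def using nz by (intro holomorphic_intros hol) auto
  show ?T unfolding tau_def by (intro holomorphic_intros hol W)
  show ?S unfolding sigma_def using nz by (intro holomorphic_intros hol W) auto
  show ?L unfolding lam_def using nz by (intro holomorphic_intros hol W) auto
qed

text \<open>Partners p and aq/p exchange numerator and denominator, so each finite product is
  completed by the tail belonging to the other.\<close>

lemma wp_pair:
  assumes "a \<noteq> 0" "p \<noteq> 0"
  shows "wp a p k * wp a (a * q / p) k = qpoch_inf q p * qpoch_inf q (a * q / p)"
proof -
  have "a * q / (a * q / p) = p" using assms by simp
  then have "wp a p k * wp a (a * q / p) k = (qpoch q p k * qpoch_inf q (p * q ^ k)) *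
      (qpoch q (a * q / p) k * qpoch_inf q (a * q / p * q ^ k))"
    by (simp add: wp_def mult_ac)
  then show ?thesis unfolding qpoch_inf_split[symmetric] .
qed

lemma norm_divide_less_iff_far:
  assumes "norm t > norm Z / norm q" 
  shows "norm (Z / t :: complex) < norm q"
proof -
  have "norm Z < norm q * norm t"
    using assms by (simp add: divide_less_eq mult.commute)
  moreover have "norm t > 0" using assms by (meson divide_nonneg_nonneg norm_ge_zero le_less_trans)
  ultimately show ?thesis by (simp add: norm_divide divide_less_eq)
qed

text \<open>The parameter q is the partner of a itself, so four factors remain. It is applied to the
  second series at b = 1, where q/b = q.\<close>

lemma tau_Phi_plus_q:
  assumes nz: "a \<noteq> 0" "b \<noteq> 0" "c \<noteq> 0" "d \<noteq> 0" "e \<noteq> 0"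
  shows "tau a b c d e q * Phi_plus a b c d e q +
      ((q - warg a b c d e q) * (1 + a) + warg a b c d e q * (b + c + d + e)
        - a * q * (1 / b + 1 / c + 1 / d + 1 / e)) * Phi a b c d e q
    = q * (qpoch_inf q a * qpoch_inf q q) * qpoch_inf q (warg a b c d e q) *
      (qpoch_inf q (a / b) * qpoch_inf q (a / c) * qpoch_inf q (a / d) * qpoch_inf q (a / e))"
    (is "?L b = ?R b")
proof (rule holomorphic_eq_on_nonzero[where f = ?L and g = ?R and t = b
      and R = "norm (a ^ 2 * q / (c * d * e)) / norm q"])
  show "?L holomorphic_on - {0}" "?R holomorphic_on - {0}"
    by (intro holomorphic_intros holomorphic_vwp_on_nonzero; use nz in simp)+
next
  fix b :: complex assume far: "norm b > norm (a ^ 2 * q / (c * d * e)) / norm q"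
  then have "norm b > 0" by (meson divide_nonneg_nonneg norm_ge_zero le_less_trans)
  then have b: "b \<noteq> 0" by simp
  have warg: "warg a b c d e q = a ^ 2 * q / (c * d * e) / b"
    by (simp add: warg_def power2_eq_square mult_ac)
  show "?L b = ?R b"
  proof (rule tau_Phi_plus_degenerate_aux)
    show "norm (warg a b c d e q) < norm q"
      unfolding warg using far by (rule norm_divide_less_iff_far)
    show "warg a b c d e q = a ^ 2 * q / (b * c * d * e)" by (simp add: warg mult_ac)
    fix k
    have pair: "wp a a k * wp a q k = qpoch_inf q a * qpoch_inf q q"
      using wp_pair[OF nz(1) nz(1), of k] nz by simp
    have "vwp_coeff a b c d e q k = (1 - a * q ^ (2 * k)) *
        (wp a a k * wp a q k * (wp a b k * wp a c k * wp a d k * wp a e k))"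
      unfolding vwp_coeff_def by (simp only: mult_ac)
    then show "vwp_coeff a b c d e q k = (1 - a * q ^ (2 * k)) *
        (qpoch_inf q a * qpoch_inf q q * (wp a b k * wp a c k * wp a d k * wp a e k))"
      unfolding pair .
  qed (use nz b in auto)
qed (rule nz)

text \<open>Here e and aq/e are partners and a is among the four remaining factors, so the boundary
  term contains (a/a)_inf = 0. It is applied to the second series at b = a, c = 1.\<close>

lemma tau_Phi_plus_pair:
  assumes nz: "a \<noteq> 0" "b \<noteq> 0" "c \<noteq> 0" "d \<noteq> 0" "e \<noteq> 0"
  shows "tau a b c d e (a * q / e) * Phi_plus a b c d e (a * q / e) +
      ((q - warg a b c d e (a * q / e)) * (1 + a) + warg a b c d e (a * q / e) * (a + b + c + d)
        - a * q * (1 / a + 1 / b + 1 / c + 1 / d)) * Phi a b c d e (a * q / e) = 0"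
    (is "?L b = 0")
proof (rule holomorphic_eq_on_nonzero[where f = ?L and t = b
      and R = "norm (a * q / (c * d)) / norm q"])
  show "?L holomorphic_on - {0}"
    by (intro holomorphic_intros holomorphic_vwp_on_nonzero) (use nz in auto)
next
  fix b :: complex assume far: "norm b > norm (a * q / (c * d)) / norm q"
  then have "norm b > 0" by (meson divide_nonneg_nonneg norm_ge_zero le_less_trans)
  then have b: "b \<noteq> 0" by simp
  have warg: "warg a b c d e (a * q / e) = a * q / (c * d) / b"
    using nz b by (simp add: warg_def power2_eq_square divide_simps)
  have "?L b =
    q * (qpoch_inf q e * qpoch_inf q (a * q / e)) * qpoch_inf q (warg a b c d e (a * q / e)) *
      (qpoch_inf q (a / a) * qpoch_inf q (a / b) * qpoch_inf q (a / c) * qpoch_inf q (a / d))"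
  proof (rule tau_Phi_plus_degenerate_aux)
    show "norm (warg a b c d e (a * q / e)) < norm q"
      unfolding warg using far by (rule norm_divide_less_iff_far)
    show "warg a b c d e (a * q / e) = a ^ 2 * q / (a * b * c * d)"
      using nz b by (simp add: warg power2_eq_square)
    fix k
    show "vwp_coeff a b c d e (a * q / e) k = (1 - a * q ^ (2 * k)) *
        (qpoch_inf q e * qpoch_inf q (a * q / e) * (wp a a k * wp a b k * wp a c k * wp a d k))"
      unfolding vwp_coeff_def wp_pair[OF nz(1) nz(5), of k] by (simp only: mult_ac)
  qed (use nz b in auto)
  then show "?L b = 0"
    using nz by simp
qed (use nz in auto)

text \<open>Two pairs of partners leave only the factors of a and f. By
  \<open>vwp_polynomial_2\<close> the sum telescopes, and its boundary term contains (a/a)_inf =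
  0.\<close>

lemma Phi_two_pairs:
  assumes nz: "a \<noteq> 0" "b \<noteq> 0" "c \<noteq> 0" "f \<noteq> 0"
  shows "Phi a b c (a * q / c) (a * q / b) f = 0"
proof (rule holomorphic_eq_on_nonzero[where t = f and R = 1])
  show "(\<lambda>f. Phi a b c (a * q / c) (a * q / b) f) holomorphic_on - {0}"
    by (intro holomorphic_intros holomorphic_vwp_on_nonzero) (use nz in auto)
next
  fix f :: complex assume far: "norm f > 1"
  then have f: "f \<noteq> 0" by auto
  have warg: "warg a b c (a * q / c) (a * q / b) f = 1 / f"
    using nz f by (simp add: warg_def power2_eq_square)
  have small: "norm (1 / f) < 1" using far f by (simp add: norm_divide)
  define K where "K = qpoch_inf q b * qpoch_inf q (a * q / b) * (qpoch_inf q c * qpoch_inf q (a * q / c))"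
  define V where "V = vwp_coeff a b c (a * q / c) (a * q / b) f"
  have coeff: "V k =
      (1 - a * q ^ (2 * k)) * (K * (wp a a k * wp a f k))" for k
  proof -
    have "V k = (1 - a * q ^ (2 * k)) *
      ((wp a b k * wp a (a * q / b) k) * (wp a c k * wp a (a * q / c) k) * (wp a a k * wp a f k))"
      unfolding V_def vwp_coeff_def by (simp only: mult_ac)
    then show ?thesis unfolding wp_pair[OF nz(1,2)] wp_pair[OF nz(1,3)] K_def .
  qed
  have p_nz: "\<And>p. p = a \<or> p = f \<Longrightarrow> p \<noteq> 0" using nz f by auto
  have "(\<lambda>k. wp a a k * wp a f k * (1 / f) ^ k * (1 / f * ((1 - a * q ^ k) * (1 - f * q ^ k)) -
      (1 - a * q ^ k / a) * (1 - a * q ^ k / f))) sums 0"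
    using wp_telescope[OF small, of "[a, f]" a] p_nz nz by (simp add: mult_ac)
  from sums_mult[OF this, of "qpoch_inf q (1 / f) * K"]
  have "(\<lambda>k. qpoch_inf q (1 / f) * K * (wp a a k * wp a f k * (1 / f) ^ k *
      ((1 / f - 1) * (1 - a * (q ^ k) ^ 2)))) sums 0"
    unfolding vwp_polynomial_2[OF f nz(1)] by simp
  moreover have "qpoch_inf q (1 / f) * K * (wp a a k * wp a f k * (1 / f) ^ k *
      ((1 / f - 1) * (1 - a * (q ^ k) ^ 2))) =
    (1 / f - 1) * (qpoch_inf q (1 / f) * (V k * (1 / f) ^ k))" for k
  proof -
    have "(q ^ k) ^ 2 = q ^ (2 * k)" by (simp add: power_mult[symmetric] mult.commute)
    then show ?thesis unfolding coeff by (simp only: mult_ac)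
  qed
  ultimately have "(\<lambda>k. (1 / f - 1) * (qpoch_inf q (1 / f) * (V k * (1 / f) ^ k))) sums 0"
    by simp
  moreover have "(\<lambda>k. (1 / f - 1) * (qpoch_inf q (1 / f) * (V k * (1 / f) ^ k))) sums
      ((1 / f - 1) * Phi a b c (a * q / c) (a * q / b) f)"
    using vwp_sums[of a b c "a * q / c" "a * q / b" f] small unfolding warg V_def[symmetric]
    by (intro sums_mult) simp
  ultimately have "(1 / f - 1) * Phi a b c (a * q / c) (a * q / b) f = 0"
    by (rule sums_unique2[symmetric])
  moreover have "f \<noteq> 1" using far by auto
  then have "1 / f - 1 \<noteq> 0" using f by (simp add: divide_simps)
  ultimately show "Phi a b c (a * q / c) (a * q / b) f = 0"
    using mult_eq_0_iff by blast
qed (use nz in auto)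

text \<open>The summands of \<open>contiguous_aux\<close> at x = q^k, with f = gq:
  \<open>vwp_polynomial_6\<close> for the parameters a, b, c, d, e, g.\<close>

lemma contiguous_polynomial:
  fixes a b c d e g x z :: complex
  assumes nz: "a \<noteq> 0" "b \<noteq> 0" "c \<noteq> 0" "d \<noteq> 0" "e \<noteq> 0" "g \<noteq> 0" "x \<noteq> 0"
    and z: "z = warg a b c d e (g * q)"
  defines "\<pi> \<equiv> (1 - a / g / c) * (1 - a / g / d) * (1 - a / g / e)"
  shows "(1 - a * x ^ 2) * ((b - g) * ((q - z) * ((1 - x) * (1 - a * x) / x) - lam a b c d e (g * q)) *
        ((1 - g * x) * (1 - a * x / g)) -
      g * q * \<pi> * (1 - g) * ((1 - g * x) * (1 - a * x / g) - (1 - b * x) * (1 - a * x / b)))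
    = - (q * (b - g)) / x *
      (z / q * ((1 - a*x) * (1 - b*x) * (1 - c*x) * (1 - d*x) * (1 - e*x) * (1 - g*x)) -
      (1 - a*x/a) * (1 - a*x/b) * (1 - a*x/c) * (1 - a*x/d) * (1 - a*x/e) * (1 - a*x/g))"
proof -
  define s where "s = 1 / b + 1 / c + 1 / d + 1 / e"
  define t where "t = b + c + d + e"
  define L where "L = (z / q - 1) * (1 + a * x ^ 2) +
        ((z / q - 1) * (g + a / g) + a * (1/a + 1/b + 1/c + 1/d + 1/e + 1/g)
          - z / q * (a + b + c + d + e + g)) * x"
  define N where "N = (1 - a/g/a) * (1 - a/g/b) * (1 - a/g/c) * (1 - a/g/d) * (1 - a/g/e)"
  have "z / q = a ^ 3 / (a * b * c * d * e * g)"
    using nz unfolding z warg_def by (simp add: power2_eq_square power3_eq_cube)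
  from vwp_polynomial_6[OF nz(1-6) this, of x]
  have rhs: "z / q * ((1 - a*x) * (1 - b*x) * (1 - c*x) * (1 - d*x) * (1 - e*x) * (1 - g*x)) -
      (1 - a*x/a) * (1 - a*x/b) * (1 - a*x/c) * (1 - a*x/d) * (1 - a*x/e) * (1 - a*x/g) =
      (1 - a * x ^ 2) * ((1 - g * x) * (1 - a * x / g) * L - g ^ 2 * N * x ^ 2)"
    unfolding L_def N_def .
  \<comment> \<open>Again only a constant in x is left over, and \<open>lam\<close> is that
    constant.\<close>
  have 1: "(q - z) * ((1 - x) * (1 - a * x) / x) - lam a b c d e (g * q) = - q * L / x"
  proof -
    have lam: "lam a b c d e (g * q) = z * (1 + a / g - t) - g * q - a * q + a * q * s"
      by (simp add: lam_def z[symmetric] s_def t_def)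
    have L: "L = (z / q - 1) * (1 + a * x ^ 2) +
        ((z / q - 1) * (g + a / g) + (1 + a * s + a / g) - z / q * (a + t + g)) * x"
      unfolding L_def s_def t_def using nz by (simp add: distrib_left)
    show ?thesis unfolding lam L using nz by (simp add: divide_simps) algebra
  qed
  \<comment> \<open>The difference of the two quadratics equals x (b - g)(1 - a/(bg)). This matches
    the remainder term of \<open>vwp_polynomial_6\<close>, in which p1 = a and p2 = b contribute (1
    - 1/g)(1 - a/(gb)).\<close>
  have 2: "g * q * \<pi> * (1 - g) * ((1 - g * x) * (1 - a * x / g) - (1 - b * x) * (1 - a * x / b)) =
      - (q * (b - g)) / x * (g ^ 2 * N * x ^ 2)"
  proof -
    have N: "N = (1 - 1 / g) * (1 - a / g / b) * \<pi>"
      using nz by (simp add: N_def \<pi>_def)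
    show ?thesis unfolding N using nz by (simp add: divide_simps) algebra
  qed
  show ?thesis
    unfolding rhs 1 2 by (simp add: algebra_simps add_divide_distrib diff_divide_distrib)
qed

text \<open>The parameter pairs (b, gq) and (bq, g) lie symmetrically above (b, g), so all summands
  are multiples of the product U for the parameters b and g. Their combination then telescopes to
  0.\<close>

lemma contiguous_aux:
  assumes nz: "a \<noteq> 0" "b \<noteq> 0" "c \<noteq> 0" "d \<noteq> 0" "e \<noteq> 0" "g \<noteq> 0" "g \<noteq> 1"
    and zq: "norm (warg a b c d e (g * q)) < norm q"
  defines "\<pi> \<equiv> (1 - a / g / c) * (1 - a / g / d) * (1 - a / g / e)"
  shows "(b - g) * (tau a b c d e (g * q) * Phi_plus a b c d e (g * q) -
      lam a b c d e (g * q) * Phi a b c d e (g * q)) =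
    g * q * \<pi> * ((1 - g) * Phi a b c d e (g * q) - (1 - b) * Phi a (b * q) c d e g)"
proof -
  define z where "z = warg a b c d e (g * q)"
  have z': "warg a (b * q) c d e g = z" unfolding z_def warg_def by (simp only: mult_ac)
  have z1: "norm z < 1" using zq norm_q_less_1 by (simp add: z_def)
  have zq': "norm (z / q) < 1" using zq by (simp add: z_def norm_divide)
  define \<Lambda> where "\<Lambda> = lam a b c d e (g * q)"
  define Z where "Z = qpoch_inf q z"
  define V where "V = vwp_coeff a b c d e (g * q)"
  define V' where "V' = vwp_coeff a (b * q) c d e g"
  define U where "U k = wp a a k * wp a b k * wp a c k * wp a d k * wp a e k * wp a g k" for k
  have gq: "g * q \<noteq> 0" using nz by simp
  have sV: "(\<lambda>k. Z * (V k * z ^ k)) sums Phi a b c d e (g * q)"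
    using vwp_sums[of a b c d e "g * q"] z1 by (simp add: z_def Z_def V_def)
  have sV': "(\<lambda>k. Z * (V' k * z ^ k)) sums Phi a (b * q) c d e g"
    using vwp_sums[of a "b * q" c d e g] z1 by (simp add: z' Z_def V'_def)
  have sp: "(\<lambda>k. (q - z) * (Z * (V k * z ^ k)) * ((1 - q ^ k) * (1 - a * q ^ k) / q ^ k)) sums
      (tau a b c d e (g * q) * Phi_plus a b c d e (g * q))"
    using tau_Phi_plus_sums[OF nz(1-5) gq zq] by (simp only: z_def Z_def V_def)
  \<comment> \<open>The factor 1 - g allows \<open>wp a (g * q)\<close> to be expressed by
    \<open>wp a g\<close>; it is cancelled at the end.\<close>
  define E where "E k = (1 - g) * ((b - g) * ((q - z) * (Z * (V k * z ^ k)) *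
        ((1 - q ^ k) * (1 - a * q ^ k) / q ^ k) - \<Lambda> * (Z * (V k * z ^ k))) -
      g * q * \<pi> * ((1 - g) * (Z * (V k * z ^ k)) - (1 - b) * (Z * (V' k * z ^ k))))" for k
  have S1: "E sums
    ((1 - g) * ((b - g) * (tau a b c d e (g * q) * Phi_plus a b c d e (g * q) -
        \<Lambda> * Phi a b c d e (g * q)) -
      g * q * \<pi> * ((1 - g) * Phi a b c d e (g * q) - (1 - b) * Phi a (b * q) c d e g)))"
    unfolding E_def[abs_def] by (intro sums_mult sums_diff sV sV' sp)
  define T where "T k = z / q * ((1 - a*q^k) * (1 - b*q^k) * (1 - c*q^k) * (1 - d*q^k) * (1 - e*q^k) *
      (1 - g*q^k)) - (1 - a*q^k/a) * (1 - a*q^k/b) * (1 - a*q^k/c) * (1 - a*q^k/d) *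
      (1 - a*q^k/e) * (1 - a*q^k/g)" for k
  have p_nz: "p \<noteq> 0" if "p \<in> set [a, b, c, d, e, g]" for p using that nz by auto
  have "(\<lambda>k. U k * (z / q) ^ k * T k) sums 0"
  proof -
    have eqs: "(\<Prod>p\<leftarrow>[a, b, c, d, e, g]. wp a p k) = U k"
      "z / q * (\<Prod>p\<leftarrow>[a, b, c, d, e, g]. 1 - p * q ^ k) - (\<Prod>p\<leftarrow>[a, b, c, d, e, g]. 1 - a * q ^ k / p)
        = T k" for k
      unfolding U_def T_def by (simp_all only: list.map prod_list.Cons prod_list.Nil mult_1_right mult.assoc)
    \<comment> \<open>The parameter a contributes (a/a)_inf = 0.\<close>
    have bnd: "- (\<Prod>p\<leftarrow>[a, b, c, d, e, g]. qpoch_inf q (a / p)) = 0" using nz by simp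
    show ?thesis
      using wp_telescope[OF zq', of "[a, b, c, d, e, g]" a, OF p_nz] unfolding eqs bnd .
  qed
  from sums_mult[OF this, of "- (q * (b - g)) * Z"]
  have "(\<lambda>k. - (q * (b - g)) * Z * (U k * (z / q) ^ k * T k)) sums 0" by simp
  moreover have "- (q * (b - g)) * Z * (U k * (z / q) ^ k * T k) = E k" for k
  proof -
    define x where "x = q ^ k"
    have x: "x \<noteq> 0" by (simp add: x_def)
    have x2: "q ^ (2 * k) = x ^ 2" unfolding x_def power_mult[symmetric] by (simp only: mult.commute)
    have V: "(1 - g) * V k = U k * ((1 - a * x ^ 2) * ((1 - g * x) * (1 - a * x / g)))"
    proof -
      have "(1 - g) * V k = (1 - a * q ^ (2 * k)) * (wp a a k * (wp a b k * (wp a c k * (wp a d k *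
          (wp a e k * ((1 - g) * wp a (g * q) k))))))"
        unfolding V_def vwp_coeff_def by (simp only: mult_ac)
      then show ?thesis
        unfolding wp_scale(1)[OF nz(6)] x2 U_def x_def[symmetric] by (simp only: mult_ac)
    qed
    have V': "(1 - b) * V' k = U k * ((1 - a * x ^ 2) * ((1 - b * x) * (1 - a * x / b)))"
    proof -
      have "(1 - b) * V' k = (1 - a * q ^ (2 * k)) * (wp a a k * (((1 - b) * wp a (b * q) k) *
          (wp a c k * (wp a d k * (wp a e k * wp a g k)))))"
        unfolding V'_def vwp_coeff_def by (simp only: mult_ac)
      then show ?thesis
        unfolding wp_scale(1)[OF nz(2)] x2 U_def x_def[symmetric] by (simp only: mult_ac)
    qed
    have pol: "(1 - a * x ^ 2) * ((b - g) * ((q - z) * ((1 - x) * (1 - a * x) / x) - \<Lambda>) *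
        ((1 - g * x) * (1 - a * x / g)) -
      g * q * \<pi> * (1 - g) * ((1 - g * x) * (1 - a * x / g) - (1 - b * x) * (1 - a * x / b))) =
      - (q * (b - g)) / x * T k"
      using contiguous_polynomial[OF nz(1-6) x z_def]
      unfolding \<Lambda>_def \<pi>_def T_def x_def[symmetric] .
    have lin: "(1 - g) * ((b - g) * ((q - z) * (Z * (v * \<xi>)) * y - \<Lambda> * (Z * (v * \<xi>))) -
        g * q * \<pi> * ((1 - g) * (Z * (v * \<xi>)) - (1 - b) * (Z * (v' * \<xi>)))) =
      Z * \<xi> * ((b - g) * ((q - z) * y - \<Lambda>) * ((1 - g) * v) -
        g * q * \<pi> * (1 - g) * ((1 - g) * v - (1 - b) * v'))" for v v' \<xi> y
      by algebra
    have lin': "Z * \<xi> * ((b - g) * y * (u * (m * F)) - g * q * \<pi> * (1 - g) * (u * (m * F) - u * (m * G))) =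
      Z * \<xi> * u * (m * ((b - g) * y * F - g * q * \<pi> * (1 - g) * (F - G)))" for \<xi> y u m F G
      by algebra
    have "(1 - g) * ((b - g) * ((q - z) * (Z * (V k * z ^ k)) * ((1 - x) * (1 - a * x) / x) -
        \<Lambda> * (Z * (V k * z ^ k))) -
      g * q * \<pi> * ((1 - g) * (Z * (V k * z ^ k)) - (1 - b) * (Z * (V' k * z ^ k)))) =
      Z * z ^ k * U k * ((1 - a * x ^ 2) *
        ((b - g) * ((q - z) * ((1 - x) * (1 - a * x) / x) - \<Lambda>) * ((1 - g * x) * (1 - a * x / g)) -
      g * q * \<pi> * (1 - g) * ((1 - g * x) * (1 - a * x / g) - (1 - b * x) * (1 - a * x / b))))"
      unfolding lin V V' lin' ..
    also have "\<dots> = Z * z ^ k * U k * (- (q * (b - g)) / x * T k)"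
      by (simp only: pol)
    also have "\<dots> = - (q * (b - g)) * Z * (U k * (z / q) ^ k * T k)"
      by (simp add: x_def power_divide)
    finally show ?thesis by (simp only: x_def E_def)
  qed
  ultimately have "E sums 0"
    by simp
  from sums_unique2[OF S1 this] nz(7) show ?thesis by (simp add: \<Lambda>_def)
qed

text \<open>Continuation of \<open>contiguous_aux\<close>, with g = f/q, from large c to all c; the
  value f = q, where 1 - g = 0, is added by continuity.\<close>

lemma contiguous:
  assumes nz: "a \<noteq> 0" "b \<noteq> 0" "c \<noteq> 0" "d \<noteq> 0" "e \<noteq> 0" "f \<noteq> 0"
  shows "(b - f / q) * (tau a b c d e f * Phi_plus a b c d e f - lam a b c d e f * Phi a b c d e f) =
    f * ((1 - a * q / f / c) * (1 - a * q / f / d) * (1 - a * q / f / e)) *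
      ((1 - f / q) * Phi a b c d e f - (1 - b) * Phi a (b * q) c d e (f / q))"
    (is "?L c f = ?R c f")
proof -
  have generic: "?L c f - ?R c f = 0" if f: "f \<noteq> 0" "f \<noteq> q" for f
  proof -
    have "?L c f = ?R c f"
    proof (rule holomorphic_eq_on_nonzero[where t = c and R = "norm (a ^ 2 * q ^ 2 / (b * d * e * f)) / norm q"])
      show "(\<lambda>c. ?L c f) holomorphic_on - {0}" "(\<lambda>c. ?R c f) holomorphic_on - {0}"
        by (intro holomorphic_intros holomorphic_vwp_on_nonzero; use nz f in simp)+
    next
      fix c :: complex assume far: "norm c > norm (a ^ 2 * q ^ 2 / (b * d * e * f)) / norm q"
      then have "norm c > 0" by (meson divide_nonneg_nonneg norm_ge_zero le_less_trans)
      then have c: "c \<noteq> 0" by simp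
      have "warg a b c d e f = a ^ 2 * q ^ 2 / (b * d * e * f) / c"
        by (simp add: warg_def mult_ac)
      then have "norm (warg a b c d e (f / q * q)) < norm q"
        using norm_divide_less_iff_far[OF far] by simp
      from contiguous_aux[OF nz(1,2) c nz(4,5) _ _ this] f
      show "?L c f = ?R c f" by simp
    qed (use nz in auto)
    then show ?thesis by simp
  qed
  have "?L c f - ?R c f = 0"
  proof (rule continuous_zero_off_countable[of "- {0}" "\<lambda>f. ?L c f - ?R c f" "{q}" f])
    show "continuous_on (- {0}) (\<lambda>f. ?L c f - ?R c f)"
      by (intro holomorphic_on_imp_continuous_on holomorphic_intros holomorphic_vwp_on_nonzero)
        (use nz in auto)
  qed (use generic nz in \<open>auto simp: open_nonzero\<close>)
  then show ?thesis by simp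
qed

section \<open>The bilinear form and its shifts\<close>


lemma prod_list_mset_cong:
  fixes h :: "complex \<Rightarrow> complex"
  assumes "mset xs = mset ys"
  shows "(\<Prod>p\<leftarrow>xs. h p) = (\<Prod>p\<leftarrow>ys. h p)"
  using assms by (metis mset_map prod_mset_prod_list)

lemma vwp_permute:
  assumes "mset [b, c, d, e, f] = mset [b', c', d', e', f']"
  shows "Phi a b c d e f = Phi a b' c' d' e' f'" (is ?P)
    and "Phi_plus a b c d e f = Phi_plus a b' c' d' e' f'" (is ?Pp)
    and "warg a b c d e f = warg a b' c' d' e' f'" (is ?W)
    and "tau a b c d e f = tau a b' c' d' e' f'" (is ?T)
    and "sigma a b c d e f = sigma a b' c' d' e' f'" (is ?S)
proof -
  have W: "warg a b c d e f = warg a b' c' d' e' f'"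
    if "mset [b, c, d, e, f] = mset [b', c', d', e', f']" for a b c d e f b' c' d' e' f'
    using prod_list_mset_cong[OF that, of "\<lambda>p. p"] by (simp add: warg_def mult_ac)
  have P: "Phi a b c d e f = Phi a b' c' d' e' f'"
    if "mset [b, c, d, e, f] = mset [b', c', d', e', f']" for a b c d e f b' c' d' e' f'
  proof -
    have "vwp_coeff a b c d e f = vwp_coeff a b' c' d' e' f'"
    proof
      fix k
      show "vwp_coeff a b c d e f k = vwp_coeff a b' c' d' e' f' k"
        using prod_list_mset_cong[OF that, of "\<lambda>p. wp a p k"] by (simp add: vwp_coeff_def mult_ac)
    qed
    then show ?thesis using W[OF that] by (simp add: Phi_def)
  qed
  show ?W ?P by (rule W[OF assms], rule P[OF assms])
  have "mset (map (\<lambda>p. p * q) [b, c, d, e, f]) = mset (map (\<lambda>p. p * q) [b', c', d', e', f'])"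
    unfolding mset_map assms ..
  then show ?Pp unfolding Phi_plus_def by (intro P) simp
  show ?T
    using W[OF assms] prod_list_mset_cong[OF assms, of "\<lambda>p. 1 - p"] by (simp add: tau_def mult_ac)
  have "(\<Sum>p\<leftarrow>[b, c, d, e, f]. 1 / p) = (\<Sum>p\<leftarrow>[b', c', d', e', f']. 1 / p)"
    using assms by (metis mset_map sum_mset_sum_list)
  then show ?S
    using W[OF assms] by (simp add: sigma_def add_ac)
qed

text \<open>Equal to s/q^2. It is the factor that relates S_2' and T_2' to \<open>sigma\<close> and
  \<open>tau\<close> of the second series.\<close>

definition mu :: fun6 where
  "mu a b c d e f = warg a b c d e f * a / q"

text \<open>The parameters of the second series, $W_2'$.\<close>

definition dual ::
  "fun6 \<Rightarrow> fun6" where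
  "dual F a b c d e f =
     F (c * d * e / a ^ 2) (c * e / a) (c * d / a) (d * e / a) (q / f) (q / b)"

text \<open>The bracket on the left of the theorem, multiplied by 1 - q and by the normalisations of
  both unshifted series.\<close>

definition Bil :: fun6 where
  "Bil a b c d e f =
     (sigma a b c d e f - mu a b c d e f * dual sigma a b c d e f) *
       Phi a b c d e f * dual Phi a b c d e f -
     tau a b c d e f * Phi_plus a b c d e f * dual Phi a b c d e f +
     mu a b c d e f * (dual tau a b c d e f * dual Phi_plus a b c d e f) * Phi a b c d e f"

text \<open>Manifest are only the permutations preserving {b, f} and {c, d, e}, since the second
  series treats the two groups differently.\<close>

lemma Bil_swap:
  "Bil a f c d e b = Bil a b c d e f"
  "Bil a b d c e f = Bil a b c d e f"
  "Bil a b c e d f = Bil a b c d e f"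
proof -
  have bf: "mset [f, c, d, e, b] = mset [b, c, d, e, f]"
    "mset [c * e / a, c * d / a, d * e / a, q / b, q / f] = mset [c * e / a, c * d / a, d * e / a, q / f, q / b]"
    by simp_all
  have cd: "mset [b, d, c, e, f] = mset [b, c, d, e, f]"
    "mset [d * e / a, d * c / a, c * e / a, q / f, q / b] = mset [c * e / a, c * d / a, d * e / a, q / f, q / b]"
    by (simp_all add: mult.commute)
  have de: "mset [b, c, e, d, f] = mset [b, c, d, e, f]"
    "mset [c * d / a, c * e / a, e * d / a, q / f, q / b] = mset [c * e / a, c * d / a, d * e / a, q / f, q / b]"
    by (simp_all add: mult.commute)
  have A: "d * c * e / a ^ 2 = c * d * e / a ^ 2" "c * e * d / a ^ 2 = c * d * e / a ^ 2"
    by (simp_all only: mult_ac)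
  show "Bil a f c d e b = Bil a b c d e f"
    unfolding Bil_def mu_def dual_def vwp_permute[OF bf(1)] vwp_permute[OF bf(2)] ..
  show "Bil a b d c e f = Bil a b c d e f"
    unfolding Bil_def mu_def dual_def A vwp_permute[OF cd(1)] vwp_permute[OF cd(2)] ..
  show "Bil a b c e d f = Bil a b c d e f"
    unfolding Bil_def mu_def dual_def A vwp_permute[OF de(1)] vwp_permute[OF de(2)] ..
qed

text \<open>Elimination of both \<open>Phi_plus\<close> terms by contiguous relations. The third
  hypothesis says that the coefficient of P * P2 cancels, which leaves a Casoratian.\<close>

lemma bilinear_combination:
  fixes P :: complex
  assumes "k * (t - l * P) = g * (u * P - v * P')" "k * (t2 - l2 * P2) = g2 * (u2 * P2 - v2 * P2')"
    and "k * ((s - l) - m * (s2 - l2)) = g * u - m * g2 * u2"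
  shows "k * ((s - m * s2) * P * P2 - t * P2 + m * t2 * P) = g * v * P' * P2 - m * g2 * v2 * P * P2'"
  using assms by algebra

lemma mu_sigma_lam_bf:
  assumes "a \<noteq> 0" "b \<noteq> 0" "c \<noteq> 0" "d \<noteq> 0" "e \<noteq> 0" "f \<noteq> 0"
  shows "mu a b c d e f * (dual sigma a b c d e f -
      lam (c * d * e / a ^ 2) (q / f) (c * e / a) (c * d / a) (d * e / a) (q / b)) =
    q + a * q * (1 / c + 1 / d + 1 / e) + warg a b c d e f * b + warg a b c d e f * a / b +
      a * q / f - b * q"
  using assms unfolding mu_def dual_def sigma_def lam_def warg_def
  by (simp add: divide_simps) algebra

lemma mu_sigma_lam_cd:
  assumes "a \<noteq> 0" "b \<noteq> 0" "c \<noteq> 0" "d \<noteq> 0" "e \<noteq> 0" "f \<noteq> 0"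
  shows "mu a b c d e f * (dual sigma a b c d e f -
      lam (c * d * e / a ^ 2) (c * e / a) (c * d / a) (q / f) (q / b) (d * e / a)) =
    q + a * q * (1 / d + 1 / e) + warg a b c d e f * (b + f) + warg a b c d e f * (d * e / q) +
      (1 - b * f / a) * (warg a b c d e f * c)"
  using assms unfolding mu_def dual_def sigma_def lam_def warg_def
  by (simp add: divide_simps) algebra

text \<open>The third hypothesis of \<open>bilinear_combination\<close> for the shift of b and f.
  This is where the exact form of S_1 - S_2' enters.\<close>

lemma coefficient_bf:
  fixes a b c d e f z :: complex
  assumes "a \<noteq> 0" "b \<noteq> 0" "c \<noteq> 0" "d \<noteq> 0" "e \<noteq> 0" "f \<noteq> 0"
    and z: "z = a ^ 2 * q ^ 2 / (b * c * d * e * f)"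
  shows "(b - f / q) * (z * a + z * (b + c + d + e) + f + (1 - z) * (a * q / f)
    - (q + a * q * (1 / c + 1 / d + 1 / e) + z * b + z * a / b + a * q / f - b * q)) =
    f * ((1 - a * q / f / c) * (1 - a * q / f / d) * (1 - a * q / f / e)) * (1 - f / q)
    - z * a / q * (f * ((1 - b * d / a) * (1 - b * c / a) * (1 - b * e / a))) * (1 - 1 / b)"
  unfolding z using assms(1-6) by (simp add: divide_simps) algebra

lemma coefficient_cd:
  fixes a b c d e f z :: complex
  assumes "a \<noteq> 0" "b \<noteq> 0" "c \<noteq> 0" "d \<noteq> 0" "e \<noteq> 0" "f \<noteq> 0"
    and z: "z = a ^ 2 * q ^ 2 / (b * c * d * e * f)"
  shows "(c - d / q) * (z * a + z * (c + b + e + f) + d + (1 - z) * (a * q / d)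
    - (q + a * q * (1 / d + 1 / e) + z * (b + f) + z * (d * e / q) + (1 - b * f / a) * (z * c))) =
    d * ((1 - a * q / d / b) * (1 - a * q / d / e) * (1 - a * q / d / f)) * (1 - d / q)
    - z * a / q * (d * ((1 - q / d) * (1 - c * f / a) * (1 - b * c / a))) * (1 - d * e / a / q)"
  unfolding z using assms(1-6) by (simp add: divide_simps) algebra

lemma sigma_minus_lam:
  "sigma a b c d e f - lam a b c d e f = warg a b c d e f * a + warg a b c d e f * (b + c + d + e) + f +
     (1 - warg a b c d e f) * (a * q / f)"
  by (simp add: sigma_def lam_def algebra_simps)

text \<open>The shift (b, f) -> (bq, f/q) multiplies q/f by q, divides q/b by q and fixes the other
  parameters of the second series. So \<open>contiguous\<close> applies to both series at
  once.\<close>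

lemma Bil_casoratian_bf:
  assumes nz: "a \<noteq> 0" "b \<noteq> 0" "c \<noteq> 0" "d \<noteq> 0" "e \<noteq> 0" "f \<noteq> 0"
  shows "(b - f / q) * Bil a b c d e f =
    f * ((1 - a * q / f / c) * (1 - a * q / f / d) * (1 - a * q / f / e)) * (1 - b) *
      Phi a (b * q) c d e (f / q) * dual Phi a b c d e f -
    mu a b c d e f * (f * ((1 - b * d / a) * (1 - b * c / a) * (1 - b * e / a))) * (1 - q / f) *
      Phi a b c d e f * dual Phi a (b * q) c d e (f / q)"
proof -
  define A where "A = c * d * e / a ^ 2"
  have perm: "mset [q / x, c * e / a, c * d / a, d * e / a, q / y] =
      mset [c * e / a, c * d / a, d * e / a, q / x, q / y]" for x y
    by simp
  have nz2: "A \<noteq> 0" "q / f \<noteq> 0" "c * e / a \<noteq> 0" "c * d / a \<noteq> 0" "d * e / a \<noteq> 0" "q / b \<noteq> 0"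
    using nz by (simp_all add: A_def)
  have shifted: "q / f * q = q / (f / q)" "q / b / q = q / (b * q)"
    using nz by simp_all
  have fac: "1 - A * q / (q / b) / (c * e / a) = 1 - b * d / a"
    "1 - A * q / (q / b) / (c * d / a) = 1 - b * e / a"
    "1 - A * q / (q / b) / (d * e / a) = 1 - b * c / a"
    using nz by (simp_all add: A_def power2_eq_square)
  have "(q / f - q / b / q) *
     (dual tau a b c d e f * dual Phi_plus a b c d e f -
       lam A (q / f) (c * e / a) (c * d / a) (d * e / a) (q / b) * dual Phi a b c d e f) =
     q / b * ((1 - b * d / a) * (1 - b * e / a) * (1 - b * c / a)) *
     ((1 - q / b / q) * dual Phi a b c d e f - (1 - q / f) * dual Phi a (b * q) c d e (f / q))"
    using contiguous[OF nz2]
    unfolding fac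
    unfolding shifted(1) vwp_permute[OF perm] A_def dual_def
    unfolding shifted(2) vwp_permute[OF perm] .
  moreover have "b - f / q = b * f / q * (q / f - q / b / q)" using nz by (simp add: field_simps)
  ultimately have "(b - f / q) * (dual tau a b c d e f * dual Phi_plus a b c d e f -
       lam A (q / f) (c * e / a) (c * d / a) (d * e / a) (q / b) * dual Phi a b c d e f) =
     b * f / q * (q / b * ((1 - b * d / a) * (1 - b * e / a) * (1 - b * c / a)) *
     ((1 - q / b / q) * dual Phi a b c d e f - (1 - q / f) * dual Phi a (b * q) c d e (f / q)))"
    by (simp only: mult.assoc)
  also have "\<dots> = f * ((1 - b * d / a) * (1 - b * c / a) * (1 - b * e / a)) *
     ((1 - 1 / b) * dual Phi a b c d e f - (1 - q / f) * dual Phi a (b * q) c d e (f / q))"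
    using nz by simp
  finally have C2: "(b - f / q) * (dual tau a b c d e f * dual Phi_plus a b c d e f -
       lam A (q / f) (c * e / a) (c * d / a) (d * e / a) (q / b) * dual Phi a b c d e f) =
     f * ((1 - b * d / a) * (1 - b * c / a) * (1 - b * e / a)) *
     ((1 - 1 / b) * dual Phi a b c d e f - (1 - q / f) * dual Phi a (b * q) c d e (f / q))" .
  have co: "(b - f / q) * ((sigma a b c d e f - lam a b c d e f) - mu a b c d e f *
      (dual sigma a b c d e f - lam A (q / f) (c * e / a) (c * d / a) (d * e / a) (q / b))) =
    f * ((1 - a * q / f / c) * (1 - a * q / f / d) * (1 - a * q / f / e)) * (1 - f / q) -
    mu a b c d e f * (f * ((1 - b * d / a) * (1 - b * c / a) * (1 - b * e / a))) * (1 - 1 / b)"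
    unfolding A_def mu_sigma_lam_bf[OF nz] sigma_minus_lam
    unfolding mu_def
    by (rule coefficient_bf[OF nz warg_def])
  show ?thesis
    unfolding Bil_def by (rule bilinear_combination[OF contiguous[OF nz] C2 co])
qed

text \<open>The shift (c, d) -> (cq, d/q) fixes cd and cde, so in the second series only ce/a and
  de/a move, again in opposite directions.\<close>

lemma Bil_casoratian_cd:
  assumes nz: "a \<noteq> 0" "b \<noteq> 0" "c \<noteq> 0" "d \<noteq> 0" "e \<noteq> 0" "f \<noteq> 0"
  shows "(c - d / q) * Bil a b c d e f =
    d * ((1 - a * q / d / b) * (1 - a * q / d / e) * (1 - a * q / d / f)) * (1 - c) *
      Phi a b (c * q) (d / q) e f * dual Phi a b c d e f -
    mu a b c d e f * (d * ((1 - q / d) * (1 - c * f / a) * (1 - b * c / a))) * (1 - c * e / a) *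
      Phi a b c d e f * dual Phi a b (c * q) (d / q) e f"
proof -
  define A where "A = c * d * e / a ^ 2"
  have perm: "mset [x, b, e, f, y] = mset [b, x, y, e, f]" for x y :: complex
    by simp
  have perm2: "mset [x, c * d / a, q / f, q / b, y] = mset [x, c * d / a, y, q / f, q / b]" for x y
    by simp
  have nz2: "A \<noteq> 0" "c * e / a \<noteq> 0" "c * d / a \<noteq> 0" "q / f \<noteq> 0" "q / b \<noteq> 0" "d * e / a \<noteq> 0"
    using nz by (simp_all add: A_def)
  have shifted: "c * e / a * q = (c * q) * e / a" "d * e / a / q = (d / q) * e / a"
    "c * q * (d / q) = c * d"
    using nz by simp_all
  have fac: "1 - A * q / (d * e / a) / (c * d / a) = 1 - q / d"
    "1 - A * q / (d * e / a) / (q / f) = 1 - c * f / a"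
    "1 - A * q / (d * e / a) / (q / b) = 1 - b * c / a"
    using nz by (simp_all add: A_def power2_eq_square)
  have "(c * e / a - d * e / a / q) *
     (dual tau a b c d e f * dual Phi_plus a b c d e f -
       lam A (c * e / a) (c * d / a) (q / f) (q / b) (d * e / a) * dual Phi a b c d e f) =
     d * e / a * ((1 - q / d) * (1 - c * f / a) * (1 - b * c / a)) *
     ((1 - d * e / a / q) * dual Phi a b c d e f -
      (1 - c * e / a) * dual Phi a b (c * q) (d / q) e f)"
    using contiguous[OF nz2] unfolding fac
    unfolding vwp_permute[OF perm2] dual_def shifted A_def[symmetric] .
  moreover have "c - d / q = a / e * (c * e / a - d * e / a / q)" using nz by (simp add: field_simps)
  ultimately have "(c - d / q) * (dual tau a b c d e f * dual Phi_plus a b c d e f -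
       lam A (c * e / a) (c * d / a) (q / f) (q / b) (d * e / a) * dual Phi a b c d e f) =
     a / e * (d * e / a * ((1 - q / d) * (1 - c * f / a) * (1 - b * c / a)) *
     ((1 - d * e / a / q) * dual Phi a b c d e f -
      (1 - c * e / a) * dual Phi a b (c * q) (d / q) e f))"
    by (simp only: mult.assoc)
  also have "\<dots> = d * ((1 - q / d) * (1 - c * f / a) * (1 - b * c / a)) *
     ((1 - d * e / a / q) * dual Phi a b c d e f -
      (1 - c * e / a) * dual Phi a b (c * q) (d / q) e f)"
    using nz by simp
  finally have C2: "(c - d / q) * (dual tau a b c d e f * dual Phi_plus a b c d e f -
       lam A (c * e / a) (c * d / a) (q / f) (q / b) (d * e / a) * dual Phi a b c d e f) =
     d * ((1 - q / d) * (1 - c * f / a) * (1 - b * c / a)) *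
     ((1 - d * e / a / q) * dual Phi a b c d e f -
      (1 - c * e / a) * dual Phi a b (c * q) (d / q) e f)" .
  have C1: "(c - d / q) * (tau a b c d e f * Phi_plus a b c d e f - lam a c b e f d * Phi a b c d e f) =
    d * ((1 - a * q / d / b) * (1 - a * q / d / e) * (1 - a * q / d / f)) *
      ((1 - d / q) * Phi a b c d e f - (1 - c) * Phi a b (c * q) (d / q) e f)"
    using contiguous[OF nz(1,3,2,5,6,4)] unfolding vwp_permute[OF perm] .
  have sl: "sigma a b c d e f - lam a c b e f d = warg a b c d e f * a +
      warg a b c d e f * (c + b + e + f) + d + (1 - warg a b c d e f) * (a * q / d)"
    using sigma_minus_lam[of a c b e f d] unfolding vwp_permute[OF perm] .
  have co: "(c - d / q) * ((sigma a b c d e f - lam a c b e f d) - mu a b c d e f *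
      (dual sigma a b c d e f - lam A (c * e / a) (c * d / a) (q / f) (q / b) (d * e / a))) =
    d * ((1 - a * q / d / b) * (1 - a * q / d / e) * (1 - a * q / d / f)) * (1 - d / q) -
    mu a b c d e f * (d * ((1 - q / d) * (1 - c * f / a) * (1 - b * c / a))) * (1 - d * e / a / q)"
    unfolding A_def
    unfolding mu_sigma_lam_cd[OF nz] sl
    unfolding mu_def
    by (rule coefficient_cd[OF nz warg_def])
  show ?thesis
    unfolding Bil_def by (rule bilinear_combination[OF C1 C2 co])
qed

lemma holomorphic_Bil:
  assumes hol: "\<alpha> holomorphic_on - {0}" "\<beta> holomorphic_on - {0}" "\<gamma> holomorphic_on - {0}"
      "\<delta> holomorphic_on - {0}" "\<epsilon> holomorphic_on - {0}" "\<zeta> holomorphic_on - {0}"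
    and nz: "\<And>t. t \<noteq> 0 \<Longrightarrow>
      \<alpha> t \<noteq> 0 \<and> \<beta> t \<noteq> 0 \<and> \<gamma> t \<noteq> 0 \<and> \<delta> t \<noteq> 0 \<and> \<epsilon> t \<noteq> 0 \<and> \<zeta> t \<noteq> 0"
  shows "(\<lambda>t. Bil (\<alpha> t) (\<beta> t) (\<gamma> t) (\<delta> t) (\<epsilon> t) (\<zeta> t)) holomorphic_on - {0}"
  unfolding Bil_def mu_def dual_def
  by (intro holomorphic_intros holomorphic_vwp_on_nonzero hol) (use nz in auto)

text \<open>The Casoratian is taken at (b, f) and at (f/q, bq). The second shift leads to (f, b), so
  by symmetry the same products X and Y occur, and corresponding coefficients are proportional with
  ratio f/(bq), up to a common sign.\<close>

lemma Bil_shift_bf: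
  assumes nz: "a \<noteq> 0" "b \<noteq> 0" "c \<noteq> 0" "d \<noteq> 0" "e \<noteq> 0" "f \<noteq> 0"
  shows "Bil a (b * q) c d e (f / q) = f / (b * q) * Bil a b c d e f"
proof -
  have generic: "Bil a (b * q) c d e (f / q) = f / (b * q) * Bil a b c d e f"
    if b: "b \<noteq> 0" "b \<noteq> f / q" for b
  proof -
    define m where "m = mu a b c d e f"
    have m: "m = a ^ 3 * q / (b * c * d * e * f)"
      unfolding m_def mu_def warg_def by (simp add: power2_eq_square power3_eq_cube mult_ac)
    have mu': "mu a (f / q) c d e (b * q) = m" unfolding m_def mu_def warg_def by (simp add: mult_ac)
    have perm: "mset [f / q, c, d, e, b * q] = mset [b * q, c, d, e, f / q]"
      "mset [f, c, d, e, b] = mset [b, c, d, e, f]" by simp_all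
    have dual: "dual Phi a (f / q) c d e (b * q) = dual Phi a (b * q) c d e (f / q)"
      "dual Phi a f c d e b = dual Phi a b c d e f"
      unfolding dual_def by (rule vwp_permute(1); simp)+
    define X where "X = Phi a b c d e f * dual Phi a (b * q) c d e (f / q)"
    define Y where "Y = Phi a (b * q) c d e (f / q) * dual Phi a b c d e f"
    have "b * q \<noteq> 0" "f / q \<noteq> 0" "f / q * q = f" "b * q / q = b" using nz b by simp_all
    with Bil_casoratian_bf[of a "f / q" c d e "b * q"] nz
    have 1: "(f / q - b) * Bil a (b * q) c d e (f / q) =
      b * q * ((1 - a / b / c) * (1 - a / b / d) * (1 - a / b / e)) * (1 - f / q) * X -
      m * (b * q * ((1 - f * d / q / a) * (1 - f * c / q / a) * (1 - f * e / q / a))) * (1 - 1 / b) * Y"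
      by (simp add: mu' dual vwp_permute(1)[OF perm(1)] vwp_permute(1)[OF perm(2)]
          Bil_swap(1)[of a "f / q" c d e "b * q"] X_def Y_def mult_ac)
    have 2: "(b - f / q) * Bil a b c d e f =
      f * ((1 - a * q / f / c) * (1 - a * q / f / d) * (1 - a * q / f / e)) * (1 - b) * Y -
      m * (f * ((1 - b * d / a) * (1 - b * c / a) * (1 - b * e / a))) * (1 - q / f) * X"
      using Bil_casoratian_bf[OF nz(1) b(1) nz(3-6)] unfolding X_def Y_def m_def
      by (simp only: mult.assoc)
    have cX: "b * q * ((1 - a / b / c) * (1 - a / b / d) * (1 - a / b / e)) * (1 - f / q) =
      f / (b * q) * (m * (f * ((1 - b * d / a) * (1 - b * c / a) * (1 - b * e / a))) * (1 - q / f))"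
      unfolding m using nz b by (simp add: divide_simps) algebra
    have cY: "m * (b * q * ((1 - f * d / q / a) * (1 - f * c / q / a) * (1 - f * e / q / a))) * (1 - 1 / b) =
      f / (b * q) * (f * ((1 - a * q / f / c) * (1 - a * q / f / d) * (1 - a * q / f / e)) * (1 - b))"
      unfolding m using nz b by (simp add: divide_simps) algebra
    have "(b - f / q) * Bil a (b * q) c d e (f / q) = f / (b * q) * ((b - f / q) * Bil a b c d e f)"
      using 1 2 unfolding cX cY by algebra
    then have "(b - f / q) * Bil a (b * q) c d e (f / q) = (b - f / q) * (f / (b * q) * Bil a b c d e f)"
      by (simp only: mult_ac)
    moreover have "b - f / q \<noteq> 0" using b(2) by simp
    ultimately show ?thesis using mult_left_cancel by blast
  qed
  have "Bil a (b * q) c d e (f / q) - f / (b * q) * Bil a b c d e f = 0"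
  proof (rule continuous_zero_off_countable[of "- {0}"
        "\<lambda>b. Bil a (b * q) c d e (f / q) - f / (b * q) * Bil a b c d e f" "{f / q}" b])
    show "continuous_on (- {0}) (\<lambda>b. Bil a (b * q) c d e (f / q) - f / (b * q) * Bil a b c d e f)"
      by (intro holomorphic_on_imp_continuous_on holomorphic_intros holomorphic_Bil)
        (use nz in auto)
  qed (use generic nz in \<open>auto simp: open_nonzero\<close>)
  then show ?thesis by simp
qed

lemma Bil_shift_cd:
  assumes nz: "a \<noteq> 0" "b \<noteq> 0" "c \<noteq> 0" "d \<noteq> 0" "e \<noteq> 0" "f \<noteq> 0"
  shows "Bil a b (c * q) (d / q) e f = d / (c * q) * Bil a b c d e f"
proof -
  have generic: "Bil a b (c * q) (d / q) e f = d / (c * q) * Bil a b c d e f"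
    if c: "c \<noteq> 0" "c \<noteq> d / q" for c
  proof -
    define m where "m = mu a b c d e f"
    have m: "m = a ^ 3 * q / (b * c * d * e * f)"
      unfolding m_def mu_def warg_def by (simp add: power2_eq_square power3_eq_cube mult_ac)
    have mu': "mu a b (d / q) (c * q) e f = m" unfolding m_def mu_def warg_def by (simp add: mult_ac)
    have perm: "mset [b, d / q, c * q, e, f] = mset [b, c * q, d / q, e, f]"
      "mset [b, d, c, e, f] = mset [b, c, d, e, f]" by simp_all
    have dual: "dual Phi a b (d / q) (c * q) e f = dual Phi a b (c * q) (d / q) e f"
      "dual Phi a b d c e f = dual Phi a b c d e f"
      unfolding dual_def by (rule trans[OF vwp_permute(1) arg_cong[of _ _ "\<lambda>A. Phi A _ _ _ _ _"]]; simp add: mult_ac)+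
    define X where "X = Phi a b c d e f * dual Phi a b (c * q) (d / q) e f"
    define Y where "Y = Phi a b (c * q) (d / q) e f * dual Phi a b c d e f"
    have "c * q \<noteq> 0" "d / q \<noteq> 0" "d / q * q = d" "c * q / q = c" using nz c by simp_all
    with Bil_casoratian_cd[of a b "d / q" "c * q" e f] nz
    have 1: "(d / q - c) * Bil a b (c * q) (d / q) e f =
      c * q * ((1 - a / c / b) * (1 - a / c / e) * (1 - a / c / f)) * (1 - d / q) * X -
      m * (c * q * ((1 - 1 / c) * (1 - d * f / q / a) * (1 - b * d / q / a))) * (1 - d * e / q / a) * Y"
      by (simp add: mu' dual vwp_permute(1)[OF perm(1)] vwp_permute(1)[OF perm(2)]
          Bil_swap(2)[of a b "d / q" "c * q" e f] X_def Y_def mult_ac)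
    have 2: "(c - d / q) * Bil a b c d e f =
      d * ((1 - a * q / d / b) * (1 - a * q / d / e) * (1 - a * q / d / f)) * (1 - c) * Y -
      m * (d * ((1 - q / d) * (1 - c * f / a) * (1 - b * c / a))) * (1 - c * e / a) * X"
      using Bil_casoratian_cd[OF nz(1,2) c(1) nz(4-6)] unfolding X_def Y_def m_def
      by (simp only: mult.assoc)
    have cX: "c * q * ((1 - a / c / b) * (1 - a / c / e) * (1 - a / c / f)) * (1 - d / q) =
      d / (c * q) * (m * (d * ((1 - q / d) * (1 - c * f / a) * (1 - b * c / a))) * (1 - c * e / a))"
      unfolding m using nz c by (simp add: divide_simps) algebra
    have cY: "m * (c * q * ((1 - 1 / c) * (1 - d * f / q / a) * (1 - b * d / q / a))) * (1 - d * e / q / a) =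
      d / (c * q) * (d * ((1 - a * q / d / b) * (1 - a * q / d / e) * (1 - a * q / d / f)) * (1 - c))"
      unfolding m using nz c by (simp add: divide_simps) algebra
    have "(c - d / q) * Bil a b (c * q) (d / q) e f = d / (c * q) * ((c - d / q) * Bil a b c d e f)"
      using 1 2 unfolding cX cY by algebra
    then have "(c - d / q) * Bil a b (c * q) (d / q) e f = (c - d / q) * (d / (c * q) * Bil a b c d e f)"
      by (simp only: mult_ac)
    moreover have "c - d / q \<noteq> 0" using c(2) by simp
    ultimately show ?thesis using mult_left_cancel by blast
  qed
  have "Bil a b (c * q) (d / q) e f - d / (c * q) * Bil a b c d e f = 0"
  proof (rule continuous_zero_off_countable[of "- {0}"
        "\<lambda>c. Bil a b (c * q) (d / q) e f - d / (c * q) * Bil a b c d e f" "{d / q}" c])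
    show "continuous_on (- {0}) (\<lambda>c. Bil a b (c * q) (d / q) e f - d / (c * q) * Bil a b c d e f)"
      by (intro holomorphic_on_imp_continuous_on holomorphic_intros holomorphic_Bil)
        (use nz in auto)
  qed (use generic nz in \<open>auto simp: open_nonzero\<close>)
  then show ?thesis by simp
qed

section \<open>Vanishing of the defect\<close>


text \<open>The bracket on the right of the theorem without denominators. The factor q/a and the
  minus sign come from (a/q, q^2/a)_inf / (a, q/a)_inf = -a/q.\<close>

definition ThetaSide :: fun6 where
  "ThetaSide a b c d e f =
     q / a * theta (warg a b c d e f) *
       (theta (a / b) * theta (a / c) * theta (a / d) * theta (a / e) * theta (a / f)) -
     theta (mu a b c d e f) * (theta b * theta c * theta d * theta e * theta f)"

text \<open>Cleared of denominators, hence holomorphic for all nonzero parameters. The extra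
  products depend only on a and cde, so they are invariant under both shifts.\<close>

definition Defect :: fun6 where
  "Defect a b c d e f = qpoch_inf q (q / a) * Bil a b c d e f -
     q * qpoch_inf q q ^ 2 * qpoch_inf q (c * d * e / a ^ 2) * ThetaSide a b c d e f"

lemma Defect_swap:
  "Defect a f c d e b = Defect a b c d e f"
  "Defect a b d c e f = Defect a b c d e f"
  "Defect a b c e d f = Defect a b c d e f"
proof -
  have bf: "mset [f, c, d, e, b] = mset [b, c, d, e, f]" and cd: "mset [b, d, c, e, f] = mset [b, c, d, e, f]"
    and de: "mset [b, c, e, d, f] = mset [b, c, d, e, f]"
    by simp_all
  show "Defect a f c d e b = Defect a b c d e f"
    unfolding Defect_def Bil_swap(1)[of a b c d e f] ThetaSide_def mu_def vwp_permute(3)[OF bf] by (simp add: mult_ac)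
  show "Defect a b d c e f = Defect a b c d e f"
    unfolding Defect_def Bil_swap(2)[of a b c d e f] ThetaSide_def mu_def vwp_permute(3)[OF cd] by (simp add: mult_ac)
  show "Defect a b c e d f = Defect a b c d e f"
    unfolding Defect_def Bil_swap(3)[of a b c d e f] ThetaSide_def mu_def vwp_permute(3)[OF de] by (simp add: mult_ac)
qed

text \<open>Both theta products acquire the multiplier of \<open>Bil_shift_bf\<close>, as the
  quasi-periodicity of the defect requires.\<close>

lemma theta_pair_shift:
  assumes "a \<noteq> 0" "b \<noteq> 0" "f \<noteq> 0"
  shows "theta (a / (b * q)) * theta (a / (f / q)) = f / (b * q) * (theta (a / b) * theta (a / f))"
    and "theta (b * q) * theta (f / q) = f / (b * q) * (theta b * theta f)"
proof -
  have 1: "theta (a / (b * q)) = - (a / b / q) * theta (a / b)"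
    using theta_shift_down[of "a / b"] assms by simp
  have 2: "theta (a / (f / q)) = - theta (a / f) / (a / f)"
    using theta_shift[of "a / f"] assms by simp
  show "theta (a / (b * q)) * theta (a / (f / q)) = f / (b * q) * (theta (a / b) * theta (a / f))"
    unfolding 1 2 using assms by simp
  show "theta (b * q) * theta (f / q) = f / (b * q) * (theta b * theta f)"
    unfolding theta_shift[OF assms(2)] theta_shift_down[OF assms(3)] using assms by simp
qed

lemma Defect_shift_bf:
  assumes nz: "a \<noteq> 0" "b \<noteq> 0" "c \<noteq> 0" "d \<noteq> 0" "e \<noteq> 0" "f \<noteq> 0"
  shows "Defect a (b * q) c d e (f / q) = f / (b * q) * Defect a b c d e f"
proof -
  have w: "warg a (b * q) c d e (f / q) = warg a b c d e f" by (simp add: warg_def)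
  define T1 T2 T3 T4 where "T1 = theta (warg a b c d e f)" and "T2 = theta (mu a b c d e f)"
    and "T3 = theta (a / c) * theta (a / d) * theta (a / e)" and "T4 = theta c * theta d * theta e"
  have "ThetaSide a (b * q) c d e (f / q) =
      q / a * T1 * (T3 * (theta (a / (b * q)) * theta (a / (f / q)))) -
      T2 * (T4 * (theta (b * q) * theta (f / q)))"
    unfolding ThetaSide_def mu_def w T1_def T2_def T3_def T4_def by (simp only: mult_ac)
  also have "\<dots> = f / (b * q) * (q / a * T1 * (T3 * (theta (a / b) * theta (a / f))) -
      T2 * (T4 * (theta b * theta f)))"
    unfolding theta_pair_shift[OF nz(1,2,6)] by (simp only: mult_ac right_diff_distrib)
  also have "q / a * T1 * (T3 * (theta (a / b) * theta (a / f))) - T2 * (T4 * (theta b * theta f)) =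
      ThetaSide a b c d e f"
    unfolding ThetaSide_def T1_def T2_def T3_def T4_def by (simp only: mult_ac)
  finally show ?thesis
    unfolding Defect_def Bil_shift_bf[OF nz] by (simp only: mult_ac right_diff_distrib)
qed

lemma Defect_shift_cd:
  assumes nz: "a \<noteq> 0" "b \<noteq> 0" "c \<noteq> 0" "d \<noteq> 0" "e \<noteq> 0" "f \<noteq> 0"
  shows "Defect a b (c * q) (d / q) e f = d / (c * q) * Defect a b c d e f"
proof -
  have w: "warg a b (c * q) (d / q) e f = warg a b c d e f" "c * q * (d / q) * e = c * d * e"
    by (simp_all add: warg_def)
  define T1 T2 T3 T4 where "T1 = theta (warg a b c d e f)" and "T2 = theta (mu a b c d e f)"
    and "T3 = theta (a / b) * theta (a / e) * theta (a / f)" and "T4 = theta b * theta e * theta f"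
  have "ThetaSide a b (c * q) (d / q) e f =
      q / a * T1 * (T3 * (theta (a / (c * q)) * theta (a / (d / q)))) -
      T2 * (T4 * (theta (c * q) * theta (d / q)))"
    unfolding ThetaSide_def mu_def w T1_def T2_def T3_def T4_def by (simp only: mult_ac)
  also have "\<dots> = d / (c * q) * (q / a * T1 * (T3 * (theta (a / c) * theta (a / d))) -
      T2 * (T4 * (theta c * theta d)))"
    unfolding theta_pair_shift[OF nz(1,3,4)] by (simp only: mult_ac right_diff_distrib)
  also have "q / a * T1 * (T3 * (theta (a / c) * theta (a / d))) - T2 * (T4 * (theta c * theta d)) =
      ThetaSide a b c d e f"
    unfolding ThetaSide_def T1_def T2_def T3_def T4_def by (simp only: mult_ac)
  finally show ?thesis
    unfolding Defect_def Bil_shift_cd[OF nz] w by (simp only: mult_ac right_diff_distrib)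
qed

lemma holomorphic_Defect:
  assumes hol: "\<alpha> holomorphic_on - {0}" "\<beta> holomorphic_on - {0}" "\<gamma> holomorphic_on - {0}"
      "\<delta> holomorphic_on - {0}" "\<epsilon> holomorphic_on - {0}" "\<zeta> holomorphic_on - {0}"
    and nz: "\<And>t. t \<noteq> 0 \<Longrightarrow>
      \<alpha> t \<noteq> 0 \<and> \<beta> t \<noteq> 0 \<and> \<gamma> t \<noteq> 0 \<and> \<delta> t \<noteq> 0 \<and> \<epsilon> t \<noteq> 0 \<and> \<zeta> t \<noteq> 0"
  shows "(\<lambda>t. Defect (\<alpha> t) (\<beta> t) (\<gamma> t) (\<delta> t) (\<epsilon> t) (\<zeta> t)) holomorphic_on - {0}"
proof -
  have w: "warg (\<alpha> t) (\<beta> t) (\<gamma> t) (\<delta> t) (\<epsilon> t) (\<zeta> t) \<noteq> 0" if "t \<noteq> 0" for t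
    using nz[OF that] by (simp add: warg_def)
  show ?thesis
    unfolding Defect_def ThetaSide_def mu_def
    by (intro holomorphic_intros holomorphic_vwp_on_nonzero holomorphic_Bil hol) (use nz w in auto)
qed

lemma theta_divide: "a \<noteq> 0 \<Longrightarrow> p \<noteq> 0 \<Longrightarrow>
    theta (a / p) = - (a / p) * (qpoch_inf q (a * q / p) * qpoch_inf q (p / a))"
  using theta_shift_down[of "a * q / p"] by (simp add: theta_def)

text \<open>As (1)_k = 0 for k > 0, only the term k = 0 remains; (1 - a)(aq)_inf combines to
  (a)_inf.\<close>

lemma Phi_1:
  assumes nz: "a \<noteq> 0" "c \<noteq> 0" "d \<noteq> 0" "e \<noteq> 0" "f \<noteq> 0"
  shows "Phi a 1 c d e f = qpoch_inf q (warg a 1 c d e f) * (qpoch_inf q a * qpoch_inf q q *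
    (qpoch_inf q (a * q / c) * qpoch_inf q (a * q / d) * qpoch_inf q (a * q / e) * qpoch_inf q (a * q / f)))"
    (is "?L c = ?R c")
proof (rule holomorphic_eq_on_nonzero[where f = ?L and g = ?R and t = c and R = "norm (a ^ 2 * q ^ 2 / (d * e * f)) / norm q"])
  show "?L holomorphic_on - {0}" "?R holomorphic_on - {0}"
    by (intro holomorphic_intros holomorphic_vwp_on_nonzero; use nz in simp)+
next
  fix c :: complex assume far: "norm c > norm (a ^ 2 * q ^ 2 / (d * e * f)) / norm q"
  have "warg a 1 c d e f = a ^ 2 * q ^ 2 / (d * e * f) / c" by (simp add: warg_def mult_ac)
  then have small: "norm (warg a 1 c d e f) < 1"
    using norm_divide_less_iff_far[OF far] norm_q_less_1 by simp
  have "vwp_coeff a 1 c d e f k = 0" if "k \<noteq> 0" for k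
  proof -
    have "qpoch q 1 k = 0" using that by (cases k) (simp_all add: qpoch_Suc')
    then show ?thesis by (simp add: vwp_coeff_def wp_def)
  qed
  then have "(\<Sum>k. vwp_coeff a 1 c d e f k * warg a 1 c d e f ^ k) = vwp_coeff a 1 c d e f 0"
    by (subst suminf_finite[of "{0}"]) auto
  also have "\<dots> = qpoch_inf q a * qpoch_inf q q *
    (qpoch_inf q (a * q / c) * qpoch_inf q (a * q / d) * qpoch_inf q (a * q / e) * qpoch_inf q (a * q / f))"
    using nz qpoch_inf_rec[of a] by (simp add: vwp_coeff_def wp_def mult_ac)
  finally show "?L c = ?R c"
    by (simp only: Phi_series[OF small])
qed (use nz in auto)

text \<open>The factor 1 - b of \<open>tau\<close> removes \<open>Phi_plus\<close>. The rest is
  \<open>Phi\<close> times a combination of the second series that \<open>tau_Phi_plus_q\<close>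
  sums, so a pure product must match the one theta product that survives.\<close>

lemma Defect_b_1:
  assumes nz: "a \<noteq> 0" "c \<noteq> 0" "d \<noteq> 0" "e \<noteq> 0" "f \<noteq> 0"
  shows "Defect a 1 c d e f = 0"
proof -
  define A where "A = c * d * e / a ^ 2"
  define z where "z = warg a 1 c d e f"
  define m where "m = mu a 1 c d e f"
  define z2 where "z2 = warg A (c * e / a) (c * d / a) (d * e / a) (q / f) q"
  define X where "X = (q - z2) * (1 + A) + z2 * (c * e / a + c * d / a + d * e / a + q / f) -
    A * q * (1 / (c * e / a) + 1 / (c * d / a) + 1 / (d * e / a) + 1 / (q / f))"
  have nz2: "A \<noteq> 0" "c * e / a \<noteq> 0" "c * d / a \<noteq> 0" "d * e / a \<noteq> 0" "q / f \<noteq> 0"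
    using nz by (simp_all add: A_def)
  have z2: "z2 = f / a"
    using nz by (simp add: z2_def warg_def A_def power2_eq_square)
  have z: "z = a ^ 2 * q ^ 2 / (c * d * e * f)" by (simp add: z_def warg_def)
  have m: "m = q / a * ((a / c) * (a / d) * (a / e) * (a / f))"
    unfolding m_def mu_def z_def[symmetric] z by (simp add: power2_eq_square mult_ac)
  \<comment> \<open>The last quotient q/z completes (z)_inf from \<open>Phi_1\<close> to theta
    z.\<close>
  have quot: "A / (c * e / a) = d / a" "A / (c * d / a) = e / a" "A / (d * e / a) = c / a" "A / (q / f) = q / z"
    using nz by (simp_all add: A_def z power2_eq_square mult_ac)
  have rel: "dual tau a 1 c d e f * dual Phi_plus a 1 c d e f + X * dual Phi a 1 c d e f =
    q * (qpoch_inf q A * qpoch_inf q q) * qpoch_inf q (f / a) *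
      (qpoch_inf q (d / a) * qpoch_inf q (e / a) * qpoch_inf q (c / a) * qpoch_inf q (q / z))"
    using tau_Phi_plus_q[OF nz2] unfolding quot
    unfolding dual_def A_def[symmetric] z2_def[symmetric] X_def div_by_1 z2 .
  \<comment> \<open>So the coefficient of \<open>Phi\<close> times the second series in
    \<open>Bil\<close> is m * X, as \<open>rel\<close> demands.\<close>
  have coeff: "sigma a 1 c d e f = m * (dual sigma a 1 c d e f + X)"
    unfolding sigma_def dual_def A_def[symmetric] z2_def[symmetric] z_def[symmetric] div_by_1
    unfolding X_def z2 A_def m z using nz by (simp add: divide_simps) algebra
  have "Bil a 1 c d e f = m * (dual tau a 1 c d e f * dual Phi_plus a 1 c d e f +
      X * dual Phi a 1 c d e f) * Phi a 1 c d e f"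
    unfolding Bil_def coeff m_def[symmetric] by (simp add: tau_def algebra_simps)
  then have Bil: "Bil a 1 c d e f = m * (q * (qpoch_inf q A * qpoch_inf q q) * qpoch_inf q (f / a) *
      (qpoch_inf q (d / a) * qpoch_inf q (e / a) * qpoch_inf q (c / a) * qpoch_inf q (q / z))) *
      (qpoch_inf q z * (qpoch_inf q a * qpoch_inf q q *
    (qpoch_inf q (a * q / c) * qpoch_inf q (a * q / d) * qpoch_inf q (a * q / e) * qpoch_inf q (a * q / f))))"
    unfolding rel Phi_1[OF nz] z_def .
  have side: "ThetaSide a 1 c d e f = q / a * (qpoch_inf q z * qpoch_inf q (q / z)) *
      (qpoch_inf q a * qpoch_inf q (q / a) * theta (a / c) * theta (a / d) * theta (a / e) * theta (a / f))"
    by (simp add: ThetaSide_def z_def[symmetric]) (simp add: theta_def)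
  show ?thesis
    unfolding Defect_def Bil side A_def[symmetric] m
      theta_divide[OF nz(1,2)] theta_divide[OF nz(1,3)] theta_divide[OF nz(1,4)] theta_divide[OF nz(1,5)]
    by (simp add: mult_ac power2_eq_square)
qed

lemma Defect_f_1:
  assumes "a \<noteq> 0" "b \<noteq> 0" "c \<noteq> 0" "d \<noteq> 0" "e \<noteq> 0"
  shows "Defect a b c d e 1 = 0"
  using Defect_b_1[of a c d e b] Defect_swap(1)[of a 1 c d e b] assms by simp

text \<open>Partners stay partners when a becomes aq^2 and the parameters are multiplied by q, so
  \<open>Phi\<close> and \<open>Phi_plus\<close> both vanish. On the theta side each pair
  contributes the factor a/q, and the two products coincide.\<close>

lemma Defect_two_pairs:
  assumes nz: "a \<noteq> 0" "b \<noteq> 0" "c \<noteq> 0" "f \<noteq> 0"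
  shows "Defect a b c (a * q / c) (a * q / b) f = 0"
proof -
  have Phi: "Phi a b c (a * q / c) (a * q / b) f = 0" by (rule Phi_two_pairs[OF nz])
  have "Phi (a * q ^ 2) (b * q) (c * q) (a * q ^ 2 * q / (c * q)) (a * q ^ 2 * q / (b * q)) (f * q) = 0"
    by (rule Phi_two_pairs) (use nz in auto)
  moreover have "a * q ^ 2 * q / (c * q) = a * q / c * q" "a * q ^ 2 * q / (b * q) = a * q / b * q"
    using nz by (simp_all add: power2_eq_square)
  ultimately have Phi_plus: "Phi_plus a b c (a * q / c) (a * q / b) f = 0"
    by (simp only: Phi_plus_def)
  have "Bil a b c (a * q / c) (a * q / b) f = 0" by (simp add: Bil_def Phi Phi_plus)
  moreover have "ThetaSide a b c (a * q / c) (a * q / b) f = 0"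
  proof -
    have pair: "theta (a / p) * theta (a / (a * q / p)) = a / q * (theta p * theta (a * q / p))"
      if "p \<noteq> 0" for p
    proof -
      have 1: "theta (a / (a * q / p)) = - (p / q) * theta p"
        using theta_shift_down[of p] nz that by simp
      have 2: "theta (a * q / p) = - theta (a / p) / (a / p)"
        using theta_shift[of "a / p"] nz that by simp
      show ?thesis unfolding 1 2 using nz that by simp
    qed
    have w: "warg a b c (a * q / c) (a * q / b) f = 1 / f"
      using nz by (simp add: warg_def power2_eq_square)
    have "theta (1 / f) = - theta f / f"
      using theta_inversion[of "f * q"] theta_shift[of f] nz by simp
    moreover have "theta (mu a b c (a * q / c) (a * q / b) f) = - (a / f / q) * theta (a / f)"
      using theta_shift_down[of "a / f"] nz by (simp add: mu_def w mult_ac)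
    ultimately have "ThetaSide a b c (a * q / c) (a * q / b) f =
      q / a * (- theta f / f) * theta (a / f) * ((theta (a / b) * theta (a / (a * q / b))) *
        (theta (a / c) * theta (a / (a * q / c)))) -
      (- (a / f / q) * theta (a / f)) * theta f * ((theta b * theta (a * q / b)) *
        (theta c * theta (a * q / c)))"
      unfolding ThetaSide_def w by (simp only: mult_ac)
    also have "\<dots> = 0" unfolding pair[OF nz(2)] pair[OF nz(3)] using nz by simp
    finally show ?thesis .
  qed
  ultimately show ?thesis by (simp add: Defect_def)
qed

text \<open>Now 1 - c = 0 removes \<open>Phi_plus\<close>, while theta (a/b) and theta c remove the
  theta side. In the second series de/a and q/a are partners, so the remaining combination is 0 by
  \<open>tau_Phi_plus_pair\<close>.\<close>

lemma Defect_a_1: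
  assumes nz: "a \<noteq> 0" "d \<noteq> 0" "e \<noteq> 0" "f \<noteq> 0"
  shows "Defect a a 1 d e f = 0"
proof -
  define A where "A = 1 * d * e / a ^ 2"
  define z where "z = warg a a 1 d e f"
  define m where "m = mu a a 1 d e f"
  define z2 where "z2 = warg A (1 * e / a) (1 * d / a) (d * e / a) (q / f) (q / a)"
  define X where "X = (q - z2) * (1 + A) + z2 * (A + 1 * e / a + 1 * d / a + q / f) -
    A * q * (1 / A + 1 / (1 * e / a) + 1 / (1 * d / a) + 1 / (q / f))"
  have nz2: "A \<noteq> 0" "1 * e / a \<noteq> 0" "1 * d / a \<noteq> 0" "q / f \<noteq> 0" "d * e / a \<noteq> 0"
    using nz by (simp_all add: A_def)
  have last: "A * q / (d * e / a) = q / a" using nz by (simp add: A_def power2_eq_square)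
  have perm: "mset [1 * e / a, 1 * d / a, q / f, d * e / a, q / a] =
      mset [1 * e / a, 1 * d / a, d * e / a, q / f, q / a]"
    by simp
  have z2: "z2 = f" using nz by (simp add: z2_def warg_def A_def power2_eq_square)
  have z: "z = a * q ^ 2 / (d * e * f)" using nz by (simp add: z_def warg_def power2_eq_square)
  have m: "m = a ^ 2 * q / (d * e * f)"
    unfolding m_def mu_def z_def[symmetric] z by (simp add: power2_eq_square mult_ac)
  have rel: "dual tau a a 1 d e f * dual Phi_plus a a 1 d e f + X * dual Phi a a 1 d e f = 0"
    using tau_Phi_plus_pair[OF nz2] unfolding last vwp_permute[OF perm]
    unfolding dual_def A_def[symmetric] z2_def[symmetric] X_def[symmetric] .
  have coeff: "sigma a a 1 d e f = m * (dual sigma a a 1 d e f + X)"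
    unfolding sigma_def dual_def A_def[symmetric] z2_def[symmetric] z_def[symmetric]
    unfolding X_def z2 A_def m z using nz by (simp add: divide_simps) algebra
  have "Bil a a 1 d e f = m * (dual tau a a 1 d e f * dual Phi_plus a a 1 d e f +
      X * dual Phi a a 1 d e f) * Phi a a 1 d e f"
    unfolding Bil_def coeff m_def[symmetric] by (simp add: tau_def algebra_simps)
  then have "Bil a a 1 d e f = 0" unfolding rel by simp
  moreover have "ThetaSide a a 1 d e f = 0" using nz by (simp add: ThetaSide_def)
  ultimately show ?thesis by (simp add: Defect_def)
qed

lemma Defect_pair:
  assumes nz: "a \<noteq> 0" "b \<noteq> 0" "c \<noteq> 0" "e \<noteq> 0" "f \<noteq> 0"
  shows "Defect a b c (a * q / c) e f = 0"
proof -
  \<comment> \<open>The product of \<beta> and the last parameter is bf t^2, and e is divided by t.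
    This puts the zeros at 1, bf t^2 and (aq/e) t, as \<open>degree_2_vanishing\<close>
    requires.\<close>
  define \<psi> where "\<psi> = (\<lambda>t \<beta>. Defect a \<beta> c (a * q / c) (e / t) (b * f * t ^ 2 / \<beta>))"
  have "\<psi> 1 b = 0"
    unfolding \<psi>_def
  proof (rule degree_2_vanishing[where \<psi> = "\<lambda>t \<beta>. Defect a \<beta> c (a * q / c) (e / t) (b * f * t ^ 2 / \<beta>)" and \<kappa> = "\<lambda>t. b * f * t ^ 2 / q" and y = "b * f" and w = "a * q / e"])
    fix t :: complex assume t: "t \<noteq> 0"
    show "(\<lambda>\<beta>. Defect a \<beta> c (a * q / c) (e / t) (b * f * t ^ 2 / \<beta>)) holomorphic_on - {0}"
      by (intro holomorphic_Defect holomorphic_intros) (use nz t in auto)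
    show "Defect a 1 c (a * q / c) (e / t) (b * f * t ^ 2 / 1) = 0"
      by (rule Defect_b_1) (use nz t in auto)
    show "Defect a (b * f * t ^ 2) c (a * q / c) (e / t) (b * f * t ^ 2 / (b * f * t ^ 2)) = 0"
      using Defect_f_1[of a "b * f * t ^ 2" c "a * q / c" "e / t"] nz t by simp
    \<comment> \<open>At this point \<beta> and e/t are partners, next to the pair c and
      aq/c.\<close>
    have "e / t = a * q / (a * q / e * t)" using nz t by simp
    then show "Defect a (a * q / e * t) c (a * q / c) (e / t) (b * f * t ^ 2 / (a * q / e * t)) = 0"
      using Defect_two_pairs[of a "a * q / e * t" c "b * f * t ^ 2 / (a * q / e * t)"] nz t
      by simp
    fix \<beta> :: complex assume \<beta>: "\<beta> \<noteq> 0"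
    show "Defect a (\<beta> * q) c (a * q / c) (e / t) (b * f * t ^ 2 / (\<beta> * q)) =
        b * f * t ^ 2 / q / \<beta> ^ 2 * Defect a \<beta> c (a * q / c) (e / t) (b * f * t ^ 2 / \<beta>)"
      using Defect_shift_bf[of a \<beta> c "a * q / c" "e / t" "b * f * t ^ 2 / \<beta>"] nz t \<beta>
      by (simp add: power2_eq_square mult_ac)
  next
    fix \<beta> :: complex assume \<beta>: "\<beta> \<noteq> 0"
    show "continuous_on (- {0}) (\<lambda>t. Defect a \<beta> c (a * q / c) (e / t) (b * f * t ^ 2 / \<beta>))"
      by (intro holomorphic_on_imp_continuous_on holomorphic_Defect holomorphic_intros)
        (use nz \<beta> in auto)
  qed (use nz in auto)
  then show ?thesis using nz by (simp add: \<psi>_def)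
qed

lemma Defect_a:
  assumes nz: "a \<noteq> 0" "c \<noteq> 0" "d \<noteq> 0" "e \<noteq> 0" "f \<noteq> 0"
  shows "Defect a a c d e f = 0"
proof -
  \<comment> \<open>The same scaling for the pair c, d; the third zero is where \<gamma> and e/t
    become partners and \<open>Defect_pair\<close> applies.\<close>
  define \<psi> where "\<psi> = (\<lambda>t \<gamma>. Defect a a \<gamma> (c * d * t ^ 2 / \<gamma>) (e / t) f)"
  have "\<psi> 1 c = 0"
    unfolding \<psi>_def
  proof (rule degree_2_vanishing[where \<psi> = "\<lambda>t \<gamma>. Defect a a \<gamma> (c * d * t ^ 2 / \<gamma>) (e / t) f" and \<kappa> = "\<lambda>t. c * d * t ^ 2 / q" and y = "c * d" and w = "a * q / e"])
    fix t :: complex assume t: "t \<noteq> 0"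
    show "(\<lambda>\<gamma>. Defect a a \<gamma> (c * d * t ^ 2 / \<gamma>) (e / t) f) holomorphic_on - {0}"
      by (intro holomorphic_Defect holomorphic_intros) (use nz t in auto)
    show "Defect a a 1 (c * d * t ^ 2 / 1) (e / t) f = 0"
      by (rule Defect_a_1) (use nz t in auto)
    show "Defect a a (c * d * t ^ 2) (c * d * t ^ 2 / (c * d * t ^ 2)) (e / t) f = 0"
      using Defect_a_1[of a "c * d * t ^ 2" "e / t" f] Defect_swap(2)[of a a 1 "c * d * t ^ 2" "e / t" f]
        nz t by simp
    have "e / t = a * q / (a * q / e * t)" using nz t by simp
    then show "Defect a a (a * q / e * t) (c * d * t ^ 2 / (a * q / e * t)) (e / t) f = 0"
      using Defect_pair[of a a "a * q / e * t" "c * d * t ^ 2 / (a * q / e * t)" f]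
        Defect_swap(3)[of a a "a * q / e * t" "c * d * t ^ 2 / (a * q / e * t)" "e / t" f] nz t
      by simp
    fix \<gamma> :: complex assume \<gamma>: "\<gamma> \<noteq> 0"
    show "Defect a a (\<gamma> * q) (c * d * t ^ 2 / (\<gamma> * q)) (e / t) f =
        c * d * t ^ 2 / q / \<gamma> ^ 2 * Defect a a \<gamma> (c * d * t ^ 2 / \<gamma>) (e / t) f"
      using Defect_shift_cd[of a a \<gamma> "c * d * t ^ 2 / \<gamma>" "e / t" f] nz t \<gamma>
      by (simp add: power2_eq_square mult_ac)
  next
    fix \<gamma> :: complex assume \<gamma>: "\<gamma> \<noteq> 0"
    show "continuous_on (- {0}) (\<lambda>t. Defect a a \<gamma> (c * d * t ^ 2 / \<gamma>) (e / t) f)"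
      by (intro holomorphic_on_imp_continuous_on holomorphic_Defect holomorphic_intros)
        (use nz \<gamma> in auto)
  qed (use nz in auto)
  then show ?thesis using nz by (simp add: \<psi>_def)
qed

lemma Defect_eq_0:
  assumes nz: "a \<noteq> 0" "b \<noteq> 0" "c \<noteq> 0" "d \<noteq> 0" "e \<noteq> 0" "f \<noteq> 0"
  shows "Defect a b c d e f = 0"
proof -
  \<comment> \<open>Here a itself is scaled, because the third zero is \<beta> = at.\<close>
  define \<psi> where "\<psi> = (\<lambda>t \<beta>. Defect (a * t) \<beta> c d e (b * f * t ^ 2 / \<beta>))"
  have "\<psi> 1 b = 0"
    unfolding \<psi>_def
  proof (rule degree_2_vanishing[where \<psi> = "\<lambda>t \<beta>. Defect (a * t) \<beta> c d e (b * f * t ^ 2 / \<beta>)" and \<kappa> = "\<lambda>t. b * f * t ^ 2 / q" and y = "b * f" and w = a])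
    fix t :: complex assume t: "t \<noteq> 0"
    show "(\<lambda>\<beta>. Defect (a * t) \<beta> c d e (b * f * t ^ 2 / \<beta>)) holomorphic_on - {0}"
      by (intro holomorphic_Defect holomorphic_intros) (use nz t in auto)
    show "Defect (a * t) 1 c d e (b * f * t ^ 2 / 1) = 0"
      by (rule Defect_b_1) (use nz t in auto)
    show "Defect (a * t) (b * f * t ^ 2) c d e (b * f * t ^ 2 / (b * f * t ^ 2)) = 0"
      using Defect_f_1[of "a * t" "b * f * t ^ 2" c d e] nz t by simp
    show "Defect (a * t) (a * t) c d e (b * f * t ^ 2 / (a * t)) = 0"
      by (rule Defect_a) (use nz t in auto)
    fix \<beta> :: complex assume \<beta>: "\<beta> \<noteq> 0"
    show "Defect (a * t) (\<beta> * q) c d e (b * f * t ^ 2 / (\<beta> * q)) =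
        b * f * t ^ 2 / q / \<beta> ^ 2 * Defect (a * t) \<beta> c d e (b * f * t ^ 2 / \<beta>)"
      using Defect_shift_bf[of "a * t" \<beta> c d e "b * f * t ^ 2 / \<beta>"] nz t \<beta>
      by (simp add: power2_eq_square mult_ac)
  next
    fix \<beta> :: complex assume \<beta>: "\<beta> \<noteq> 0"
    show "continuous_on (- {0}) (\<lambda>t. Defect (a * t) \<beta> c d e (b * f * t ^ 2 / \<beta>))"
      by (intro holomorphic_on_imp_continuous_on holomorphic_Defect holomorphic_intros)
        (use nz \<beta> in auto)
  qed (use nz in auto)
  then show ?thesis using nz by (simp add: \<psi>_def)
qed

section \<open>The theorem\<close>


text \<open>The quotient of the normalisations at the shifted and the original parameters consists
  of finitely many factors, which turn T_1 into \<open>tau\<close>.\<close>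

lemma T_W87_plus:
  assumes reg: "W87_regular q a [b, c, d, e, f]"
    and reg_plus: "W87_regular q (a * q ^ 2) [b * q, c * q, d * q, e * q, f * q]"
  defines "z \<equiv> warg a b c d e f"
  shows "z * (1 - z / q) * (1 - a * q) * (1 - a * q ^ 2) *
      ((1 - b) * (1 - c) * (1 - d) * (1 - e) * (1 - f)) /
      ((1 - q) * ((1 - a * q / b) * (1 - a * q / c) * (1 - a * q / d) * (1 - a * q / e) * (1 - a * q / f))) *
      W87 q (a * q ^ 2) [b * q, c * q, d * q, e * q, f * q] =
    tau a b c d e f * Phi_plus a b c d e f / ((1 - q) * W87_norm a [b, c, d, e, f])"
proof -
  have nz: "a \<noteq> 0" "b \<noteq> 0" "c \<noteq> 0" "d \<noteq> 0" "e \<noteq> 0" "f \<noteq> 0"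
    and N: "W87_norm a [b, c, d, e, f] \<noteq> 0"
    using reg by (auto simp: W87_regular_iff)
  have N_plus: "W87_norm (a * q ^ 2) [b * q, c * q, d * q, e * q, f * q] \<noteq> 0"
    using reg_plus unfolding W87_regular_iff by blast
  define V where "V = (1 - a * q / b) * (1 - a * q / c) * (1 - a * q / d) * (1 - a * q / e) * (1 - a * q / f)"
  define Y where "Y = (1 - b) * (1 - c) * (1 - d) * (1 - e) * (1 - f)"
  have shift: "a * q ^ 2 * q / (p * q) = a * q / p * q" for p by (simp add: power2_eq_square)
  have "qpoch_inf q (z / q) = (1 - z / q) * qpoch_inf q z"
    using qpoch_inf_rec[of "z / q"] by simp
  then have key: "W87_norm (a * q ^ 2) [b * q, c * q, d * q, e * q, f * q] * ((1 - a) * V) =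
      W87_norm a [b, c, d, e, f] * ((1 - a * q ^ 2) * (1 - z / q))"
    unfolding W87_norm_def W87_arg_eq warg_plus[OF nz] z_def[symmetric] V_def
    by (simp add: shift qpoch_inf_rec[of "a * q / b"] qpoch_inf_rec[of "a * q / c"]
        qpoch_inf_rec[of "a * q / d"] qpoch_inf_rec[of "a * q / e"] qpoch_inf_rec[of "a * q / f"] mult_ac power2_eq_square)
  have "1 - a * q / p \<noteq> 0" if "p \<in> {b, c, d, e, f}" for p
    using N that qpoch_inf_rec[of "a * q / p"] by (auto simp: W87_norm_def)
  then have V: "V \<noteq> 0" by (simp add: V_def)
  have 1: "1 - a \<noteq> 0" using N by (auto simp: W87_norm_def)
  define N1 where "N1 = W87_norm a [b, c, d, e, f]"
  define N2 where "N2 = W87_norm (a * q ^ 2) [b * q, c * q, d * q, e * q, f * q]"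
  have Nz: "N1 \<noteq> 0" "N2 \<noteq> 0" using N N_plus by (simp_all add: N1_def N2_def)
  have key': "(1 - a * q ^ 2) * (1 - z / q) = N2 * (1 - a) * V / N1"
    using key Nz unfolding N1_def[symmetric] N2_def[symmetric] by (simp add: field_simps)
  have "z * (1 - z / q) * (1 - a * q) * (1 - a * q ^ 2) * Y / ((1 - q) * V) *
      (Phi_plus a b c d e f / N2) =
    z * (1 - a * q) * Y * ((1 - a * q ^ 2) * (1 - z / q)) / ((1 - q) * V) * (Phi_plus a b c d e f / N2)"
    by (simp only: mult_ac)
  also have "\<dots> = z * (1 - a) * (1 - a * q) * Y * Phi_plus a b c d e f / ((1 - q) * N1)"
    unfolding key' using Nz V by (simp add: mult_ac)
  finally show ?thesis
    unfolding W87_eq_Phi[OF reg_plus] Phi_plus_def[symmetric] tau_def z_def[symmetric]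
      V_def[symmetric] Y_def[symmetric] N1_def[symmetric] N2_def[symmetric] .
qed

text \<open>The letters stand for the products in the last step: Z = theta z, g = (q^2/a)_inf, i =
  (aq)_inf, Q = (q)_inf, V = product of the 1 - a/p, and V U and M for the two theta products. The
  sign of the right side comes from (q/a)/(1 - q/a) = -1/(1 - a/q).\<close>

lemma final_algebra:
  fixes a A Aq Z V U M g i Bl Q x :: complex
  assumes "a \<noteq> 0" "1 - A \<noteq> 0" "Aq \<noteq> 0" "Z \<noteq> 0" "V \<noteq> 0" "U \<noteq> 0" "g \<noteq> 0" "i \<noteq> 0" "Q \<noteq> 0"
    "1 - a \<noteq> 0" "1 - q / a \<noteq> 0" "1 - a / q \<noteq> 0"
    and Bl: "(1 - q / a) * g * Bl = q * Q ^ 2 * ((1 - A) * Aq) * (q / a * Z * (V * U) - M)"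
  shows "g * Bl / (((1 - A) * Aq) * Q ^ 2 * (1 - a) * Z * U) =
    - q * V * (i / ((1 - a / q) * ((1 - a) * i))) *
      (1 + (1 - a / q) * ((1 - a) * i) * g * M / ((1 - a) * i * ((1 - q / a) * g) * (V * U) * Z))"
proof -
  have "g * Bl = q * Q ^ 2 * ((1 - A) * Aq) * (q / a * Z * (V * U) - M) / (1 - q / a)"
    using Bl assms by (simp add: eq_divide_eq mult_ac)
  then have "g * Bl / (((1 - A) * Aq) * Q ^ 2 * (1 - a) * Z * U) =
      q * (q / a * Z * (V * U) - M) / ((1 - q / a) * (1 - a) * Z * U)"
    using assms by simp
  also have "\<dots> = q * (q / a) * V / ((1 - q / a) * (1 - a)) - q * M / ((1 - q / a) * (1 - a) * Z * U)"
  proof -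
    have "q * (x - M) / y = q * x / y - q * M / y" for x y :: complex
      by (simp only: right_diff_distrib diff_divide_distrib)
    then show ?thesis using assms by simp
  qed
  also have "q * (q / a) * V / ((1 - q / a) * (1 - a)) = - (q * V / ((1 - a / q) * (1 - a)))"
  proof -
    have "(q / a) / (1 - q / a) = - 1 / (1 - a / q)"
      using assms(1,11,12) by (simp add: divide_simps) (simp add: algebra_simps)
    then have "q * V / (1 - a) * ((q / a) / (1 - q / a)) = q * V / (1 - a) * (- 1 / (1 - a / q))"
      by (simp only:)
    then show ?thesis by (simp add: mult_ac)
  qed
  finally show ?thesis using assms by (simp add: distrib_left)
qed

end

theorem mainTheorem7:
  fixes q a b c d e f s W1 W1p S1 T1 W2 W2p S2 T2 L2 :: complex
  assumes q: "0 < norm q" "norm q < 1"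
    and nz: "a \<noteq> 0" "b \<noteq> 0" "c \<noteq> 0" "d \<noteq> 0" "e \<noteq> 0" "f \<noteq> 0"
    and s: "s = a^3 * q^3 / (b * c * d * e * f)"
    and W1: "W1 = W87 q a [b, c, d, e, f]"
    and W1p: "W1p = W87 q (a * q^2) [b * q, c * q, d * q, e * q, f * q]"
    and S1: "S1 = 1 / (1 - q) *
      (s / q + s / (a * q) + a * q / b + a * q / c + a * q / d + a * q / e + a * q / f - a * q)"
    and T1: "T1 =
      (s / (a * q) * (1 - s / (a * q^2)) * (1 - a * q) * (1 - a * q^2)
        * (1 - b) * (1 - c) * (1 - d) * (1 - e) * (1 - f))
      / ((1 - q) * (1 - a * q / b) * (1 - a * q / c) * (1 - a * q / d)
        * (1 - a * q / e) * (1 - a * q / f))"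
    and W2: "W2 = W87 q (c * d * e / a^2) [c * e / a, c * d / a, d * e / a, q / f, q / b]"
    and W2p: "W2p = W87 q (c * d * e * q^2 / a^2)
      [c * e * q / a, c * d * q / a, d * e * q / a, q^2 / f, q^2 / b]"
    and S2: "S2 = 1 / (1 - q) *
      (q + c * s / (a * q) + d * s / (a * q) + e * s / (a * q) + a^2 * q / (c * d * e)
        + a * q / f + a * q / b - a * q^2 / (b * f))"
    and T2: "T2 =
      (b * f * s / (a * q^2) * (1 - b * f / (a * q)) * (1 - c * d * e * q / a^2)
        * (1 - c * d * e * q^2 / a^2) * (1 - c * d / a) * (1 - c * e / a) * (1 - d * e / a)
        * (1 - q / f) * (1 - q / b))
      / ((1 - q) * (1 - c * q / a) * (1 - d * q / a) * (1 - e * q / a)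
        * (1 - c * d * e * f / a^2) * (1 - b * c * d * e / a^2))"
    and L2: "L2 =
      qpochs_inf q [q^2 / a, c * d * e * f / a^2, b * c * d * e / a^2, b * f / a]
      / qpochs_inf q [c * d * e * q / a^2, f * q / a, b * q / a, a * q^2 / s]"
    \<comment> \<open>no zero denominators or singularities; the denominators of T1 and T2 are among
      those of the series\<close>
    and regular:
      "W87_regular q a [b, c, d, e, f]"
      "W87_regular q (a * q^2) [b * q, c * q, d * q, e * q, f * q]"
      "W87_regular q (c * d * e / a^2) [c * e / a, c * d / a, d * e / a, q / f, q / b]"
      "W87_regular q (c * d * e * q^2 / a^2)
        [c * e * q / a, c * d * q / a, d * e * q / a, q^2 / f, q^2 / b]"
    and denominators:
      "qpochs_inf q [c * d * e * q / a^2, f * q / a, b * q / a, a * q^2 / s] \<noteq> 0"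
      "qpoch_inf q (a / q) \<noteq> 0"
      "qpochs_inf q [a, q / a, a / b, b * q / a, a / c, c * q / a, a / d, d * q / a,
        a / e, e * q / a, a / f, f * q / a, s / (a * q), a * q^2 / s] \<noteq> 0"
  shows "L2 * (1 - q) * ((S1 - S2) * W1 * W2 - T1 * W1p * W2 + T2 * W1 * W2p)
    = - q * (1 - a / b) * (1 - a / c) * (1 - a / d) * (1 - a / e) * (1 - a / f)
      * (qpoch_inf q (a * q) / qpoch_inf q (a / q))
      * (1 +
          qpochs_inf q [a / q, q^2 / a, b, q / b, c, q / c, d, q / d, e, q / e, f, q / f,
            s / q^2, q^3 / s]
          / qpochs_inf q [a, q / a, a / b, b * q / a, a / c, c * q / a, a / d, d * q / a,
            a / e, e * q / a, a / f, f * q / a, s / (a * q), a * q^2 / s])"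
proof -
  interpret nome q using q by unfold_locales auto
  define A where "A = c * d * e / a^2"
  define z where "z = warg a b c d e f"
  note reg = regular
  have q_1: "1 - q \<noteq> 0" using q by auto
  have s_z: "s = z * a * q"
    unfolding s z_def warg_def using nz by (simp add: power2_eq_square power3_eq_cube)
  have z_nz: "z \<noteq> 0" using nz by (simp add: z_def warg_def)
  have mu: "mu a b c d e f = s / q^2" "mu a b c d e f = z * a / q"
    unfolding mu_def z_def[symmetric] s_z by (simp_all add: power2_eq_square)
  have plus_args: "c * d * e * q^2 / a^2 = A * q^2" "c * e * q / a = c * e / a * q"
    "c * d * q / a = c * d / a * q" "d * e * q / a = d * e / a * q" "q^2 / f = q / f * q" "q^2 / b = q / b * q"
    by (simp_all add: A_def power2_eq_square)
  have z2: "warg A (c * e / a) (c * d / a) (d * e / a) (q / f) (q / b) = b * f / a"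
    using nz by (simp add: warg_def A_def power2_eq_square)
  \<comment> \<open>The denominator parameters of the second series, which are those occurring in
    T_2' and L_2'.\<close>
  have bottoms: "A * q / (c * e / a) = d * q / a" "A * q / (c * d / a) = e * q / a"
    "A * q / (d * e / a) = c * q / a" "A * q / (q / f) = c * d * e * f / a^2"
    "A * q / (q / b) = b * c * d * e / a^2"
    using nz by (simp_all add: A_def power2_eq_square mult_ac)
  define N1 where "N1 = W87_norm a [b, c, d, e, f]"
  define N2 where "N2 = W87_norm A [c * e / a, c * d / a, d * e / a, q / f, q / b]"
  have N_nz: "N1 \<noteq> 0" "N2 \<noteq> 0"
    using reg(1,3) unfolding W87_regular_iff N1_def N2_def A_def by blast+
  have W1': "W1 = Phi a b c d e f / N1"
    unfolding W1 N1_def by (rule W87_eq_Phi[OF reg(1)])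
  have W2': "W2 = dual Phi a b c d e f / N2"
    unfolding W2 N2_def dual_def A_def by (rule W87_eq_Phi[OF reg(3)])
  have S1': "S1 = sigma a b c d e f / (1 - q)"
    unfolding S1 sigma_def z_def[symmetric] s_z using nz by (simp add: distrib_left add_divide_distrib diff_divide_distrib)
  have S2': "S2 = mu a b c d e f * dual sigma a b c d e f / (1 - q)"
  proof -
    have "q + c * s / (a * q) + d * s / (a * q) + e * s / (a * q) + a^2 * q / (c * d * e)
        + a * q / f + a * q / b - a * q^2 / (b * f) = mu a b c d e f * dual sigma a b c d e f"
      unfolding dual_def sigma_def A_def[symmetric] z2 mu(1) s
      unfolding A_def using nz by (simp add: divide_simps) algebra
    then show ?thesis unfolding S2 by simp
  qed
  have T1': "T1 * W1p = tau a b c d e f * Phi_plus a b c d e f / ((1 - q) * N1)"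
    using T_W87_plus[OF reg(1,2)] unfolding T1 W1p s_z z_def[symmetric] N1_def[symmetric]
    using nz by (simp add: mult_ac power2_eq_square)
  have T2': "T2 * W2p = mu a b c d e f * (dual tau a b c d e f * dual Phi_plus a b c d e f) / ((1 - q) * N2)"
  proof -
    have t1: "T2 = mu a b c d e f * (b * f / a * (1 - b * f / a / q) * (1 - A * q) * (1 - A * q^2) *
        ((1 - c * e / a) * (1 - c * d / a) * (1 - d * e / a) * (1 - q / f) * (1 - q / b)) /
        ((1 - q) * ((1 - d * q / a) * (1 - e * q / a) * (1 - c * q / a) * (1 - c * d * e * f / a^2) *
          (1 - b * c * d * e / a^2))))"
      unfolding T2 mu(1) A_def by (simp add: mult_ac power2_eq_square)
    have t2: "b * f / a * (1 - b * f / a / q) * (1 - A * q) * (1 - A * q^2) *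
        ((1 - c * e / a) * (1 - c * d / a) * (1 - d * e / a) * (1 - q / f) * (1 - q / b)) /
        ((1 - q) * ((1 - d * q / a) * (1 - e * q / a) * (1 - c * q / a) * (1 - c * d * e * f / a^2) *
          (1 - b * c * d * e / a^2))) * W2p =
      dual tau a b c d e f * dual Phi_plus a b c d e f / ((1 - q) * N2)"
      using T_W87_plus[OF reg(3,4)[unfolded plus_args A_def[symmetric]]]
      unfolding W2p plus_args dual_def A_def[symmetric] bottoms z2 N2_def[symmetric] .
    show ?thesis unfolding t1 mult.assoc[of "mu a b c d e f"] t2 by simp
  qed
  have bilinear: "(1 - q) * ((S1 - S2) * W1 * W2 - T1 * W1p * W2 + T2 * W1 * W2p) =
      Bil a b c d e f / (N1 * N2)"
  proof -
    have "(1 - q) * ((S1 - S2) * W1 * W2 - T1 * W1p * W2 + T2 * W1 * W2p) =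
      (1 - q) * ((S1 - S2) * W1 * W2 - (T1 * W1p) * W2 + (T2 * W2p) * W1)"
      by (simp only: mult_ac)
    also have "\<dots> = Bil a b c d e f / (N1 * N2)"
      unfolding S1' S2' W1' W2' T1' T2' Bil_def using N_nz q_1
      by (simp add: divide_simps)
    finally show ?thesis .
  qed
  define U where "U = (qpoch_inf q (a * q / b) * qpoch_inf q (b * q / a)) *
    (qpoch_inf q (a * q / c) * qpoch_inf q (c * q / a)) * (qpoch_inf q (a * q / d) * qpoch_inf q (d * q / a)) *
    (qpoch_inf q (a * q / e) * qpoch_inf q (e * q / a)) * (qpoch_inf q (a * q / f) * qpoch_inf q (f * q / a))"
  define V where "V = (1 - a / b) * (1 - a / c) * (1 - a / d) * (1 - a / e) * (1 - a / f)"
  define M where "M = theta (s / q^2) * (theta b * theta c * theta d * theta e * theta f)"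
  have Z: "theta z = qpoch_inf q (s / (a * q)) * qpoch_inf q (a * q^2 / s)"
    unfolding theta_def s_z using nz z_nz by (simp add: power2_eq_square)
  have th: "qpoch_inf q (a / p) * qpoch_inf q (p * q / a) =
      (1 - a / p) * (qpoch_inf q (a * q / p) * qpoch_inf q (p * q / a))" "theta (a / p) =
      (1 - a / p) * (qpoch_inf q (a * q / p) * qpoch_inf q (p * q / a))" if "p \<noteq> 0" for p
    using qpoch_inf_rec[of "a / p"] nz that by (simp_all add: theta_def mult_ac)
  have VU: "theta (a / b) * theta (a / c) * theta (a / d) * theta (a / e) * theta (a / f) = V * U"
    unfolding th(2)[OF nz(2)] th(2)[OF nz(3)] th(2)[OF nz(4)] th(2)[OF nz(5)] th(2)[OF nz(6)]
      V_def U_def by (simp only: mult_ac)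
  have rec: "qpoch_inf q (q / a) = (1 - q / a) * qpoch_inf q (q^2 / a)"
    "qpoch_inf q (a / q) = (1 - a / q) * qpoch_inf q a" "qpoch_inf q a = (1 - a) * qpoch_inf q (a * q)"
    "qpoch_inf q A = (1 - A) * qpoch_inf q (A * q)"
    using qpoch_inf_rec[of "q / a"] qpoch_inf_rec[of "a / q"] qpoch_inf_rec[of a] qpoch_inf_rec[of A]
    by (simp_all add: power2_eq_square)
  have den3: "qpochs_inf q [a, q / a, a / b, b * q / a, a / c, c * q / a, a / d, d * q / a,
        a / e, e * q / a, a / f, f * q / a, s / (a * q), a * q^2 / s] =
      qpoch_inf q a * qpoch_inf q (q / a) * (V * U) * theta z"
    unfolding VU[symmetric] Z unfolding theta_def using nz by (simp add: qpochs_inf_def mult_ac)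
  have num3: "qpochs_inf q [a / q, q^2 / a, b, q / b, c, q / c, d, q / d, e, q / e, f, q / f,
            s / q^2, q^3 / s] = qpoch_inf q (a / q) * qpoch_inf q (q^2 / a) * M"
    unfolding M_def theta_def using nz
    by (simp add: qpochs_inf_def mult_ac power2_eq_square power3_eq_cube)
  have nonzero: "qpoch_inf q a \<noteq> 0" "qpoch_inf q (q / a) \<noteq> 0" "V \<noteq> 0" "U \<noteq> 0" "theta z \<noteq> 0"
    using denominators(3) unfolding den3 by auto
  have A_1: "1 - A \<noteq> 0" using N_nz(2) by (auto simp: N2_def W87_norm_def)
  have cdeq: "c * d * e * q / a^2 = A * q" by (simp add: A_def)
  have Aq_nz: "qpoch_inf q (A * q) \<noteq> 0"
    using denominators(1) unfolding cdeq by (auto simp: qpochs_inf_def)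
  have Q_nz: "qpoch_inf q q \<noteq> 0" using q(2) by (rule qpoch_inf_nonzero)
  have side: "ThetaSide a b c d e f = q / a * theta z * (V * U) - M"
    unfolding ThetaSide_def z_def[symmetric] VU mu(1) M_def ..
  have Bil: "(1 - q / a) * qpoch_inf q (q^2 / a) * Bil a b c d e f =
      q * qpoch_inf q q ^ 2 * ((1 - A) * qpoch_inf q (A * q)) * (q / a * theta z * (V * U) - M)"
    using Defect_eq_0[OF nz] unfolding Defect_def side A_def[symmetric] rec(1,4) by simp
  have N2': "N2 = qpoch_inf q q * (1 - A) * qpoch_inf q (b * f / a) * (qpoch_inf q (d * q / a) *
      qpoch_inf q (e * q / a) * qpoch_inf q (c * q / a) * qpoch_inf q (c * d * e * f / a^2) *
      qpoch_inf q (b * c * d * e / a^2))"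
    unfolding N2_def W87_norm_def W87_arg_eq z2 list.map prod_list.Cons prod_list.Nil bottoms
    by (simp only: mult_ac mult_1_left mult_1_right)
  have N1': "N1 = qpoch_inf q q * (1 - a) * qpoch_inf q (s / (a * q)) * (qpoch_inf q (a * q / b) *
      qpoch_inf q (a * q / c) * qpoch_inf q (a * q / d) * qpoch_inf q (a * q / e) * qpoch_inf q (a * q / f))"
    unfolding N1_def W87_norm_def W87_arg_eq z_def[symmetric] s_z using nz by (simp add: mult_ac)
  \<comment> \<open>The numerator of L_2' cancels against N2, apart from (q^2/a)_inf. Its
    denominator supplies the partners that complete the products in N1 and N2 to U and theta
    z.\<close>
  have L2': "L2 / (N1 * N2) = qpoch_inf q (q^2 / a) /
      (((1 - A) * qpoch_inf q (A * q)) * qpoch_inf q q ^ 2 * (1 - a) * theta z * U)"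
  proof -
    have "qpoch_inf q (b * f / a) \<noteq> 0" "qpoch_inf q (c * d * e * f / a^2) \<noteq> 0"
      "qpoch_inf q (b * c * d * e / a^2) \<noteq> 0"
      using N_nz(2) unfolding N2' by auto
    then show ?thesis
      unfolding L2 cdeq N1' N2' Z U_def by (simp add: qpochs_inf_def power2_eq_square mult_ac)
  qed
  have "L2 * (1 - q) * ((S1 - S2) * W1 * W2 - T1 * W1p * W2 + T2 * W1 * W2p) =
      L2 / (N1 * N2) * Bil a b c d e f"
    unfolding mult.assoc[of L2] bilinear by simp
  also have "\<dots> = qpoch_inf q (q^2 / a) * Bil a b c d e f /
      (((1 - A) * qpoch_inf q (A * q)) * qpoch_inf q q ^ 2 * (1 - a) * theta z * U)"
    unfolding L2' by simp
  also have "\<dots> = - q * V * (qpoch_inf q (a * q) / ((1 - a / q) * ((1 - a) * qpoch_inf q (a * q)))) *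
      (1 + (1 - a / q) * ((1 - a) * qpoch_inf q (a * q)) * qpoch_inf q (q^2 / a) * M /
        ((1 - a) * qpoch_inf q (a * q) * ((1 - q / a) * qpoch_inf q (q^2 / a)) * (V * U) * theta z))"
    by (rule final_algebra[OF nz(1) A_1 Aq_nz nonzero(5,3,4) _ _ Q_nz _ _ _ Bil])
      (use nonzero(1,2) denominators(2) rec in auto)
  finally show ?thesis
    unfolding den3 num3 rec V_def by (simp only: mult.assoc)
qed

end
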